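(* Let $X_1(t)$ be a Pearson diffusion in steady state (of Hermite, Laguerre or Jacobi type, as described in the context), with correlation function $\mathrm{corr}[X_1(t),X_1(s)]=\exp(-\theta|t-s|)$, where $\theta=\lambda_1$ is the smallest positive eigenvalue of the generator $\mathcal{G}$ (in the sign convention $\mathcal{G}Q_n=-\lambda_nQ_n$). Let $D(t)$ be a subordinator with Laplace exponent $\psi(s)=c_1s^{\beta_1}+c_2s^{\beta_2}$, where $c_1,c_2\ge0$, $c_1+c_2=1$ and $0<\beta_1<\beta_2<1$; that is, $\mathbb{E}[e^{-sD(t)}]=e^{-t\psi(s)}$. Let $E(t)=\inf\{\tau\ge0:D(\tau)>t\}$ be the inverse subordinator, independent of $X_1$, and let $X(t)=X_1(E(t))$. Stationary Pearson diffusions exhibit short-range dependence, since their correlation function falls off exponentially fast. However, the correlation function of the time-changed Pearson diffusion $X(t)$ falls off like a power law with exponent $\beta_1\in(0,1)$ ($\beta_1<\beta_2$), and so this process exhibits long-range dependence. More precisely, with $\Phi_\theta$, $h$ and $k$ as in the context: (a) $\Phi_\theta(t)=1-\int_0^t\theta k(\theta,x)\,dx$, where for fixed $\theta$ the function $x\mapsto\theta k(\theta,x)$ is a density function for $x\ge0$; $$\lim_{s\to0}\frac{\theta}{c_1}s^{-\beta_1}\left(\frac{c_1s^{\beta_1}+c_2s^{\beta_2}}{\theta+c_1s^{\beta_1}+c_2s^{\beta_2}}\right)=1;$$ and $$\Phi_\theta(t)\sim\frac{c_1}{\Gamma(1-\beta_1)\,\theta\,t^{\beta_1}},\qquad t\to\infty,$$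 which depends only on the smaller fractional index $\beta_1$. (b) For fixed $s>0$ and any $y\in[0,1]$, $$\Phi_\theta\bigl(t(1-sy/t)\bigr)\sim\frac{c_1}{\Gamma(1-\beta_1)\,\theta\,t^{\beta_1}(1-sy/t)^{\beta_1}},\qquad t\to\infty,$$ and $$\theta\int_0^s h(y)\,\Phi_\theta(t-y)\,dy\sim\frac{s\,c_1}{\Gamma(1-\beta_1)t^{\beta_1}}\int_0^1h(sz)\,dz=\frac{c_1}{c_2}\,\frac{s^{\beta_2}E_{\beta_2-\beta_1,\beta_2+1}\left(-\frac{c_1}{c_2}s^{\beta_2-\beta_1}\right)}{t^{\beta_1}\Gamma(1-\beta_1)},\qquad t\to\infty.$$ (c) For any fixed $s>0$, $$\mathrm{corr}[X(t),X(s)]\sim\frac{1}{t^{\beta_1}\Gamma(1-\beta_1)}\left(\frac{c_1}{\theta}+\frac{c_1}{c_2}\,s^{\beta_2}E_{\beta_2-\beta_1,\beta_2+1}\left(-\frac{c_1}{c_2}s^{\beta_2-\beta_1}\right)\right),\qquad t\to\infty.$$ (d) If one also lets $s\to\infty$, then $$\mathrm{corr}[X(t),X(s)]\sim\frac{1}{t^{\beta_1}\Gamma(1-\beta_1)}\left(\frac{c_1}{\theta}+\frac{s^{\beta_1}}{\Gamma(1+\beta_1)}\right)$$ as $t\to\infty$ and $s\to\infty$.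
   Context: Pearson diffusion: the solution $X_1(t)$ of the stochastic differential equation $dX_1(t)=\mu(X_1(t))\,dt+\sigma(X_1(t))\,dW(t)$, with $W$ a standard Brownian motion, $\mu(x)=a_0+a_1x$ and $D(x)=\sigma^2(x)/2=d_0+d_1x+d_2x^2$ (this polynomial $D(x)$ is not to be confused with the subordinator $D(t)$). Its generator is $\mathcal{G}=\mu(y)\frac{\partial}{\partial y}+\frac{\sigma^2(y)}{2}\frac{\partial^2}{\partial y^2}$, and $m$ denotes the density of its steady-state distribution. It is assumed that one of three cases holds: (1) Hermite: $d_1=d_2=0$ and $d_0>0$, $m$ is a normal density, and the $Q_n$ are Hermite polynomials; (2) Laguerre: $d_2=0$, $m$ is a gamma density, and the $Q_n$ are Laguerre polynomials; (3) Jacobi: $D''(y)<0$ with two positive real roots, $m$ is a beta density, and the $Q_n$ are Jacobi polynomials. Here the $Q_n$ are eigenfunctions of the generator, $\mathcal{G}Q_n=-\lambda_nQ_n$ with $0=\lambda_0<\lambda_1<\lambda_2<\cdots$, forming an orthonormal basis of $L^2(m(y)\,dy)$; in these cases all moments exist. The process $X_1(t)$ is in steady state if its probability density is $m$ for all time; the time-changed process $X_1(E(t))$ is in steady state if it starts with the distribution $m$, and then its mean and variance do not vary over time. $\mathrm{corr}$ denotes the correlation coefficient of two random variables. Functions used: $\Phi_\theta(t)=\int_0^\infty e^{-\theta u}f_t(u)\,du=\mathbb{E}[e^{-\theta E(t)}]$, where $f_t$ is the density of $E(t)$; $h(y)=\frac{1}{c_2}y^{\beta_2-1}E_{\beta_2-\beta_1,\beta_2}\left(-\frac{c_1}{c_2}y^{\beta_2-\beta_1}\right)$;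 and $k(\theta,x)=\int_0^\infty g(x,z)e^{-\theta z}\,dz$, where $g(\cdot,z)$ is the density of $D(z)$, so that $k(\theta,x)=-\frac1\theta\frac{d}{dx}\Phi_\theta(x)$. The Mittag-Leffler function is $E_{\alpha,\beta}(z)=\sum_{j=0}^\infty\frac{z^j}{\Gamma(\alpha j+\beta)}$. The symbol $\sim$ means that the ratio of the two sides tends to $1$ in the indicated limit. Short- and long-range dependence: a process $Y(t)$, $t>0$, with $\mathbb{E}(Y(t))=0$ and $\mathbb{E}(Y^2(t))<\infty$ has short-range dependence if for fixed $t>0$, $\sum_{h=1}^\infty\mathbb{E}(Y(t)Y(t+h))<\infty$ (here $h$ is a summation index), and otherwise has long-range dependence. For the steady-state processes here, which have constant mean and variance, this is read off from the correlation function.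
   Formalization: Asymptotic claims are stated for c1>0 (false or undefined at c1=0), those involving h or 1/c2 also for c2>0; in (d) the limit is taken as t→∞ first and then s→∞, or jointly with s/t→0, since the unrestricted joint limit fails at s=t. *)

theory Defs
  imports
    "HOL-Probability.Probability"
    "HOL-Library.Landau_Symbols"
begin

section \<open>Stochastic differential equations\<close>

definition brownian_motion ::
  "'a measure \<Rightarrow> (real \<Rightarrow> 'a measure) \<Rightarrow> (real \<Rightarrow> 'a \<Rightarrow> real) \<Rightarrow> bool" where
  "brownian_motion M F W \<longleftrightarrow>
     filtration (space M) F \<and> (\<forall>t. subalgebra M (F t)) \<and>
     (\<forall>t\<ge>0. W t \<in> borel_measurable (F t)) \<and>
     (AE \<omega> in M. W 0 \<omega> = 0) \<and>
     (\<forall>\<omega>\<in>space M. continuous_on {0..} (\<lambda>t. W t \<omega>)) \<and>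
     (\<forall>s t. 0 \<le> s \<and> s < t \<longrightarrow>
        distributed M lborel (\<lambda>\<omega>. W t \<omega> - W s \<omega>) (\<lambda>x. ennreal (normal_density 0 (sqrt (t - s)) x)) \<and>
        prob_space.indep_set M
          {(\<lambda>\<omega>. W t \<omega> - W s \<omega>) -` B \<inter> space M | B. B \<in> sets borel} (sets (F s)))"

definition conv_in_prob :: "'a measure \<Rightarrow> (nat \<Rightarrow> 'a \<Rightarrow> real) \<Rightarrow> ('a \<Rightarrow> real) \<Rightarrow> bool" where
  "conv_in_prob M Y Z \<longleftrightarrow>
     (\<forall>\<epsilon>>0. (\<lambda>k. measure M {\<omega> \<in> space M. \<bar>Y k \<omega> - Z \<omega>\<bar> > \<epsilon>}) \<longlonglongrightarrow> 0)"

text \<open>A simple integrand on \<open>[0, T]\<close> is given by a partition \<open>0 = p 0 < \<dots> < p n = T\<close> and bounded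
  random variables \<open>\<xi> i\<close>, where \<open>\<xi> i\<close> is known at time \<open>p i\<close> and is the value on \<open>(p i, p (i+1)]\<close>.\<close>

definition simple_integrand ::
  "'a measure \<Rightarrow> (real \<Rightarrow> 'a measure) \<Rightarrow> real \<Rightarrow> nat \<Rightarrow> (nat \<Rightarrow> real) \<Rightarrow> (nat \<Rightarrow> 'a \<Rightarrow> real) \<Rightarrow> bool" where
  "simple_integrand M F T n p \<xi> \<longleftrightarrow>
     p 0 = 0 \<and> p n = T \<and> (\<forall>i<n. p i < p (Suc i)) \<and>
     (\<forall>i<n. \<xi> i \<in> borel_measurable (F (p i)) \<and> (\<exists>C. \<forall>\<omega>\<in>space M. \<bar>\<xi> i \<omega>\<bar> \<le> C))"

definition simple_value :: "nat \<Rightarrow> (nat \<Rightarrow> real) \<Rightarrow> (nat \<Rightarrow> 'a \<Rightarrow> real) \<Rightarrow> real \<Rightarrow> 'a \<Rightarrow> real" where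
  "simple_value n p \<xi> s \<omega> = (\<Sum>i<n. \<xi> i \<omega> * indicator {p i<..p (Suc i)} s)"

definition simple_integral ::
  "(real \<Rightarrow> 'a \<Rightarrow> real) \<Rightarrow> nat \<Rightarrow> (nat \<Rightarrow> real) \<Rightarrow> (nat \<Rightarrow> 'a \<Rightarrow> real) \<Rightarrow> 'a \<Rightarrow> real" where
  "simple_integral W n p \<xi> \<omega> = (\<Sum>i<n. \<xi> i \<omega> * (W (p (Suc i)) \<omega> - W (p i) \<omega>))"

text \<open>\<open>I\<close> is (a version of) the Ito integral of \<open>H\<close> against \<open>W\<close> over \<open>[0, T]\<close>: simple integrands
  converge to \<open>H\<close> in \<open>L\<^sup>2[0, T]\<close> in probability, and their integrals converge to \<open>I\<close> in probability.\<close>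

definition is_ito_integral ::
  "'a measure \<Rightarrow> (real \<Rightarrow> 'a measure) \<Rightarrow> (real \<Rightarrow> 'a \<Rightarrow> real) \<Rightarrow> (real \<Rightarrow> 'a \<Rightarrow> real) \<Rightarrow> real \<Rightarrow>
     ('a \<Rightarrow> real) \<Rightarrow> bool" where
  "is_ito_integral M F W H T I \<longleftrightarrow>
     (\<lambda>(s, \<omega>). H s \<omega>) \<in> borel_measurable (restrict_space borel {0..T} \<Otimes>\<^sub>M M) \<and>
     I \<in> borel_measurable M \<and>
     (\<exists>n p \<xi>.
        (\<forall>k. simple_integrand M F T (n k) (p k) (\<xi> k)) \<and>
        (\<forall>\<epsilon>>0. (\<lambda>k. measure M {\<omega> \<in> space M.
             (\<integral>\<^sup>+ s\<in>{0..T}. ennreal ((H s \<omega> - simple_value (n k) (p k) (\<xi> k) s \<omega>)\<^sup>2) \<partial>lborel) > ennreal \<epsilon>})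
           \<longlonglongrightarrow> 0) \<and>
        conv_in_prob M (\<lambda>k. simple_integral W (n k) (p k) (\<xi> k)) I)"

definition sde_solution ::
  "'a measure \<Rightarrow> (real \<Rightarrow> 'a measure) \<Rightarrow> (real \<Rightarrow> 'a \<Rightarrow> real) \<Rightarrow> (real \<Rightarrow> real) \<Rightarrow> (real \<Rightarrow> real) \<Rightarrow>
     (real \<Rightarrow> 'a \<Rightarrow> real) \<Rightarrow> bool" where
  "sde_solution M F W \<mu> \<sigma> X \<longleftrightarrow>
     (\<forall>t\<ge>0. X t \<in> borel_measurable (F t)) \<and>
     (\<forall>\<omega>\<in>space M. continuous_on {0..} (\<lambda>t. X t \<omega>)) \<and>
     (\<forall>t\<ge>0. \<exists>I. is_ito_integral M F W (\<lambda>s \<omega>. \<sigma> (X s \<omega>)) t I \<and>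
        (AE \<omega> in M. X t \<omega> = X 0 \<omega> + (LINT s:{0..t}|lborel. \<mu> (X s \<omega>)) + I \<omega>))"


section \<open>Pearson diffusions\<close>

definition pearson_drift :: "real \<Rightarrow> real \<Rightarrow> real \<Rightarrow> real" where
  "pearson_drift a0 a1 x = a0 + a1 * x"

definition pearson_D :: "real \<Rightarrow> real \<Rightarrow> real \<Rightarrow> real \<Rightarrow> real" where
  "pearson_D d0 d1 d2 x = d0 + d1 * x + d2 * x\<^sup>2"

text \<open>\<open>\<sigma>\<close> is only constrained where \<open>D \<ge> 0\<close>, which contains the state space of the diffusion.\<close>

definition pearson_diffusion ::
  "'a measure \<Rightarrow> (real \<Rightarrow> 'a measure) \<Rightarrow> (real \<Rightarrow> 'a \<Rightarrow> real) \<Rightarrow> real \<Rightarrow> real \<Rightarrow> real \<Rightarrow> real \<Rightarrow> real \<Rightarrow>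
     (real \<Rightarrow> 'a \<Rightarrow> real) \<Rightarrow> bool" where
  "pearson_diffusion M F W a0 a1 d0 d1 d2 X \<longleftrightarrow>
     brownian_motion M F W \<and>
     (\<exists>\<sigma>. \<sigma> \<in> borel_measurable borel \<and>
        (\<forall>x. 0 \<le> pearson_D d0 d1 d2 x \<longrightarrow> (\<sigma> x)\<^sup>2 / 2 = pearson_D d0 d1 d2 x) \<and>
        sde_solution M F W (pearson_drift a0 a1) \<sigma> X)"

definition steady_state :: "'a measure \<Rightarrow> (real \<Rightarrow> real) \<Rightarrow> (real \<Rightarrow> 'a \<Rightarrow> real) \<Rightarrow> bool" where
  "steady_state M m X \<longleftrightarrow> (\<forall>t\<ge>0. distributed M lborel (X t) (\<lambda>y. ennreal (m y)))"

definition generator :: "(real \<Rightarrow> real) \<Rightarrow> (real \<Rightarrow> real) \<Rightarrow> (real \<Rightarrow> real) \<Rightarrow> real \<Rightarrow> real" where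
  "generator \<mu> D f y = \<mu> y * deriv f y + D y * deriv (deriv f) y"

fun hermite_poly :: "nat \<Rightarrow> real \<Rightarrow> real" where
  "hermite_poly 0 x = 1"
| "hermite_poly (Suc 0) x = x"
| "hermite_poly (Suc (Suc n)) x = x * hermite_poly (Suc n) x - real (Suc n) * hermite_poly n x"

definition laguerre_poly :: "real \<Rightarrow> nat \<Rightarrow> real \<Rightarrow> real" where
  "laguerre_poly \<alpha> n x = (\<Sum>k\<le>n. (-1) ^ k * ((real n + \<alpha>) gchoose (n - k)) * x ^ k / fact k)"

definition jacobi_poly :: "real \<Rightarrow> real \<Rightarrow> nat \<Rightarrow> real \<Rightarrow> real" where
  "jacobi_poly \<alpha> \<beta> n x =
     (\<Sum>k\<le>n. ((real n + \<alpha>) gchoose (n - k)) * ((real n + \<beta>) gchoose k) *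
        ((x - 1) / 2) ^ k * ((x + 1) / 2) ^ (n - k))"

text \<open>Gamma density with shape \<open>a\<close> and rate \<open>b\<close>, starting at \<open>l\<close>.\<close>

definition gamma_density :: "real \<Rightarrow> real \<Rightarrow> real \<Rightarrow> real \<Rightarrow> real" where
  "gamma_density l a b y =
     (if l < y then b powr a / Gamma a * (y - l) powr (a - 1) * exp (- b * (y - l)) else 0)"

text \<open>Beta density with parameters \<open>p\<close>, \<open>q\<close> on the interval \<open>(l, r)\<close>.\<close>

definition beta_density :: "real \<Rightarrow> real \<Rightarrow> real \<Rightarrow> real \<Rightarrow> real \<Rightarrow> real" where
  "beta_density l r p q y =
     (if l < y \<and> y < r
      then (y - l) powr (p - 1) * (r - y) powr (q - 1) / (Beta p q * (r - l) powr (p + q - 1)) else 0)"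

text \<open>The polynomials are the classical ones in the affine coordinate that standardizes \<open>m\<close>; the
  normalizing constants \<open>\<kappa> n\<close> are determined up to sign by orthonormality, see below.
  The gamma density starts at the zero of \<open>D\<close> (at 0 in the standard case \<open>d0 = 0\<close>), and the beta
  density lives between the zeros of \<open>D\<close>, where \<open>l = 0\<close> admits the standard interval \<open>(0, 1)\<close>.\<close>

definition hermite_case ::
  "real \<Rightarrow> real \<Rightarrow> real \<Rightarrow> (real \<Rightarrow> real) \<Rightarrow> (nat \<Rightarrow> real \<Rightarrow> real) \<Rightarrow> bool" where
  "hermite_case d0 d1 d2 m Q \<longleftrightarrow> d1 = 0 \<and> d2 = 0 \<and> d0 > 0 \<and>
     (\<exists>e sd \<kappa>. sd > 0 \<and> m = normal_density e sd \<and>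
        (\<forall>n y. Q n y = \<kappa> n * hermite_poly n ((y - e) / sd)))"

definition laguerre_case ::
  "real \<Rightarrow> real \<Rightarrow> real \<Rightarrow> (real \<Rightarrow> real) \<Rightarrow> (nat \<Rightarrow> real \<Rightarrow> real) \<Rightarrow> bool" where
  "laguerre_case d0 d1 d2 m Q \<longleftrightarrow> d2 = 0 \<and> d1 > 0 \<and>
     (\<exists>a b \<kappa>. a > 0 \<and> b > 0 \<and> m = gamma_density (- d0 / d1) a b \<and>
        (\<forall>n y. Q n y = \<kappa> n * laguerre_poly (a - 1) n (b * (y - (- d0 / d1)))))"

definition jacobi_case ::
  "real \<Rightarrow> real \<Rightarrow> real \<Rightarrow> (real \<Rightarrow> real) \<Rightarrow> (nat \<Rightarrow> real \<Rightarrow> real) \<Rightarrow> bool" where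
  "jacobi_case d0 d1 d2 m Q \<longleftrightarrow> d2 < 0 \<and>
     (\<exists>l r. 0 \<le> l \<and> l < r \<and> pearson_D d0 d1 d2 l = 0 \<and> pearson_D d0 d1 d2 r = 0 \<and>
       (\<exists>p q \<kappa>. p > 0 \<and> q > 0 \<and> m = beta_density l r p q \<and>
          (\<forall>n y. Q n y = \<kappa> n * jacobi_poly (q - 1) (p - 1) n (2 * (y - l) / (r - l) - 1))))"

definition orthonormal_basis_L2 :: "(real \<Rightarrow> real) \<Rightarrow> (nat \<Rightarrow> real \<Rightarrow> real) \<Rightarrow> bool" where
  "orthonormal_basis_L2 m Q \<longleftrightarrow>
     (\<forall>i j. integrable lborel (\<lambda>y. Q i y * Q j y * m y) \<and>
        (LINT y|lborel. Q i y * Q j y * m y) = (if i = j then 1 else 0)) \<and>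
     (\<forall>f. f \<in> borel_measurable borel \<and> integrable lborel (\<lambda>y. (f y)\<^sup>2 * m y) \<longrightarrow>
        (\<lambda>N. LINT y|lborel. (f y - (\<Sum>n<N. (LINT z|lborel. f z * Q n z * m z) * Q n y))\<^sup>2 * m y)
          \<longlonglongrightarrow> 0)"

definition pearson_spectrum ::
  "real \<Rightarrow> real \<Rightarrow> real \<Rightarrow> real \<Rightarrow> real \<Rightarrow> (real \<Rightarrow> real) \<Rightarrow> (nat \<Rightarrow> real \<Rightarrow> real) \<Rightarrow> (nat \<Rightarrow> real) \<Rightarrow> bool" where
  "pearson_spectrum a0 a1 d0 d1 d2 m Q lam \<longleftrightarrow>
     lam 0 = 0 \<and> strict_mono lam \<and>
     (\<forall>n y. generator (pearson_drift a0 a1) (pearson_D d0 d1 d2) (Q n) y = - lam n * Q n y) \<and>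
     orthonormal_basis_L2 m Q"


section \<open>Subordinators and time change\<close>

definition subordinator :: "'a measure \<Rightarrow> (real \<Rightarrow> 'a \<Rightarrow> real) \<Rightarrow> bool" where
  "subordinator M D \<longleftrightarrow>
     (\<forall>t\<ge>0. D t \<in> borel_measurable M) \<and>
     (AE \<omega> in M. D 0 \<omega> = 0) \<and>
     (\<forall>\<omega>\<in>space M. mono_on {0..} (\<lambda>t. D t \<omega>) \<and> (\<forall>t\<ge>0. continuous (at_right t) (\<lambda>u. D u \<omega>))) \<and>
     (\<forall>n p. 0 \<le> p 0 \<and> strict_mono p \<longrightarrow>
        prob_space.indep_vars M (\<lambda>_. borel) (\<lambda>i \<omega>. D (p (Suc i)) \<omega> - D (p i) \<omega>) {..<n::nat}) \<and>
     (\<forall>s t. 0 \<le> s \<and> s \<le> t \<longrightarrow> distr M borel (\<lambda>\<omega>. D t \<omega> - D s \<omega>) = distr M borel (D (t - s)))"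

definition has_laplace_exponent ::
  "'a measure \<Rightarrow> (real \<Rightarrow> 'a \<Rightarrow> real) \<Rightarrow> (real \<Rightarrow> real) \<Rightarrow> bool" where
  "has_laplace_exponent M D \<psi> \<longleftrightarrow>
     (\<forall>s>0. \<forall>t\<ge>0. (LINT \<omega>|M. exp (- s * D t \<omega>)) = exp (- t * \<psi> s))"

text \<open>The value 0 is a convention for bounded paths, where the infimum is over the empty set; for the
  subordinators considered here this is a null event.\<close>

definition inverse_subordinator :: "(real \<Rightarrow> 'a \<Rightarrow> real) \<Rightarrow> real \<Rightarrow> 'a \<Rightarrow> real" where
  "inverse_subordinator D t \<omega> =
     (if \<exists>\<tau>\<ge>0. D \<tau> \<omega> > t then Inf {\<tau>. 0 \<le> \<tau> \<and> D \<tau> \<omega> > t} else 0)"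

definition time_change :: "(real \<Rightarrow> 'a \<Rightarrow> real) \<Rightarrow> (real \<Rightarrow> 'a \<Rightarrow> real) \<Rightarrow> real \<Rightarrow> 'a \<Rightarrow> real" where
  "time_change X E t \<omega> = X (E t \<omega>) \<omega>"

text \<open>Independence of whole processes on \<open>[0, \<infinity>)\<close>, i.e. of their path-valued random variables.\<close>

definition indep_processes ::
  "'a measure \<Rightarrow> (real \<Rightarrow> 'a \<Rightarrow> real) \<Rightarrow> (real \<Rightarrow> 'a \<Rightarrow> real) \<Rightarrow> bool" where
  "indep_processes M Y Z \<longleftrightarrow>
     prob_space.indep_var M
       (Pi\<^sub>M {0..} (\<lambda>_. borel)) (\<lambda>\<omega>. \<lambda>t\<in>{0..}. Y t \<omega>)
       (Pi\<^sub>M {0..} (\<lambda>_. borel)) (\<lambda>\<omega>. \<lambda>t\<in>{0..}. Z t \<omega>)"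

text \<open>\<open>g x z\<close> is the density of \<open>D z\<close> at \<open>x\<close>. Joint measurability is needed because densities are
  only determined up to null sets, separately for each \<open>z\<close>.\<close>

definition density_family :: "'a measure \<Rightarrow> (real \<Rightarrow> 'a \<Rightarrow> real) \<Rightarrow> (real \<Rightarrow> real \<Rightarrow> real) \<Rightarrow> bool" where
  "density_family M D g \<longleftrightarrow>
     (\<lambda>(x, z). g x z) \<in> borel_measurable (borel \<Otimes>\<^sub>M borel) \<and>
     (\<forall>x z. 0 \<le> g x z) \<and>
     (\<forall>z>0. distributed M lborel (D z) (\<lambda>x. ennreal (g x z)))"

definition Phi :: "'a measure \<Rightarrow> (real \<Rightarrow> 'a \<Rightarrow> real) \<Rightarrow> real \<Rightarrow> real \<Rightarrow> real" where
  "Phi M E \<theta> t = (LINT \<omega>|M. exp (- \<theta> * E t \<omega>))"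

definition k_fun :: "(real \<Rightarrow> real \<Rightarrow> real) \<Rightarrow> real \<Rightarrow> real \<Rightarrow> real" where
  "k_fun g \<theta> x = (LINT z:{0..}|lborel. g x z * exp (- \<theta> * z))"

definition mittag_leffler :: "real \<Rightarrow> real \<Rightarrow> real \<Rightarrow> real" where
  "mittag_leffler \<alpha> \<beta> z = (\<Sum>j. z ^ j / Gamma (\<alpha> * real j + \<beta>))"

definition h_fun :: "real \<Rightarrow> real \<Rightarrow> real \<Rightarrow> real \<Rightarrow> real \<Rightarrow> real" where
  "h_fun c1 c2 \<beta>1 \<beta>2 y =
     1 / c2 * y powr (\<beta>2 - 1) * mittag_leffler (\<beta>2 - \<beta>1) \<beta>2 (- (c1 / c2) * y powr (\<beta>2 - \<beta>1))"


section \<open>Correlation and dependence\<close>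

definition corr :: "'a measure \<Rightarrow> ('a \<Rightarrow> real) \<Rightarrow> ('a \<Rightarrow> real) \<Rightarrow> real" where
  "corr M Y Z =
     (LINT \<omega>|M. (Y \<omega> - (LINT w|M. Y w)) * (Z \<omega> - (LINT w|M. Z w))) /
     (sqrt (LINT \<omega>|M. (Y \<omega> - (LINT w|M. Y w))\<^sup>2) * sqrt (LINT \<omega>|M. (Z \<omega> - (LINT w|M. Z w))\<^sup>2))"

definition centered :: "'a measure \<Rightarrow> (real \<Rightarrow> 'a \<Rightarrow> real) \<Rightarrow> real \<Rightarrow> 'a \<Rightarrow> real" where
  "centered M X t \<omega> = X t \<omega> - (LINT w|M. X t w)"

definition centered_L2_process :: "'a measure \<Rightarrow> (real \<Rightarrow> 'a \<Rightarrow> real) \<Rightarrow> bool" where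
  "centered_L2_process M Y \<longleftrightarrow>
     (\<forall>t>0. Y t \<in> borel_measurable M \<and> (LINT \<omega>|M. Y t \<omega>) = 0 \<and> integrable M (\<lambda>\<omega>. (Y t \<omega>)\<^sup>2))"

definition short_range_dependent :: "'a measure \<Rightarrow> (real \<Rightarrow> 'a \<Rightarrow> real) \<Rightarrow> real \<Rightarrow> bool" where
  "short_range_dependent M Y t \<longleftrightarrow>
     centered_L2_process M Y \<and> summable (\<lambda>n. LINT \<omega>|M. Y t \<omega> * Y (t + real (Suc n)) \<omega>)"

definition long_range_dependent :: "'a measure \<Rightarrow> (real \<Rightarrow> 'a \<Rightarrow> real) \<Rightarrow> real \<Rightarrow> bool" where
  "long_range_dependent M Y t \<longleftrightarrow>
     centered_L2_process M Y \<and> \<not> summable (\<lambda>n. LINT \<omega>|M. Y t \<omega> * Y (t + real (Suc n)) \<omega>)"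

end

theory Submission
  imports Defs
begin

text \<open>
  Conditioning on the time change reduces the correlation of \<open>X(t)\<close> and \<open>X(s)\<close> to
  \<open>E exp (-\<theta> (E(t) - E(s)))\<close>. Expanding the exponential over pairs \<open>u < E(s)\<close>, \<open>v \<ge> E(t)\<close> and using
  \<open>{u < E(s)} = {D(u) \<le> s}\<close> up to null sets, the independence of \<open>D(u)\<close> and \<open>D(v) - D(u)\<close> gives,
  with \<open>U(s) = E[E(s)]\<close>,
  \<open>\<Phi>(t) (1 + \<theta> U(s)) \<le> corr[X(t), X(s)] \<le> \<Phi>(t) + \<theta> U(s) \<Phi>(t - s)\<close>.
  Both \<open>\<Phi>\<close> and \<open>U\<close> are monotone with Laplace transforms \<open>\<psi>(s) / (s (\<theta> + \<psi>(s)))\<close> and \<open>1 / (s \<psi>(s))\<close>, so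
  a Tauberian argument turns the behaviour of \<open>\<psi>\<close> at \<open>0\<close> into power laws at infinity. The formula
  \<open>U(s) = \<integral>\<^sub>0\<^sup>s h\<close> comes from the uniqueness of Laplace transforms; the two transforms are only compared
  for large arguments, where the Mittag-Leffler series may be transformed term by term.
\<close>

section \<open>A continuity theorem for Laplace transforms of monotone functions\<close>

text \<open>One continuity theorem does all inversion of transforms. Applied to the rescalings
  \<open>l powr (1 - \<gamma>) * F (l * t)\<close> it is the Tauberian theorem; applied to a
  constant sequence it is uniqueness. Monotonicity of the functions takes the place of any
  regularity in \<open>t\<close>. The obstacle to an exact correlation formula is the undershoot: on
  D(u) \<le> s the later increment has to exceed t - D(u), a random level between t - s and t.
  Replacing it by either end gives the two bounds. They differ by a shift of \<open>\<Phi>\<close>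
  by s, which a power law does not feel as long as s/t tends to 0, whatever the size of the mean of
  E(s). Hence fixed s and growing s fall under one limit theorem. Atoms of the law of E(t) are
  avoided rather than excluded: events are compared only for almost every level u, which is enough
  under the integrals over u and v. The asymptotics are stated for a pair \<open>\<beta>\<close>,
  \<open>c\<close> with s^(-\<beta>) \<psi>(s) tending to c and not for \<open>\<beta>1\<close>,
  \<open>c1\<close>, because long-range dependence is also claimed at \<open>c1 = 0\<close>, where
  the exponent is \<open>\<beta>2\<close>.\<close>

text \<open>The method of moments on [0,1]: convergence against all powers of \<open>e\<close>
  passes to polynomials and, by Stone-Weierstrass, to every continuous \<open>q\<close>. The
  approximation error is controlled by the mass of \<open>f i\<close>; as \<open>f i\<close> is
  nonnegative, that mass is the zeroth moment and therefore eventually bounded. The limit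
  \<open>g\<close> may change sign.\<close>

lemma weighted_integral_tendsto:
  fixes N :: "'x measure" and f :: "'i \<Rightarrow> 'x \<Rightarrow> real" and e g :: "'x \<Rightarrow> real" and q :: "real \<Rightarrow> real"
  assumes e: "e \<in> borel_measurable N" "\<And>x. x \<in> space N \<Longrightarrow> e x \<in> {0..1}"
    and f: "\<forall>\<^sub>F i in Fl. integrable N (f i) \<and> (\<forall>x\<in>space N. 0 \<le> f i x)"
    and g: "integrable N g"
    and lim: "\<And>n::nat. ((\<lambda>i. LINT x|N. e x ^ n * f i x) \<longlongrightarrow> (LINT x|N. e x ^ n * g x)) Fl"
    and q: "continuous_on {0..1} q"
  shows "((\<lambda>i. LINT x|N. q (e x) * f i x) \<longlongrightarrow> (LINT x|N. q (e x) * g x)) Fl"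
proof -
  have intb: "integrable N (\<lambda>x. r (e x) * k x)"
    if r: "continuous_on {0..1} r" and k: "integrable N k" for r :: "real \<Rightarrow> real" and k
  proof -
    have "bounded (r ` {0..1})"
      using r by (intro compact_imp_bounded compact_continuous_image) auto
    then obtain B where B: "\<And>y. y \<in> {0..1} \<Longrightarrow> \<bar>r y\<bar> \<le> B"
      unfolding bounded_iff by fastforce
    have re: "e \<in> measurable N (restrict_space borel {0..1})"
      using e by (intro measurable_restrict_space2) auto
    have "r \<in> borel_measurable (restrict_space borel {0..1})"
      using r by (rule borel_measurable_continuous_on_restrict)
    from measurable_compose[OF re this] have m: "(\<lambda>x. r (e x)) \<in> borel_measurable N" .
    show ?thesis
    proof (rule Bochner_Integration.integrable_bound[of _ "\<lambda>x. B * k x"])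
      show "integrable N (\<lambda>x. B * k x)" using k by simp
      show "(\<lambda>x. r (e x) * k x) \<in> borel_measurable N" using m k by measurable
      show "AE x in N. norm (r (e x) * k x) \<le> norm (B * k x)"
      proof (rule AE_I2)
        fix x assume "x \<in> space N"
        then have "\<bar>r (e x)\<bar> \<le> \<bar>B\<bar>" using B e(2) by fastforce
        then show "norm (r (e x) * k x) \<le> norm (B * k x)"
          by (simp add: abs_mult mult_right_mono)
      qed
    qed
  qed
  have poly: "((\<lambda>i. LINT x|N. (\<Sum>j\<le>n. a j * e x ^ j) * f i x) \<longlongrightarrow> (LINT x|N. (\<Sum>j\<le>n. a j * e x ^ j) * g x)) Fl"
    for a :: "nat \<Rightarrow> real" and n
  proof -
    have eq: "(LINT x|N. (\<Sum>j\<le>n. a j * e x ^ j) * k x) = (\<Sum>j\<le>n. a j * (LINT x|N. e x ^ j * k x))"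
      if "integrable N k" for k
    proof -
      have "(LINT x|N. (\<Sum>j\<le>n. a j * e x ^ j) * k x) = (LINT x|N. (\<Sum>j\<le>n. a j * (e x ^ j * k x)))"
        by (simp add: sum_distrib_right mult.assoc)
      also have "\<dots> = (\<Sum>j\<le>n. a j * (LINT x|N. e x ^ j * k x))"
      proof (subst Bochner_Integration.integral_sum)
        show "integrable N (\<lambda>x. a j * (e x ^ j * k x))" if "j \<in> {..n}" for j
          using intb[of "\<lambda>y. y ^ j", OF _ \<open>integrable N k\<close>] by (simp add: continuous_on_power)
      qed simp
      finally show ?thesis .
    qed
    have "((\<lambda>i. \<Sum>j\<le>n. a j * (LINT x|N. e x ^ j * f i x)) \<longlongrightarrow> (\<Sum>j\<le>n. a j * (LINT x|N. e x ^ j * g x))) Fl"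
      by (intro tendsto_sum tendsto_mult lim tendsto_const)
    moreover have "\<forall>\<^sub>F i in Fl. (\<Sum>j\<le>n. a j * (LINT x|N. e x ^ j * f i x)) = (LINT x|N. (\<Sum>j\<le>n. a j * e x ^ j) * f i x)"
      using f by eventually_elim (simp add: eq)
    ultimately show ?thesis
      using eq[OF g] by (simp add: tendsto_cong)
  qed
  have lim0: "((\<lambda>i. LINT x|N. f i x) \<longlongrightarrow> (LINT x|N. g x)) Fl" using lim[of 0] by simp
  define G where "G = (LINT x|N. \<bar>g x\<bar>)"
  \<comment> \<open>\<open>B\<close> eventually bounds the mass of \<open>f i\<close>, whose limit
    is the integral of \<open>g\<close>; \<open>G\<close> is the mass of \<open>g\<close> itself.
    The tolerance \<open>d\<close> below makes both approximation errors smaller than a third of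
    \<open>\<epsilon>\<close>.\<close>
  define B where "B = \<bar>LINT x|N. g x\<bar> + 1"
  show ?thesis
  proof (rule tendstoI)
    fix \<epsilon> :: real assume \<epsilon>: "\<epsilon> > 0"
    define d where "d = \<epsilon> / (3 * (G + B + 1))"
    have G0: "G \<ge> 0" "B > 0" unfolding G_def B_def by auto
    then have d: "d > 0" unfolding d_def using \<epsilon> by auto
    have dG: "d * G < \<epsilon> / 3" and dB: "d * B < \<epsilon> / 3"
      unfolding d_def using \<epsilon> G0 by (auto simp: field_simps intro!: add_pos_nonneg)
    obtain p where p: "real_polynomial_function p" "\<And>y. y \<in> {0..1} \<Longrightarrow> \<bar>q y - p y\<bar> < d"
      using Stone_Weierstrass_real_polynomial_function[OF _ q d] by auto
    then obtain a n where pa: "p = (\<lambda>x. \<Sum>j\<le>n. a j * x ^ j)"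
      using real_polynomial_function_iff_sum by auto
    have pc: "continuous_on {0..1} p" unfolding pa by (intro continuous_intros)
    have close: "\<bar>(LINT x|N. q (e x) * k x) - (LINT x|N. p (e x) * k x)\<bar> \<le> d * (LINT x|N. \<bar>k x\<bar>)"
      if k: "integrable N k" for k
    proof -
      have "(LINT x|N. q (e x) * k x) - (LINT x|N. p (e x) * k x) = (LINT x|N. (q (e x) - p (e x)) * k x)"
        using intb[OF q k] intb[OF pc k] by (simp add: left_diff_distrib)
      also have "\<bar>\<dots>\<bar> \<le> (LINT x|N. \<bar>(q (e x) - p (e x)) * k x\<bar>)"
        by (rule integral_abs_bound)
      also have "\<dots> \<le> (LINT x|N. d * \<bar>k x\<bar>)"
      proof (rule integral_mono)
        show "integrable N (\<lambda>x. \<bar>(q (e x) - p (e x)) * k x\<bar>)"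
          using intb[OF q k] intb[OF pc k] by (simp add: left_diff_distrib)
        show "integrable N (\<lambda>x. d * \<bar>k x\<bar>)" using k by simp
        show "\<bar>(q (e x) - p (e x)) * k x\<bar> \<le> d * \<bar>k x\<bar>" if "x \<in> space N" for x
          using p(2)[OF e(2)[OF that]] by (simp add: abs_mult mult_right_mono)
      qed
      finally show ?thesis by simp
    qed
    have ev1: "\<forall>\<^sub>F i in Fl. dist (LINT x|N. p (e x) * f i x) (LINT x|N. p (e x) * g x) < \<epsilon> / 3"
      using poly[of a n] \<epsilon> unfolding pa by (intro tendstoD) auto
    have ev2: "\<forall>\<^sub>F i in Fl. dist (LINT x|N. f i x) (LINT x|N. g x) < 1"
      using lim0 by (intro tendstoD) auto
    show "\<forall>\<^sub>F i in Fl. dist (LINT x|N. q (e x) * f i x) (LINT x|N. q (e x) * g x) < \<epsilon>"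
      using ev1 ev2 f
    proof eventually_elim
      case (elim i)
      have "(LINT x|N. \<bar>f i x\<bar>) = (LINT x|N. f i x)"
        using elim by (intro Bochner_Integration.integral_cong) auto
      then have "(LINT x|N. \<bar>f i x\<bar>) \<le> B" unfolding B_def using elim by (auto simp: dist_real_def)
      then have "d * (LINT x|N. \<bar>f i x\<bar>) \<le> d * B" using d by simp
      then show ?case
        using close[of "f i"] close[OF g] elim dG dB unfolding G_def dist_real_def by linarith
    qed
  qed
qed

text \<open>Laplace transforms are written with this factor as integrals over the whole line, so
  that an affine substitution applies directly and values at arguments \<le> 0 never matter.\<close>

definition pos :: "real \<Rightarrow> real" where "pos t = indicator {0<..} t"

lemma pos_simps: "t > 0 \<Longrightarrow> pos t = 1" "t \<le> 0 \<Longrightarrow> pos t = 0" "0 \<le> pos t" "pos t \<le> 1"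
  by (auto simp: pos_def)

lemma pos_measurable [measurable]: "pos \<in> borel_measurable borel"
  unfolding pos_def by measurable

text \<open>Test functions of the form \<open>q (exp (-t))\<close> suffice, since Laplace transforms at \<open>s0 + n\<close> are integrals
  against polynomials in \<open>exp (-t)\<close>; the tent function \<open>q\<close> below localizes to \<open>[a, b]\<close>.\<close>
lemma laplace_tendsto_interval:
  fixes f :: "'i \<Rightarrow> real \<Rightarrow> real" and g :: "real \<Rightarrow> real"
  assumes f: "\<forall>\<^sub>F i in Fl. integrable lborel (\<lambda>t. pos t * (exp (- s0 * t) * f i t)) \<and> (\<forall>t>0. 0 \<le> f i t)"
    and g: "integrable lborel (\<lambda>t. pos t * (exp (- s0 * t) * g t))"
    and lim: "\<And>n::nat. ((\<lambda>i. LINT t|lborel. pos t * (exp (- (s0 + real n) * t) * f i t))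
                 \<longlongrightarrow> (LINT t|lborel. pos t * (exp (- (s0 + real n) * t) * g t))) Fl"
    and ab: "0 < a" "a < b"
  shows "(\<And>t. t \<in> {a..b} \<Longrightarrow> g t \<le> u) \<Longrightarrow> u < u' \<Longrightarrow> \<forall>\<^sub>F i in Fl. \<exists>t\<in>{a..b}. f i t < u'"
    and "(\<And>t. t \<in> {a..b} \<Longrightarrow> u \<le> g t) \<Longrightarrow> u' < u \<Longrightarrow> \<forall>\<^sub>F i in Fl. \<exists>t\<in>{a..b}. f i t > u'"
proof -
  define q where "q = (\<lambda>y::real. max 0 (min (y - exp (-b)) (exp (-a) - y)))"
  have qc: "continuous_on S q" for S unfolding q_def by (intro continuous_intros)
  \<comment> \<open>The minimum with 1 keeps \<open>e\<close> in [0,1] at negative arguments as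
    well; there the factor \<open>pos\<close> annihilates the integrand.\<close>
  define e where "e = (\<lambda>t::real. min 1 (exp (-t)))"
  have em: "e \<in> borel_measurable lborel" unfolding e_def by measurable
  have e1: "pos t * (e t ^ n * x) = pos t * (exp (- real n * t) * x)" for t n x
  proof (cases "t > 0")
    case True
    then have "e t = exp (- t)" by (simp add: e_def)
    then have "e t ^ n = exp (- real n * t)" using exp_of_nat_mult[of n "-t"] by simp
    then show ?thesis by simp
  qed (simp add: pos_simps)
  have conv: "((\<lambda>i. LINT t|lborel. q (e t) * (pos t * (exp (- s0 * t) * f i t)))
      \<longlongrightarrow> (LINT t|lborel. q (e t) * (pos t * (exp (- s0 * t) * g t)))) Fl"
  proof (rule weighted_integral_tendsto[OF em])
    show "\<forall>\<^sub>F i in Fl. integrable lborel (\<lambda>t. pos t * (exp (- s0 * t) * f i t)) \<and>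
         (\<forall>x\<in>space lborel. 0 \<le> pos x * (exp (- s0 * x) * f i x))"
      using f by eventually_elim (auto simp: pos_def split: split_indicator)
    have eq: "e x ^ n * (pos x * (exp (- s0 * x) * k)) = pos x * (exp (- (s0 + real n) * x) * k)" for x n k
    proof -
      have "e x ^ n * (pos x * (exp (- s0 * x) * k)) = pos x * (e x ^ n * (exp (- s0 * x) * k))" by simp
      also have "\<dots> = pos x * (exp (- real n * x) * (exp (- s0 * x) * k))" by (rule e1)
      also have "exp (- real n * x) * (exp (- s0 * x) * k) = exp (- (s0 + real n) * x) * k"
        by (simp add: exp_add[symmetric] algebra_simps flip: mult.assoc)
      finally show ?thesis .
    qed
    show "((\<lambda>i. LINT x|lborel. e x ^ n * (pos x * (exp (- s0 * x) * f i x)))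
          \<longlongrightarrow> (LINT x|lborel. e x ^ n * (pos x * (exp (- s0 * x) * g x)))) Fl" for n
      unfolding eq by (rule lim)
  qed (use g qc in \<open>auto simp: e_def\<close>)
  \<comment> \<open>All factors besides \<open>f i\<close> form one weight, which is positive
    exactly on the open interval from \<open>a\<close> to \<open>b\<close>. After division by its
    integral \<open>I\<close>, the functional \<open>J\<close> is an average over that
    interval.\<close>
  define w where "w = (\<lambda>t. q (e t) * (pos t * exp (- s0 * t)))"
  have w0: "0 \<le> w t" for t unfolding w_def q_def by (auto simp: pos_simps)
  have wout: "w t = 0" if "t \<notin> {a<..<b}" for t
  proof (cases "t > 0")
    case True
    then have "e t = exp (-t)" by (simp add: e_def)
    moreover have "exp (-a) \<le> exp (-t) \<or> exp (-t) \<le> exp (-b)" using that by auto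
    ultimately have "min (e t - exp (-b)) (exp (-a) - e t) \<le> 0" by linarith
    then have "q (e t) = 0" unfolding q_def by simp
    then show ?thesis by (simp add: w_def)
  qed (simp add: w_def pos_simps)
  have win: "w t > 0" if "t \<in> {a<..<b}" for t
    using that ab by (auto simp: w_def q_def e_def pos_simps)
  have wm[measurable]: "w \<in> borel_measurable borel"
    unfolding w_def q_def e_def by measurable
  have wi: "integrable lborel w"
  proof -
    \<comment> \<open>The sign of \<open>s0\<close> is open, so the exponential is bounded on the
      interval by the larger of its two endpoint values.\<close>
    have "w t \<le> indicator {a..b} t * max (exp (- s0 * a)) (exp (- s0 * b))" for t
    proof (cases "t \<in> {a<..<b}")
      case True
      have e: "e t = exp (-t)" using True ab by (simp add: e_def)
      have "exp (-t) \<le> 1" using True ab by simp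
      moreover have "exp (-b) \<ge> 0" by simp
      ultimately have "exp (-t) - exp (-b) \<le> 1" by linarith
      then have "q (e t) \<le> 1" unfolding q_def e by auto
      moreover have "exp (- s0 * t) \<le> max (exp (- s0 * a)) (exp (- s0 * b))"
      proof (cases "s0 \<ge> 0")
        case s: True
        have "s0 * a \<le> s0 * t" using True s by (intro mult_left_mono) auto
        then show ?thesis by (simp add: le_max_iff_disj)
      next
        case False
        then have "s0 * b \<le> s0 * t" using True by (intro mult_left_mono_neg) auto
        then show ?thesis by (simp add: le_max_iff_disj)
      qed
      ultimately have "w t \<le> 1 * max (exp (- s0 * a)) (exp (- s0 * b))"
        unfolding w_def using True ab by (intro mult_mono) (auto simp: pos_simps)
      then show ?thesis using True by auto
    next
      case False
      then show ?thesis using wout by (auto simp: indicator_def le_max_iff_disj)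
    qed
    moreover have "integrable lborel (\<lambda>t. indicator {a..b} t * max (exp (- s0 * a)) (exp (- s0 * b)))"
      by (intro integrable_mult_left) (intro integrable_real_indicator, auto simp: emeasure_lborel_Icc_eq)
    ultimately have bd: "integrable lborel (\<lambda>t. indicator {a..b} t * max (exp (- s0 * a)) (exp (- s0 * b)))"
      "norm (w t) \<le> norm (indicator {a..b} t * max (exp (- s0 * a)) (exp (- s0 * b)))" for t
      using w0 by (auto intro: order_trans[OF _ abs_ge_self])
    show ?thesis
      by (rule Bochner_Integration.integrable_bound[OF bd(1)]) (use bd(2) wm in auto)
  qed
  define I where "I = (LINT t|lborel. w t)"
  have Ipos: "I > 0"
  proof -
    have "I \<noteq> 0"
    proof
      assume "I = 0"
      then have "AE t in lborel. w t = 0"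
        unfolding I_def using integral_nonneg_eq_0_iff_AE[OF wi] w0 by auto
      then have "AE t in lborel. t \<notin> {a<..<b}"
        by eventually_elim (metis win less_irrefl)
      then have "emeasure lborel {a<..<b} = 0"
        using AE_iff_measurable[of "{a<..<b}" lborel "\<lambda>t. t \<notin> {a<..<b}"]
        by (simp add: set_eq_iff del: greaterThanLessThan_iff)
      then show False using ab by simp
    qed
    moreover have "I \<ge> 0" unfolding I_def using w0 by simp
    ultimately show ?thesis by simp
  qed
  define J where "J = (\<lambda>k. LINT t|lborel. q (e t) * (pos t * (exp (- s0 * t) * k t)))"
  have Jeq: "J k = (LINT t|lborel. w t * k t)" for k
    unfolding J_def w_def by (simp only: mult.assoc)
  have Jint: "integrable lborel (\<lambda>t. w t * k t)" if "integrable lborel (\<lambda>t. pos t * (exp (- s0 * t) * k t))" for k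
  proof -
    have "integrable lborel (\<lambda>t. q (e t) * (pos t * (exp (- s0 * t) * k t)))"
    proof (rule Bochner_Integration.integrable_bound[OF that])
      have "(\<lambda>t. q (e t)) \<in> borel_measurable lborel" unfolding q_def e_def by measurable
      then show "(\<lambda>t. q (e t) * (pos t * (exp (- s0 * t) * k t))) \<in> borel_measurable lborel"
        by (rule borel_measurable_times[OF _ borel_measurable_integrable[OF that]])
      have "\<bar>q (e t)\<bar> \<le> 1" for t
      proof -
        have "e t \<le> 1" "0 \<le> exp (- b)" unfolding e_def by auto
        then have "min (e t - exp (-b)) (exp (-a) - e t) \<le> 1" by linarith
        then show ?thesis unfolding q_def by simp
      qed
      then have "norm (q (e x) * y) \<le> norm y" for x y
        using mult_right_mono[of "\<bar>q (e x)\<bar>" 1 "\<bar>y\<bar>"] by (simp add: abs_mult)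
      then show "AE x in lborel. norm (q (e x) * (pos x * (exp (- s0 * x) * k x))) \<le> norm (pos x * (exp (- s0 * x) * k x))"
        by (intro AE_I2)
    qed
    then show ?thesis unfolding w_def by (simp only: mult.assoc)
  qed
  have up: "J k \<le> u * I" if k: "integrable lborel (\<lambda>t. pos t * (exp (- s0 * t) * k t))" "\<And>t. t \<in> {a..b} \<Longrightarrow> k t \<le> u" for k u
  proof -
    have "J k \<le> (LINT t|lborel. w t * u)" unfolding Jeq
    proof (rule integral_mono[OF Jint[OF k(1)]])
      show "integrable lborel (\<lambda>t. w t * u)" using wi by simp
      show "w t * k t \<le> w t * u" for t
        using wout[of t] w0[of t] k(2)[of t] by (cases "t \<in> {a<..<b}") (auto intro!: mult_left_mono)
    qed
    then show ?thesis by (simp add: I_def mult.commute)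
  qed
  have low: "u * I \<le> J k" if k: "integrable lborel (\<lambda>t. pos t * (exp (- s0 * t) * k t))" "\<And>t. t \<in> {a..b} \<Longrightarrow> u \<le> k t" for k u
  proof -
    have "(LINT t|lborel. w t * u) \<le> J k" unfolding Jeq
    proof (rule integral_mono[OF _ Jint[OF k(1)]])
      show "integrable lborel (\<lambda>t. w t * u)" using wi by simp
      show "w t * u \<le> w t * k t" for t
        using wout[of t] w0[of t] k(2)[of t] by (cases "t \<in> {a<..<b}") (auto intro!: mult_left_mono)
    qed
    then show ?thesis by (simp add: I_def mult.commute)
  qed
  have conv': "((\<lambda>i. J (f i)) \<longlongrightarrow> J g) Fl" using conv unfolding J_def .
  show "\<forall>\<^sub>F i in Fl. \<exists>t\<in>{a..b}. f i t < u'" if "\<And>t. t \<in> {a..b} \<Longrightarrow> g t \<le> u" "u < u'"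
  proof -
    \<comment> \<open>The average of \<open>g\<close> is below \<open>u'\<close>, hence eventually
      that of \<open>f i\<close> too; if \<open>f i\<close> were at least \<open>u'\<close> on the
      whole interval, \<open>low\<close> would contradict this.\<close>
    have "J g \<le> u * I" using up[OF g] that by blast
    also have "\<dots> < u' * I" using that Ipos by simp
    finally have "\<forall>\<^sub>F i in Fl. J (f i) < u' * I" using conv' by (intro order_tendstoD)
    then show ?thesis using f
    proof eventually_elim
      case (elim i)
      then show ?case using low[of "f i" u'] by (meson leI linorder_not_less)
    qed
  qed
  show "\<forall>\<^sub>F i in Fl. \<exists>t\<in>{a..b}. f i t > u'" if "\<And>t. t \<in> {a..b} \<Longrightarrow> u \<le> g t" "u' < u"
  proof -
    have "u' * I < u * I" using that Ipos by simp
    also have "u * I \<le> J g" using low[OF g] that by blast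
    finally have "\<forall>\<^sub>F i in Fl. J (f i) > u' * I" using conv' by (intro order_tendstoD)
    then show ?thesis using f
    proof eventually_elim
      case (elim i)
      then show ?case using up[of "f i" u'] by (meson leI linorder_not_less)
    qed
  qed
qed

text \<open>Near \<open>x\<close> the limit \<open>g\<close> is almost constant, so each small
  interval on either side of \<open>x\<close> contains points where \<open>f i\<close> is not much
  above, and points where it is not much below, \<open>g x\<close>. For increasing
  \<open>f i\<close> a point to the right bounds \<open>f i x\<close> from above and one to the left
  from below; for decreasing \<open>f i\<close> the sides are exchanged.\<close>

theorem laplace_continuity_monotone:
  fixes f :: "'i \<Rightarrow> real \<Rightarrow> real" and g :: "real \<Rightarrow> real"
  assumes f: "\<forall>\<^sub>F i in Fl. integrable lborel (\<lambda>t. pos t * (exp (- s0 * t) * f i t)) \<and> (\<forall>t>0. 0 \<le> f i t)"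
    and mono: "(\<forall>\<^sub>F i in Fl. mono_on {0<..} (f i)) \<or> (\<forall>\<^sub>F i in Fl. antimono_on {0<..} (f i))"
    and g: "integrable lborel (\<lambda>t. pos t * (exp (- s0 * t) * g t))" "continuous_on {0<..} g"
    and lim: "\<And>n::nat. ((\<lambda>i. LINT t|lborel. pos t * (exp (- (s0 + real n) * t) * f i t))
                 \<longlongrightarrow> (LINT t|lborel. pos t * (exp (- (s0 + real n) * t) * g t))) Fl"
    and x: "x > 0"
  shows "((\<lambda>i. f i x) \<longlongrightarrow> g x) Fl"
proof (rule tendstoI)
  fix \<epsilon> :: real assume \<epsilon>: "\<epsilon> > 0"
  have "isCont g x" using g(2) x by (simp add: continuous_on_eq_continuous_at)
  then obtain d where d: "d > 0" "\<And>y. \<bar>y - x\<bar> < d \<Longrightarrow> \<bar>g y - g x\<bar> < \<epsilon> / 2"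
    using \<epsilon> unfolding continuous_at_eps_delta dist_real_def by (meson half_gt_zero)
  \<comment> \<open>Half of \<open>x\<close> keeps the left interval inside the positive
    half-line.\<close>
  define r where "r = min (d / 2) (x / 2)"
  have r: "r > 0" "r < d" "r < x" using d(1) x unfolding r_def by auto
  have near: "g x - \<epsilon> / 2 \<le> g t \<and> g t \<le> g x + \<epsilon> / 2" if "t \<in> {x - r..x + r}" for t
  proof -
    have "\<bar>t - x\<bar> < d" using that r by auto
    from d(2)[OF this] show ?thesis by linarith
  qed
  note I1 = laplace_tendsto_interval(1)[OF f g(1) lim, of _ _ "g x + \<epsilon> / 2" "g x + \<epsilon>"]
  note I2 = laplace_tendsto_interval(2)[OF f g(1) lim, of _ _ "g x - \<epsilon> / 2" "g x - \<epsilon>"]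
  have R1: "\<forall>\<^sub>F i in Fl. \<exists>t\<in>{x..x + r}. f i t < g x + \<epsilon>"
    using x r near \<epsilon> by (intro I1) auto
  have R2: "\<forall>\<^sub>F i in Fl. \<exists>t\<in>{x..x + r}. f i t > g x - \<epsilon>"
    using x r near \<epsilon> by (intro I2) auto
  have L1: "\<forall>\<^sub>F i in Fl. \<exists>t\<in>{x - r..x}. f i t < g x + \<epsilon>"
    using x r near \<epsilon> by (intro I1) auto
  have L2: "\<forall>\<^sub>F i in Fl. \<exists>t\<in>{x - r..x}. f i t > g x - \<epsilon>"
    using x r near \<epsilon> by (intro I2) auto
  show "\<forall>\<^sub>F i in Fl. dist (f i x) (g x) < \<epsilon>"
    using mono
  proof
    assume "\<forall>\<^sub>F i in Fl. mono_on {0<..} (f i)"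
    then show ?thesis using R1 L2
    proof eventually_elim
      case (elim i)
      then obtain t1 t2 where t: "t1 \<in> {x..x + r}" "f i t1 < g x + \<epsilon>" "t2 \<in> {x - r..x}" "f i t2 > g x - \<epsilon>"
        by blast
      have "f i x \<le> f i t1" "f i t2 \<le> f i x" 
        using t x r by (auto intro!: mono_onD[OF elim(1)])
      then show ?case using t by (auto simp: dist_real_def)
    qed
  next
    assume "\<forall>\<^sub>F i in Fl. antimono_on {0<..} (f i)"
    then show ?thesis using R2 L1
    proof eventually_elim
      case (elim i)
      then obtain t1 t2 where t: "t1 \<in> {x..x + r}" "f i t1 > g x - \<epsilon>" "t2 \<in> {x - r..x}" "f i t2 < g x + \<epsilon>"
        by blast
      have "f i t1 \<le> f i x" "f i x \<le> f i t2" 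
        using t x r by (auto intro!: monotone_onD[OF elim(1)])
      then show ?case using t by (auto simp: dist_real_def)
    qed
  qed
qed

section \<open>Power laws and the Tauberian theorem\<close>

lemma pos_mult: "c > 0 \<Longrightarrow> pos (c * t) = pos t"
  by (auto simp: pos_def indicator_def zero_less_mult_iff)

lemma laplace_powr:
  assumes "\<gamma> > 0" "s > 0"
  shows "has_bochner_integral lborel (\<lambda>t. pos t * (exp (- s * t) * t powr (\<gamma> - 1))) (Gamma \<gamma> * s powr (- \<gamma>))"
proof -
  have "has_bochner_integral lborel (\<lambda>t. pos t * (exp (- t) * t powr (\<gamma> - 1))) (Gamma \<gamma>)"
  proof (rule has_bochner_integral_nn_integral)
    have "AE t in lborel. t \<noteq> (0::real)" by (rule AE_lborel_singleton)
    then have "AE t in lborel. ennreal (pos t * (exp (- t) * t powr (\<gamma> - 1))) = ennreal (indicator {0..} t * t powr (\<gamma> - 1) / exp t)"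
      by eventually_elim (auto simp: pos_def indicator_def exp_minus field_simps)
    from nn_integral_cong_AE[OF this]
    show "(\<integral>\<^sup>+t. ennreal (pos t * (exp (- t) * t powr (\<gamma> - 1))) \<partial>lborel) = ennreal (Gamma \<gamma>)"
      using Gamma_conv_nn_integral_real[OF assms(1)] by simp
  qed (use assms Gamma_real_pos[of \<gamma>] in \<open>auto simp: pos_simps intro!: AE_I2\<close>)
  then have "has_bochner_integral lborel (\<lambda>t. pos (0 + s * t) * (exp (- (0 + s * t)) * (0 + s * t) powr (\<gamma> - 1))) (Gamma \<gamma> /\<^sub>R \<bar>s\<bar>)"
    using assms by (subst (asm) lborel_has_bochner_integral_real_affine_iff[where c = s and t = 0]) auto
  then have "has_bochner_integral lborel (\<lambda>t. s powr (1 - \<gamma>) * (pos (0 + s * t) * (exp (- (0 + s * t)) * (0 + s * t) powr (\<gamma> - 1)))) (s powr (1 - \<gamma>) * (Gamma \<gamma> /\<^sub>R \<bar>s\<bar>))"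
    by (rule has_bochner_integral_mult_right)
  moreover have "s powr (1 - \<gamma>) * (pos (0 + s * t) * (exp (- (0 + s * t)) * (0 + s * t) powr (\<gamma> - 1))) = pos t * (exp (- s * t) * t powr (\<gamma> - 1))" for t
  proof (cases "t > 0")
    case True
    have "s powr (1 - \<gamma>) * s powr (\<gamma> - 1) = 1" using assms by (simp flip: powr_add)
    then show ?thesis using True assms by (simp add: pos_simps powr_mult mult_ac)
  qed (use assms in \<open>simp add: pos_mult pos_simps\<close>)
  moreover have "s powr (1 - \<gamma>) * (Gamma \<gamma> /\<^sub>R \<bar>s\<bar>) = Gamma \<gamma> * s powr (- \<gamma>)"
    using assms by (simp add: powr_diff powr_minus field_simps)
  ultimately show ?thesis by (simp only:)
qed

text \<open>The rescaled function with parameter l has the transform l^(-\<gamma>) L(s/l), which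
  tends to C s^(-\<gamma>) as l grows. This is the transform of C t^(\<gamma>-1) /
  \<Gamma>(\<gamma>), and the continuity theorem at t = 1 gives the claim. It is used with \<gamma>
  = 1 - \<beta> for a decreasing and with \<gamma> = 1 + \<beta> for an increasing function.\<close>

theorem karamata_monotone:
  fixes F L :: "real \<Rightarrow> real"
  assumes nonneg: "\<And>t. t > 0 \<Longrightarrow> 0 \<le> F t"
    and mono: "mono_on {0<..} F \<or> antimono_on {0<..} F"
    and L: "\<And>s. s > 0 \<Longrightarrow> has_bochner_integral lborel (\<lambda>t. pos t * (exp (- s * t) * F t)) (L s)"
    and \<gamma>: "\<gamma> > 0"
    and lim: "((\<lambda>s. s powr \<gamma> * L s) \<longlongrightarrow> C) (at_right 0)"
  shows "((\<lambda>t. t powr (1 - \<gamma>) * F t) \<longlongrightarrow> C / Gamma \<gamma>) at_top"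
proof -
  define f where "f = (\<lambda>l t. l powr (1 - \<gamma>) * F (l * t))"
  define h where "h = (\<lambda>t. C / Gamma \<gamma> * t powr (\<gamma> - 1))"
  have G: "Gamma \<gamma> > 0" using \<gamma> by (rule Gamma_real_pos)
  have Lf: "has_bochner_integral lborel (\<lambda>t. pos t * (exp (- s * t) * f l t)) (l powr (- \<gamma>) * L (s / l))"
    if "l > 0" "s > 0" for l s
  proof -
    have "has_bochner_integral lborel (\<lambda>t. pos t * (exp (- (s / l) * t) * F t)) (L (s / l))"
      using that by (intro L) simp
    then have "has_bochner_integral lborel (\<lambda>t. pos (0 + l * t) * (exp (- (s / l) * (0 + l * t)) * F (0 + l * t))) (L (s / l) /\<^sub>R \<bar>l\<bar>)"
      using that by (subst (asm) lborel_has_bochner_integral_real_affine_iff[where c = l and t = 0]) auto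
    then have "has_bochner_integral lborel (\<lambda>t. l powr (1 - \<gamma>) * (pos (0 + l * t) * (exp (- (s / l) * (0 + l * t)) * F (0 + l * t)))) (l powr (1 - \<gamma>) * (L (s / l) /\<^sub>R \<bar>l\<bar>))"
      by (rule has_bochner_integral_mult_right)
    moreover have "l powr (1 - \<gamma>) * (L (s / l) /\<^sub>R \<bar>l\<bar>) = l powr (- \<gamma>) * L (s / l)"
      using that by (simp add: powr_diff powr_minus field_simps)
    moreover have "l powr (1 - \<gamma>) * (pos (0 + l * t) * (exp (- (s / l) * (0 + l * t)) * F (0 + l * t))) = pos t * (exp (- s * t) * f l t)" for t
      using that by (simp add: pos_mult f_def)
    ultimately show ?thesis by (simp only:)
  qed
  have Lh: "has_bochner_integral lborel (\<lambda>t. pos t * (exp (- s * t) * h t)) (C * s powr (- \<gamma>))" if "s > 0" for s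
    using has_bochner_integral_mult_right[OF laplace_powr[OF \<gamma> that], of "C / Gamma \<gamma>"] G
    by (simp add: h_def mult_ac)
  have "((\<lambda>l. f l 1) \<longlongrightarrow> h 1) at_top"
  proof (rule laplace_continuity_monotone[where f = f and g = h and x = 1 and ?s0.0 = 1])
    show "\<forall>\<^sub>F l in at_top. integrable lborel (\<lambda>t. pos t * (exp (- 1 * t) * f l t)) \<and> (\<forall>t>0. 0 \<le> f l t)"
      using eventually_gt_at_top[of 0]
    proof eventually_elim
      case (elim l)
      then show ?case using Lf[of l 1] nonneg by (auto simp: has_bochner_integral_iff f_def)
    qed
    show "(\<forall>\<^sub>F l in at_top. mono_on {0<..} (f l)) \<or> (\<forall>\<^sub>F l in at_top. antimono_on {0<..} (f l))"
      using mono
    proof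
      assume m: "mono_on {0<..} F"
      have "\<forall>\<^sub>F l in at_top. mono_on {0<..} (f l)"
        using eventually_gt_at_top[of 0]
      proof eventually_elim
        case (elim l)
        then show ?case
          by (auto simp: f_def intro!: mono_onI mult_left_mono mono_onD[OF m])
      qed
      then show ?thesis ..
    next
      assume m: "antimono_on {0<..} F"
      have "\<forall>\<^sub>F l in at_top. antimono_on {0<..} (f l)"
        using eventually_gt_at_top[of 0]
      proof eventually_elim
        case (elim l)
        then show ?case
          by (auto simp: f_def intro!: monotone_onI mult_left_mono monotone_onD[OF m])
      qed
      then show ?thesis ..
    qed
    show "integrable lborel (\<lambda>t. pos t * (exp (- 1 * t) * h t))"
      using Lh[of 1] by (auto simp: has_bochner_integral_iff)
    show "continuous_on {0<..} h" unfolding h_def by (intro continuous_intros) auto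
    fix n :: nat
    let ?s = "1 + real n"
    have s: "?s > 0" by simp
    have "((\<lambda>l. ?s powr (- \<gamma>) * ((?s / l) powr \<gamma> * L (?s / l))) \<longlongrightarrow> ?s powr (- \<gamma>) * C) at_top"
    proof (intro tendsto_mult tendsto_const filterlim_compose[OF lim])
      show "LIM l at_top. ?s / l :> at_right 0"
        unfolding filterlim_at
      proof (intro conjI)
        show "((\<lambda>l. ?s / l) \<longlongrightarrow> 0) at_top"
          by (intro real_tendsto_divide_at_top[OF tendsto_const filterlim_ident])
        show "\<forall>\<^sub>F l in at_top. ?s / l \<in> {0<..} \<and> ?s / l \<noteq> 0"
          using eventually_gt_at_top[of 0] by eventually_elim auto
      qed
    qed
    moreover have "\<forall>\<^sub>F l in at_top. ?s powr (- \<gamma>) * ((?s / l) powr \<gamma> * L (?s / l)) = (LINT t|lborel. pos t * (exp (- ?s * t) * f l t))"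
      using eventually_gt_at_top[of 0]
    proof eventually_elim
      case (elim l)
      have "?s powr (- \<gamma>) * ((?s / l) powr \<gamma> * L (?s / l)) = l powr (- \<gamma>) * L (?s / l)"
      proof -
        have "x > 0 \<Longrightarrow> x powr (- \<gamma>) * ((x / l) powr \<gamma> * y) = l powr (- \<gamma>) * y" for x y
          using elim by (simp add: powr_divide powr_minus field_simps)
        from this[OF s] show ?thesis .
      qed
      then show ?case using Lf[OF elim s] by (simp add: has_bochner_integral_iff)
    qed
    ultimately have "((\<lambda>l. LINT t|lborel. pos t * (exp (- ?s * t) * f l t)) \<longlongrightarrow> ?s powr (- \<gamma>) * C) at_top"
      by (rule Lim_transform_eventually)
    then show "((\<lambda>l. LINT t|lborel. pos t * (exp (- (1 + real n) * t) * f l t)) \<longlongrightarrow> (LINT t|lborel. pos t * (exp (- (1 + real n) * t) * h t))) at_top"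
      using Lh[OF s] by (simp add: has_bochner_integral_iff mult.commute)
  qed simp
  then show ?thesis by (simp add: f_def h_def)
qed

section \<open>The inverse subordinator\<close>

lemma nn_integral_exp_atLeast:
  fixes c a :: real
  assumes "c > 0"
  shows "(\<integral>\<^sup>+w. ennreal (c * exp (- c * w)) * indicator {a..} w \<partial>lborel) = ennreal (exp (- c * a))"
proof -
  have "(\<integral>\<^sup>+w. ennreal (c * exp (- c * w)) * indicator {a..} w \<partial>lborel) = 0 - (- exp (- c * a))"
  proof (rule nn_integral_FTC_atLeast)
    show "((\<lambda>w. - exp (- c * w)) has_real_derivative c * exp (- c * x)) (at x)" for x
      by (auto intro!: derivative_eq_intros)
    have "filterlim (\<lambda>w. c * w) at_top at_top"
      by (rule filterlim_tendsto_pos_mult_at_top[OF tendsto_const assms filterlim_ident])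
    then have "((\<lambda>w. exp (- (c * w))) \<longlongrightarrow> 0) at_top"
      by (intro filterlim_compose[OF exp_at_bot] filterlim_compose[OF filterlim_uminus_at_bot_at_top])
    then show "((\<lambda>w. - exp (- c * w)) \<longlongrightarrow> 0) at_top"
      using tendsto_minus[of "\<lambda>w. exp (- (c * w))" 0] by simp
  qed (use assms in auto)
  then show ?thesis by simp
qed

lemma nn_integral_exp_greaterThan:
  fixes c :: real
  assumes "c > 0"
  shows "(\<integral>\<^sup>+w. ennreal (c * exp (- c * w)) * indicator {0<..} w \<partial>lborel) = 1"
proof -
  have "AE w in lborel. w \<noteq> (0::real)" by (rule AE_lborel_singleton)
  then have "AE w in lborel. ennreal (c * exp (- c * w)) * indicator {0<..} w = ennreal (c * exp (- c * w)) * indicator {0..} w"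
    by eventually_elim (auto simp: indicator_def)
  from nn_integral_cong_AE[OF this] show ?thesis
    using nn_integral_exp_atLeast[OF assms, of 0] by simp
qed

lemma nn_integral_exp_Ioo_growing:
  fixes c a :: real
  assumes "c > 0" "a \<ge> 0"
  shows "(\<integral>\<^sup>+u. ennreal (c * exp (c * u)) * indicator {0<..<a} u \<partial>lborel) = ennreal (exp (c * a) - 1)"
proof -
  have "AE w in lborel. w \<noteq> (0::real)" "AE w in lborel. w \<noteq> a" by (rule AE_lborel_singleton)+
  then have "AE w in lborel. ennreal (c * exp (c * w)) * indicator {0<..<a} w = ennreal (c * exp (c * w)) * indicator {0..a} w"
    by eventually_elim (auto simp: indicator_def)
  from nn_integral_cong_AE[OF this]
  have "(\<integral>\<^sup>+u. ennreal (c * exp (c * u)) * indicator {0<..<a} u \<partial>lborel) = (\<integral>\<^sup>+u. ennreal (c * exp (c * u)) * indicator {0..a} u \<partial>lborel)" .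
  also have "\<dots> = exp (c * a) - exp (c * 0)"
    by (rule nn_integral_FTC_Icc) (use assms in \<open>auto intro!: derivative_eq_intros\<close>)
  finally show ?thesis by simp
qed

text \<open>Expands the correlation kernel of the parent process over pairs \<open>u < a \<le> b \<le> v\<close>, i.e. over times
  at which the subordinator has not passed level \<open>s\<close>, respectively has passed level \<open>t\<close>.\<close>
lemma exp_difference_expansion:
  fixes a b c :: real
  assumes c: "c > 0" and ab: "0 \<le> a" "a \<le> b"
  shows "ennreal (exp (- c * (b - a))) = ennreal (exp (- c * b)) +
    (\<integral>\<^sup>+u. (\<integral>\<^sup>+v. ennreal (c * c * exp (- c * (v - u))) *
        (indicator {0<..} u * (if u < v then 1 else 0) * (if u < a \<and> b \<le> v then 1 else 0)) \<partial>lborel) \<partial>lborel)"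
proof -
  have inner: "(\<integral>\<^sup>+v. ennreal (c * c * exp (- c * (v - u))) *
        (indicator {0<..} u * (if u < v then 1 else 0) * (if u < a \<and> b \<le> v then 1 else 0)) \<partial>lborel)
      = ennreal (c * exp (c * u)) * indicator {0<..<a} u * ennreal (exp (- c * b))" for u
  proof (cases "0 < u \<and> u < a")
    case True
    have "(\<integral>\<^sup>+v. ennreal (c * c * exp (- c * (v - u))) *
        (indicator {0<..} u * (if u < v then 1 else 0) * (if u < a \<and> b \<le> v then 1 else 0)) \<partial>lborel)
      = (\<integral>\<^sup>+v. ennreal (c * exp (c * u)) * (ennreal (c * exp (- c * v)) * indicator {b..} v) \<partial>lborel)"
    proof (rule nn_integral_cong)
      fix v
      have "c * c * exp (- c * (v - u)) = (c * exp (c * u)) * (c * exp (- c * v))"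
        by (simp add: exp_add[symmetric] algebra_simps flip: mult.assoc)
      then show "ennreal (c * c * exp (- c * (v - u))) *
        (indicator {0<..} u * (if u < v then 1 else 0) * (if u < a \<and> b \<le> v then 1 else 0))
        = ennreal (c * exp (c * u)) * (ennreal (c * exp (- c * v)) * indicator {b..} v)"
        using True ab c by (auto simp: indicator_def ennreal_mult mult_ac)
    qed
    also have "\<dots> = ennreal (c * exp (c * u)) * ennreal (exp (- c * b))"
      by (subst nn_integral_cmult) (simp_all add: nn_integral_exp_atLeast[OF c, simplified])
    finally show ?thesis using True by simp
  qed (auto simp: indicator_def)
  have "(\<integral>\<^sup>+u. (\<integral>\<^sup>+v. ennreal (c * c * exp (- c * (v - u))) *
        (indicator {0<..} u * (if u < v then 1 else 0) * (if u < a \<and> b \<le> v then 1 else 0)) \<partial>lborel) \<partial>lborel)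
     = ennreal (exp (c * a) - 1) * ennreal (exp (- c * b))"
    unfolding inner by (subst nn_integral_multc) (simp_all add: nn_integral_exp_Ioo_growing c ab)
  moreover have "exp (c * a) \<ge> 1" using c ab by simp
  ultimately show ?thesis
    by (simp add: ennreal_mult[symmetric] ennreal_plus[symmetric] exp_add[symmetric] algebra_simps del: ennreal_plus)
qed

text \<open>The exponent stays abstract: positivity is assumed here, a power law at 0 is added later
  where it is needed. Measurability of the inverse is an assumption because in the application it is
  contained in the independence hypothesis.\<close>

locale subordinator_setting = prob_space M for M :: "'a measure" +
  fixes D :: "real \<Rightarrow> 'a \<Rightarrow> real" and g :: "real \<Rightarrow> real \<Rightarrow> real" and \<psi> :: "real \<Rightarrow> real" and \<theta> :: real
  assumes sub: "subordinator M D" and lap: "has_laplace_exponent M D \<psi>" and dens: "density_family M D g"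
    and psi_pos: "\<And>s. s > 0 \<Longrightarrow> \<psi> s > 0" and theta_pos: "\<theta> > 0"
    and E_measurable: "\<And>t. t \<ge> 0 \<Longrightarrow> inverse_subordinator D t \<in> borel_measurable M"
begin

abbreviation E where "E \<equiv> inverse_subordinator D"

section \<open>Paths of \<open>D\<close> and of its inverse\<close>

lemma D_measurable [measurable]: "t \<ge> 0 \<Longrightarrow> D t \<in> borel_measurable M"
  using sub unfolding subordinator_def by blast

lemma E_measurable' [measurable]: "t \<ge> 0 \<Longrightarrow> E t \<in> borel_measurable M"
  by (rule E_measurable)

lemma D_mono: "\<omega> \<in> space M \<Longrightarrow> 0 \<le> s \<Longrightarrow> s \<le> t \<Longrightarrow> D s \<omega> \<le> D t \<omega>"
  using sub unfolding subordinator_def mono_on_def by auto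

lemma AE_D0: "AE \<omega> in M. D 0 \<omega> = 0"
  using sub unfolding subordinator_def by blast

lemma AE_D_nonneg: "t \<ge> 0 \<Longrightarrow> AE \<omega> in M. 0 \<le> D t \<omega>"
  using AE_D0 AE_space by eventually_elim (metis D_mono order_refl)

lemma g_measurable [measurable]: "(\<lambda>(x, z). g x z) \<in> borel_measurable (borel \<Otimes>\<^sub>M borel)"
  and g_nonneg: "0 \<le> g x z"
  and g_distributed: "z > 0 \<Longrightarrow> distributed M lborel (D z) (\<lambda>x. ennreal (g x z))"
  using dens unfolding density_family_def by auto

lemma g_measurable' [measurable (raw)]:
  assumes "f \<in> borel_measurable N" "h \<in> borel_measurable N"
  shows "(\<lambda>x. g (f x) (h x)) \<in> borel_measurable N"
  using measurable_compose[OF measurable_Pair[OF assms] g_measurable] by simp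

lemma D_laplace:
  assumes "s > 0" "t \<ge> 0"
  shows "(\<integral>\<^sup>+\<omega>. ennreal (exp (- s * D t \<omega>)) \<partial>M) = ennreal (exp (- t * \<psi> s))"
proof -
  have "integrable M (\<lambda>\<omega>. exp (- s * D t \<omega>))"
  proof (rule integrable_const_bound[where B = 1])
    show "AE \<omega> in M. norm (exp (- s * D t \<omega>)) \<le> 1"
      using AE_D_nonneg[OF assms(2)] by eventually_elim (use assms in auto)
  qed (use assms in measurable)
  then show ?thesis
    using lap assms unfolding has_laplace_exponent_def by (subst nn_integral_eq_integral) auto
qed

text \<open>By Markov's inequality the probability of D(k) \<le> n is at most exp(n) E exp(-D(k)) =
  exp(n - k \<psi>(1)), which vanishes as k grows. Hence the conventional value 0 in
  \<open>inverse_subordinator\<close> is taken on a null event only.\<close>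

lemma AE_D_unbounded: "AE \<omega> in M. \<forall>t. \<exists>\<tau>\<ge>0. D \<tau> \<omega> > t"
proof -
  have "AE \<omega> in M. \<exists>k::nat. D (real k) \<omega> > real n" for n
  proof -
    let ?N = "{\<omega>\<in>space M. \<forall>k::nat. D (real k) \<omega> \<le> real n}"
    have meas: "?N \<in> sets M" by measurable
    have le: "emeasure M ?N \<le> ennreal (exp (real n) * exp (- real k * \<psi> 1))" for k
    proof -
      have "emeasure M ?N = (\<integral>\<^sup>+\<omega>. indicator ?N \<omega> \<partial>M)" using meas by simp
      also have "\<dots> \<le> (\<integral>\<^sup>+\<omega>. ennreal (exp (real n)) * ennreal (exp (- 1 * D (real k) \<omega>)) \<partial>M)"
      proof (rule nn_integral_mono)
        fix \<omega> assume "\<omega> \<in> space M"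
        show "indicator ?N \<omega> \<le> ennreal (exp (real n)) * ennreal (exp (- 1 * D (real k) \<omega>))"
        proof (cases "\<omega> \<in> ?N")
          case True
          then have "1 \<le> exp (real n - D (real k) \<omega>)" by simp
          then have "1 \<le> ennreal (exp (real n) * exp (- 1 * D (real k) \<omega>))"
            by (simp add: exp_add[symmetric] del: one_le_exp_iff)
          then show ?thesis using True by (simp add: ennreal_mult)
        qed simp
      qed
      also have "\<dots> = ennreal (exp (real n)) * ennreal (exp (- real k * \<psi> 1))"
        by (subst nn_integral_cmult) (simp_all add: D_laplace[of 1, simplified])
      finally show ?thesis by (simp add: ennreal_mult)
    qed
    have "(\<lambda>k. exp (- \<psi> 1) ^ k) \<longlonglongrightarrow> 0"
      using psi_pos[of 1] by (intro LIMSEQ_power_zero) auto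
    then have "(\<lambda>k. exp (real n) * exp (- real k * \<psi> 1)) \<longlonglongrightarrow> exp (real n) * 0"
      by (intro tendsto_mult tendsto_const) (simp add: exp_of_nat_mult[symmetric])
    then have "(\<lambda>k. ennreal (exp (real n) * exp (- real k * \<psi> 1))) \<longlonglongrightarrow> ennreal (exp (real n) * 0)"
      by (intro tendsto_ennrealI)
    then have "emeasure M ?N \<le> ennreal (exp (real n) * 0)"
      by (rule LIMSEQ_le_const) (use le in blast)
    then have "emeasure M ?N = 0" by simp
    then have "AE \<omega> in M. \<not> (\<forall>k::nat. D (real k) \<omega> \<le> real n)"
      using meas by (intro AE_I[where N = ?N]) auto
    then show ?thesis by eventually_elim (auto simp: not_le)
  qed
  then have "AE \<omega> in M. \<forall>n. \<exists>k::nat. D (real k) \<omega> > real n" by (simp add: AE_all_countable)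
  then show ?thesis
  proof eventually_elim
    case (elim \<omega>)
    show ?case
    proof
      fix t
      obtain n :: nat where "t < real n" using reals_Archimedean2 by blast
      moreover obtain k where "D (real k) \<omega> > real n" using elim by blast
      ultimately show "\<exists>\<tau>\<ge>0. D \<tau> \<omega> > t" by (intro exI[of _ "real k"]) auto
    qed
  qed
qed

lemma E_nonneg: "0 \<le> E t \<omega>"
  unfolding inverse_subordinator_def by (auto intro!: cInf_greatest)

lemma E_le: "D u \<omega> > t \<Longrightarrow> u \<ge> 0 \<Longrightarrow> E t \<omega> \<le> u"
  unfolding inverse_subordinator_def by (auto intro!: cInf_lower bdd_belowI[of _ 0])

lemma le_E:
  assumes "\<omega> \<in> space M" "\<exists>\<tau>\<ge>0. D \<tau> \<omega> > t" "D u \<omega> \<le> t" "u \<ge> 0"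
  shows "u \<le> E t \<omega>"
proof -
  have "Inf {\<tau>. 0 \<le> \<tau> \<and> D \<tau> \<omega> > t} \<ge> u"
  proof (rule cInf_greatest)
    show "{\<tau>. 0 \<le> \<tau> \<and> D \<tau> \<omega> > t} \<noteq> {}" using assms by auto
    show "u \<le> x" if "x \<in> {\<tau>. 0 \<le> \<tau> \<and> D \<tau> \<omega> > t}" for x
      using that assms D_mono[of \<omega> x u] by (cases "u \<le> x") auto
  qed
  then show ?thesis using assms unfolding inverse_subordinator_def by auto
qed

lemma AE_E_mono:
  assumes "s \<le> t"
  shows "AE \<omega> in M. E s \<omega> \<le> E t \<omega>"
  using AE_D_unbounded
proof eventually_elim
  case (elim \<omega>)
  have "Inf {\<tau>. 0 \<le> \<tau> \<and> D \<tau> \<omega> > s} \<le> Inf {\<tau>. 0 \<le> \<tau> \<and> D \<tau> \<omega> > t}"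
    using elim assms by (intro cInf_superset_mono) (auto intro!: bdd_belowI[of _ 0])
  then show ?case using elim unfolding inverse_subordinator_def by auto
qed

text \<open>On an unbounded path the two conditions can differ only at u = E(t). For each path that
  is a single u, hence a Lebesgue null set; Fubini turns "for almost every path, almost every u"
  into the order of quantifiers stated here.\<close>

lemma AE_less_E_iff:
  assumes t: "t \<ge> 0"
  shows "AE u in lborel. u > 0 \<longrightarrow> (AE \<omega> in M. u < E t \<omega> \<longleftrightarrow> D u \<omega> \<le> t)"
proof -
  interpret P: pair_sigma_finite M lborel ..
  have "AE \<omega> in M. AE u in lborel. u \<noteq> E t \<omega>" by (simp add: AE_lborel_singleton)
  then have "AE u in lborel. AE \<omega> in M. u \<noteq> E t \<omega>"
  proof (subst (asm) P.AE_commute)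
    have [measurable]: "E t \<in> borel_measurable M" using t by measurable
    show "{x \<in> space (M \<Otimes>\<^sub>M lborel). snd x \<noteq> E t (fst x)} \<in> sets (M \<Otimes>\<^sub>M lborel)"
      by measurable
  qed
  then show ?thesis
  proof eventually_elim
    case (elim u)
    show ?case
    proof
      assume u: "u > 0"
      show "AE \<omega> in M. u < E t \<omega> \<longleftrightarrow> D u \<omega> \<le> t"
        using elim AE_D_unbounded AE_space
      proof eventually_elim
        case (elim \<omega>)
        have "D u \<omega> \<le> t" if "u < E t \<omega>" using E_le[of t u \<omega>] that u by fastforce
        moreover have "u \<le> E t \<omega>" if "D u \<omega> \<le> t" using le_E[of \<omega> t u] elim that u by auto
        ultimately show ?case using elim by force
      qed
    qed
  qed
qed

section \<open>Distribution functions of \<open>D\<close>\<close>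

definition cdfD :: "real \<Rightarrow> real \<Rightarrow> ennreal" where
  "cdfD w t = (\<integral>\<^sup>+x. ennreal (g x w) * indicator {0..t} x \<partial>lborel)"

definition tailD :: "real \<Rightarrow> real \<Rightarrow> ennreal" where
  "tailD w t = (\<integral>\<^sup>+x. ennreal (g x w) * (if t < x then 1 else 0) \<partial>lborel)"

text \<open>Joint measurability in level and time, required by every later use of Fubini, is the
  reason for defining \<open>cdfD\<close> and \<open>tailD\<close> from the density family and not
  as probabilities; for \<open>w > 0\<close> they are the probabilities of D(w) \<le> t and D(w) >
  t.\<close>

lemma cdfD_measurable [measurable (raw)]:
  assumes [measurable]: "f \<in> borel_measurable N" "h \<in> borel_measurable N"
  shows "(\<lambda>x. cdfD (f x) (h x)) \<in> borel_measurable N"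
proof -
  have eq: "cdfD = (\<lambda>w t. \<integral>\<^sup>+x. ennreal (g x w) * (if 0 \<le> x \<and> x \<le> t then 1 else 0) \<partial>lborel)"
    unfolding cdfD_def by (intro ext nn_integral_cong) (auto simp: indicator_def)
  show ?thesis unfolding eq by measurable
qed

lemma tailD_measurable [measurable (raw)]:
  assumes [measurable]: "f \<in> borel_measurable N" "h \<in> borel_measurable N"
  shows "(\<lambda>x. tailD (f x) (h x)) \<in> borel_measurable N"
  unfolding tailD_def by measurable

lemma cdfD_eq: "w > 0 \<Longrightarrow> cdfD w t = emeasure M {\<omega>\<in>space M. D w \<omega> \<le> t}"
proof -
  assume w: "w > 0"
  have "cdfD w t = emeasure M (D w -` {0..t} \<inter> space M)"
    unfolding cdfD_def using distributed_emeasure[OF g_distributed[OF w], of "{0..t}"] by simp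
  also have "\<dots> = emeasure M {\<omega>\<in>space M. D w \<omega> \<le> t}"
    using AE_D_nonneg[of w] w by (intro emeasure_eq_AE) auto
  finally show ?thesis .
qed

lemma tailD_eq: "w > 0 \<Longrightarrow> tailD w t = emeasure M {\<omega>\<in>space M. t < D w \<omega>}"
proof -
  assume w: "w > 0"
  have "tailD w t = emeasure M (D w -` {t<..} \<inter> space M)"
    unfolding tailD_def using distributed_emeasure[OF g_distributed[OF w], of "{t<..}"]
    by (simp add: indicator_def of_bool_def)
  also have "D w -` {t<..} \<inter> space M = {\<omega>\<in>space M. t < D w \<omega>}" by auto
  finally show ?thesis .
qed

lemma cdfD_plus_tailD:
  assumes w: "w > 0"
  shows "cdfD w t + tailD w t = 1"
proof -
  have "cdfD w t + tailD w t = emeasure M ({\<omega>\<in>space M. D w \<omega> \<le> t} \<union> {\<omega>\<in>space M. t < D w \<omega>})"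
    unfolding cdfD_eq[OF w] tailD_eq[OF w] using w by (subst plus_emeasure) auto
  also have "{\<omega>\<in>space M. D w \<omega> \<le> t} \<union> {\<omega>\<in>space M. t < D w \<omega>} = space M" by auto
  finally show ?thesis by (simp add: emeasure_space_1)
qed

lemma tailD_antimono: "s \<le> t \<Longrightarrow> tailD w t \<le> tailD w s"
  unfolding tailD_def by (intro nn_integral_mono mult_left_mono) auto

lemma cdfD_mono: "s \<le> t \<Longrightarrow> cdfD w s \<le> cdfD w t"
  unfolding cdfD_def by (intro nn_integral_mono mult_left_mono) (auto simp: indicator_def)

section \<open>The function \<open>\<Phi>\<close> as a mixture of tail probabilities\<close>

abbreviation \<Phi> where "\<Phi> \<equiv> Phi M E \<theta>"

lemma AE_emeasure_E_le:
  assumes t: "t \<ge> 0"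
  shows "AE w in lborel. w > 0 \<longrightarrow> emeasure M {\<omega>\<in>space M. E t \<omega> \<le> w} = tailD w t"
  using AE_less_E_iff[OF t]
proof eventually_elim
  case (elim w)
  have [measurable]: "E t \<in> borel_measurable M" using t by measurable
  show ?case
  proof
    assume w: "w > 0"
    then have "AE \<omega> in M. w < E t \<omega> \<longleftrightarrow> D w \<omega> \<le> t" using elim by blast
    then have "AE \<omega> in M. \<omega> \<in> {\<omega>\<in>space M. E t \<omega> \<le> w} \<longleftrightarrow> \<omega> \<in> {\<omega>\<in>space M. t < D w \<omega>}"
      by eventually_elim auto
    then show "emeasure M {\<omega>\<in>space M. E t \<omega> \<le> w} = tailD w t"
      unfolding tailD_eq[OF w] using w by (intro emeasure_eq_AE) auto
  qed
qed

lemma integrable_exp_E: "t \<ge> 0 \<Longrightarrow> integrable M (\<lambda>\<omega>. exp (- \<theta> * E t \<omega>))"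
  using theta_pos E_nonneg by (intro integrable_const_bound[where B = 1]) (auto intro!: AE_I2)

lemma Phi_nonneg: "0 \<le> \<Phi> t"
  unfolding Phi_def by (intro integral_nonneg_AE) auto

lemma Phi_le_1: "t \<ge> 0 \<Longrightarrow> \<Phi> t \<le> 1"
proof -
  assume t: "t \<ge> 0"
  have "\<Phi> t \<le> (LINT \<omega>|M. 1)"
    unfolding Phi_def using theta_pos E_nonneg integrable_exp_E[OF t] by (intro integral_mono) auto
  then show ?thesis by (simp add: prob_space)
qed

text \<open>Write exp(-\<theta> a) as the integral of \<theta> exp(-\<theta> w) over w \<ge> a, put
  a = E(t), exchange the integrals, and replace E(t) \<le> w by D(w) > t. Monotonicity and
  measurability of \<open>\<Phi>\<close> in \<open>t\<close> are both read off from this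
  form.\<close>

lemma Phi_eq_tailD:
  assumes t: "t \<ge> 0"
  shows "ennreal (\<Phi> t) = (\<integral>\<^sup>+w. ennreal (\<theta> * exp (- \<theta> * w)) * indicator {0<..} w * tailD w t \<partial>lborel)"
proof -
  interpret P: pair_sigma_finite M lborel ..
  have [measurable]: "E t \<in> borel_measurable M" using t by measurable
  have "ennreal (\<Phi> t) = (\<integral>\<^sup>+\<omega>. ennreal (exp (- \<theta> * E t \<omega>)) \<partial>M)"
    unfolding Phi_def by (subst nn_integral_eq_integral[OF integrable_exp_E[OF t]]) auto
  also have "\<dots> = (\<integral>\<^sup>+\<omega>. (\<integral>\<^sup>+w. ennreal (\<theta> * exp (- \<theta> * w)) * indicator {0<..} w * (if E t \<omega> \<le> w then 1 else 0) \<partial>lborel) \<partial>M)"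
  proof (rule nn_integral_cong)
    fix \<omega>
    have "AE w in lborel. w \<noteq> (0::real)" by (rule AE_lborel_singleton)
    then have "AE w in lborel. ennreal (\<theta> * exp (- \<theta> * w)) * indicator {E t \<omega>..} w =
        ennreal (\<theta> * exp (- \<theta> * w)) * indicator {0<..} w * (if E t \<omega> \<le> w then 1 else 0)"
      by eventually_elim (use E_nonneg[of t \<omega>] in \<open>auto simp: indicator_def\<close>)
    from nn_integral_cong_AE[OF this]
    show "ennreal (exp (- \<theta> * E t \<omega>)) = (\<integral>\<^sup>+w. ennreal (\<theta> * exp (- \<theta> * w)) * indicator {0<..} w * (if E t \<omega> \<le> w then 1 else 0) \<partial>lborel)"
      unfolding nn_integral_exp_atLeast[OF theta_pos] .
  qed
  also have "\<dots> = (\<integral>\<^sup>+w. (\<integral>\<^sup>+\<omega>. ennreal (\<theta> * exp (- \<theta> * w)) * indicator {0<..} w * (if E t \<omega> \<le> w then 1 else 0) \<partial>M) \<partial>lborel)"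
    by (rule P.Fubini'[symmetric]) measurable
  also have "\<dots> = (\<integral>\<^sup>+w. ennreal (\<theta> * exp (- \<theta> * w)) * indicator {0<..} w * tailD w t \<partial>lborel)"
  proof (rule nn_integral_cong_AE)
    show "AE w in lborel. (\<integral>\<^sup>+\<omega>. ennreal (\<theta> * exp (- \<theta> * w)) * indicator {0<..} w * (if E t \<omega> \<le> w then 1 else 0) \<partial>M)
       = ennreal (\<theta> * exp (- \<theta> * w)) * indicator {0<..} w * tailD w t"
      using AE_emeasure_E_le[OF t]
    proof eventually_elim
      case (elim w)
      have "(\<integral>\<^sup>+\<omega>. (if E t \<omega> \<le> w then 1 else 0) \<partial>M) = (\<integral>\<^sup>+\<omega>. indicator {\<omega>\<in>space M. E t \<omega> \<le> w} \<omega> \<partial>M)"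
        by (intro nn_integral_cong) auto
      also have "\<dots> = emeasure M {\<omega>\<in>space M. E t \<omega> \<le> w}" by simp
      finally show ?case
        using elim by (subst nn_integral_cmult) (auto simp: indicator_def)
    qed
  qed
  finally show ?thesis .
qed

lemma Phi_antimono: "0 \<le> s \<Longrightarrow> s \<le> t \<Longrightarrow> \<Phi> t \<le> \<Phi> s"
proof -
  assume "0 \<le> s" "s \<le> t"
  then have "ennreal (\<Phi> t) \<le> ennreal (\<Phi> s)"
    by (subst (1 2) Phi_eq_tailD) (auto intro!: nn_integral_mono mult_left_mono tailD_antimono)
  then show ?thesis using Phi_nonneg by simp
qed

text \<open>The renewal (potential) function of the subordinator: the mean of E(t), written as the
  integral over w of the probability that E(t) exceeds w. It is extended-valued until
  \<open>renewal_finite\<close>; \<open>U\<close> below is its real version.\<close>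

definition renewal :: "real \<Rightarrow> ennreal" where
  "renewal t = (\<integral>\<^sup>+w. indicator {0<..} w * cdfD w t \<partial>lborel)"

lemma renewal_measurable [measurable]: "renewal \<in> borel_measurable borel"
  unfolding renewal_def by measurable

lemma renewal_mono: "s \<le> t \<Longrightarrow> renewal s \<le> renewal t"
  unfolding renewal_def by (intro nn_integral_mono mult_left_mono cdfD_mono) auto

section \<open>Laplace transforms in the time variable\<close>

lemma exp_laplace_cdf:
  assumes w: "w > 0" and s: "s > 0"
  shows "(\<integral>\<^sup>+t. ennreal (s * exp (- s * t)) * indicator {0<..} t * cdfD w t \<partial>lborel) = ennreal (exp (- w * \<psi> s))"
proof -
  interpret P: pair_sigma_finite M lborel ..
  have [measurable]: "D w \<in> borel_measurable M" using w by (intro D_measurable) simp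
  have "(\<integral>\<^sup>+t. ennreal (s * exp (- s * t)) * indicator {0<..} t * cdfD w t \<partial>lborel)
     = (\<integral>\<^sup>+t. (\<integral>\<^sup>+\<omega>. ennreal (s * exp (- s * t)) * indicator {0<..} t * (if D w \<omega> \<le> t then 1 else 0) \<partial>M) \<partial>lborel)"
  proof (rule nn_integral_cong)
    fix t
    have "cdfD w t = (\<integral>\<^sup>+\<omega>. indicator {\<omega>\<in>space M. D w \<omega> \<le> t} \<omega> \<partial>M)"
      unfolding cdfD_eq[OF w] by simp
    also have "\<dots> = (\<integral>\<^sup>+\<omega>. (if D w \<omega> \<le> t then 1 else 0) \<partial>M)"
      by (intro nn_integral_cong) auto
    finally show "ennreal (s * exp (- s * t)) * indicator {0<..} t * cdfD w t
      = (\<integral>\<^sup>+\<omega>. ennreal (s * exp (- s * t)) * indicator {0<..} t * (if D w \<omega> \<le> t then 1 else 0) \<partial>M)"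
      by (subst nn_integral_cmult) auto
  qed
  also have "\<dots> = (\<integral>\<^sup>+\<omega>. (\<integral>\<^sup>+t. ennreal (s * exp (- s * t)) * indicator {0<..} t * (if D w \<omega> \<le> t then 1 else 0) \<partial>lborel) \<partial>M)"
    by (rule P.Fubini') measurable
  also have "\<dots> = (\<integral>\<^sup>+\<omega>. ennreal (exp (- s * D w \<omega>)) \<partial>M)"
  proof (rule nn_integral_cong_AE)
    show "AE \<omega> in M. (\<integral>\<^sup>+t. ennreal (s * exp (- s * t)) * indicator {0<..} t * (if D w \<omega> \<le> t then 1 else 0) \<partial>lborel)
       = ennreal (exp (- s * D w \<omega>))"
      using AE_D_nonneg[of w, OF less_imp_le[OF w]]
    proof eventually_elim
      case (elim \<omega>)
      have "AE t in lborel. t \<noteq> (0::real)" by (rule AE_lborel_singleton)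
      then have "AE t in lborel. ennreal (s * exp (- s * t)) * indicator {0<..} t * (if D w \<omega> \<le> t then 1 else 0)
          = ennreal (s * exp (- s * t)) * indicator {D w \<omega>..} t"
        by eventually_elim (use elim in \<open>auto simp: indicator_def\<close>)
      from nn_integral_cong_AE[OF this] show ?case
        unfolding nn_integral_exp_atLeast[OF s] .
    qed
  qed
  also have "\<dots> = ennreal (exp (- w * \<psi> s))" using s w by (intro D_laplace) auto
  finally show ?thesis .
qed

text \<open>By \<open>exp_laplace_cdf\<close> the inner integral is exp(-w \<psi>(s)), and
  integration over w leaves 1/\<psi>(s).\<close>

lemma renewal_laplace:
  assumes s: "s > 0"
  shows "(\<integral>\<^sup>+t. ennreal (s * exp (- s * t)) * indicator {0<..} t * renewal t \<partial>lborel) = ennreal (1 / \<psi> s)"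
proof -
  have "(\<integral>\<^sup>+t. ennreal (s * exp (- s * t)) * indicator {0<..} t * renewal t \<partial>lborel)
    = (\<integral>\<^sup>+t. (\<integral>\<^sup>+w. indicator {0<..} w * (ennreal (s * exp (- s * t)) * indicator {0<..} t * cdfD w t) \<partial>lborel) \<partial>lborel)"
    unfolding renewal_def
    by (subst nn_integral_cmult[symmetric]) (auto simp: mult_ac)
  also have "\<dots> = (\<integral>\<^sup>+w. (\<integral>\<^sup>+t. indicator {0<..} w * (ennreal (s * exp (- s * t)) * indicator {0<..} t * cdfD w t) \<partial>lborel) \<partial>lborel)"
    by (rule lborel_pair.Fubini') measurable
  also have "\<dots> = (\<integral>\<^sup>+w. indicator {0<..} w * (\<integral>\<^sup>+t. ennreal (s * exp (- s * t)) * indicator {0<..} t * cdfD w t \<partial>lborel) \<partial>lborel)"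
    by (intro nn_integral_cong nn_integral_cmult) measurable
  also have "\<dots> = (\<integral>\<^sup>+w. ennreal (1 / \<psi> s) * (ennreal (\<psi> s * exp (- \<psi> s * w)) * indicator {0<..} w) \<partial>lborel)"
  proof (rule nn_integral_cong)
    fix w :: real
    have "ennreal (exp (- w * \<psi> s)) = ennreal (1 / \<psi> s) * ennreal (\<psi> s * exp (- \<psi> s * w))"
      using psi_pos[OF s] by (subst ennreal_mult[symmetric]) (auto simp: mult.commute)
    then show "indicator {0<..} w * (\<integral>\<^sup>+t. ennreal (s * exp (- s * t)) * indicator {0<..} t * cdfD w t \<partial>lborel)
      = ennreal (1 / \<psi> s) * (ennreal (\<psi> s * exp (- \<psi> s * w)) * indicator {0<..} w)"
      using exp_laplace_cdf[OF _ s, of w] by (cases "w > 0") simp_all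
  qed
  also have "\<dots> = ennreal (1 / \<psi> s)"
    using nn_integral_exp_greaterThan[OF psi_pos[OF s]] by (subst nn_integral_cmult) simp_all
  finally show ?thesis .
qed

text \<open>By monotonicity an infinite value at \<open>t\<close> would persist on a half-line and
  make the transform at 1 infinite, but this transform is 1/\<psi>(1).\<close>

lemma renewal_finite: "renewal t < \<top>"
proof (rule ccontr)
  assume "\<not> renewal t < \<top>"
  then have top: "renewal x = \<top>" if "x \<ge> t" for x
    using renewal_mono[OF that] by (auto simp: top_unique less_top[symmetric])
  define m where "m = max t 0"
  have "(\<integral>\<^sup>+x. \<top> * indicator {m<..<m+1} x \<partial>lborel) \<le> (\<integral>\<^sup>+t. ennreal (1 * exp (- 1 * t)) * indicator {0<..} t * renewal t \<partial>lborel)"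
    using top by (intro nn_integral_mono) (auto simp: indicator_def m_def ennreal_mult_top ennreal_mult_eq_top_iff)
  also have "\<dots> < \<top>" using renewal_laplace[of 1] by simp
  finally show False by (subst (asm) nn_integral_cmult_indicator) auto
qed

definition U :: "real \<Rightarrow> real" where "U t = enn2real (renewal t)"

lemma U_ennreal: "ennreal (U t) = renewal t"
  unfolding U_def using renewal_finite by simp

lemma U_nonneg: "0 \<le> U t"
  unfolding U_def by simp

lemma U_mono: "s \<le> t \<Longrightarrow> U s \<le> U t"
  unfolding U_def by (intro enn2real_mono renewal_mono renewal_finite) auto

lemma U_measurable [measurable]: "U \<in> borel_measurable borel"
  unfolding U_def by measurable

lemma U_laplace:
  assumes s: "s > 0"
  shows "has_bochner_integral lborel (\<lambda>t. pos t * (exp (- s * t) * U t)) (1 / (s * \<psi> s))"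
proof (rule has_bochner_integral_nn_integral)
  show "(\<integral>\<^sup>+t. ennreal (pos t * (exp (- s * t) * U t)) \<partial>lborel) = ennreal (1 / (s * \<psi> s))"
  proof -
    have "(\<integral>\<^sup>+t. ennreal (pos t * (exp (- s * t) * U t)) \<partial>lborel)
       = (\<integral>\<^sup>+t. ennreal (1 / s) * (ennreal (s * exp (- s * t)) * indicator {0<..} t * renewal t) \<partial>lborel)"
      using s U_nonneg
      by (intro nn_integral_cong) (auto simp: pos_def indicator_def ennreal_mult'[symmetric] U_ennreal[symmetric] mult.assoc[symmetric])
    also have "\<dots> = ennreal (1 / s) * ennreal (1 / \<psi> s)"
      by (subst nn_integral_cmult) (simp_all only: renewal_laplace[OF s], measurable)
    finally show ?thesis using s psi_pos[OF s] by (simp add: ennreal_mult[symmetric])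
  qed
qed (use s psi_pos[OF s] U_nonneg in \<open>auto simp: pos_simps intro!: AE_I2\<close>)

lemma exp_weighted_tail_plus_cdf:
  "(\<integral>\<^sup>+w. ennreal (\<theta> * exp (- \<theta> * w)) * indicator {0<..} w * tailD w t \<partial>lborel) +
    (\<integral>\<^sup>+w. ennreal (\<theta> * exp (- \<theta> * w)) * indicator {0<..} w * cdfD w t \<partial>lborel) = 1"
  (is "?T + ?C = 1")
proof -
  have "?T + ?C = (\<integral>\<^sup>+w. ennreal (\<theta> * exp (- \<theta> * w)) * indicator {0<..} w * tailD w t + ennreal (\<theta> * exp (- \<theta> * w)) * indicator {0<..} w * cdfD w t \<partial>lborel)"
    by (subst nn_integral_add) auto
  also have "\<dots> = (\<integral>\<^sup>+w. ennreal (\<theta> * exp (- \<theta> * w)) * indicator {0<..} w \<partial>lborel)"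
  proof (rule nn_integral_cong)
    fix w :: real
    show "ennreal (\<theta> * exp (- \<theta> * w)) * indicator {0<..} w * tailD w t + ennreal (\<theta> * exp (- \<theta> * w)) * indicator {0<..} w * cdfD w t
      = ennreal (\<theta> * exp (- \<theta> * w)) * indicator {0<..} w"
      using cdfD_plus_tailD[of w t] by (cases "w > 0") (simp_all add: distrib_left[symmetric] add.commute)
  qed
  finally show ?thesis by (simp only: nn_integral_exp_greaterThan[OF theta_pos])
qed

text \<open>The complement 1 - \<Phi> is the mixture \<open>C\<close> of distribution functions,
  whose weighted transform is the integral of \<theta> exp(-(\<theta> + \<psi>(s)) w), that is
  \<theta> / (\<theta> + \<psi>(s)). Subtraction from 1, carried out by cancelling a finite summand,
  and division by \<open>s\<close> give the result.\<close>

lemma Phi_laplace: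
  assumes s: "s > 0"
  shows "has_bochner_integral lborel (\<lambda>t. pos t * (exp (- s * t) * \<Phi> t)) (\<psi> s / (s * (\<theta> + \<psi> s)))"
proof -
  define T where "T t = (\<integral>\<^sup>+w. ennreal (\<theta> * exp (- \<theta> * w)) * indicator {0<..} w * tailD w t \<partial>lborel)" for t
  define C where "C t = (\<integral>\<^sup>+w. ennreal (\<theta> * exp (- \<theta> * w)) * indicator {0<..} w * cdfD w t \<partial>lborel)" for t
  have [measurable]: "T \<in> borel_measurable borel" "C \<in> borel_measurable borel"
    unfolding T_def[abs_def] C_def[abs_def] by measurable
  have PT: "ennreal (\<Phi> t) = T t" if "t \<ge> 0" for t
    using Phi_eq_tailD[OF that] unfolding T_def .
  have TC: "T t + C t = 1" for t
    unfolding T_def C_def by (rule exp_weighted_tail_plus_cdf)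
  have LC: "(\<integral>\<^sup>+t. ennreal (s * exp (- s * t)) * indicator {0<..} t * C t \<partial>lborel) = ennreal (\<theta> / (\<theta> + \<psi> s))"
  proof -
    have "(\<integral>\<^sup>+t. ennreal (s * exp (- s * t)) * indicator {0<..} t * C t \<partial>lborel)
      = (\<integral>\<^sup>+t. (\<integral>\<^sup>+w. ennreal (\<theta> * exp (- \<theta> * w)) * indicator {0<..} w * (ennreal (s * exp (- s * t)) * indicator {0<..} t * cdfD w t) \<partial>lborel) \<partial>lborel)"
      unfolding C_def by (subst nn_integral_cmult[symmetric]) (auto simp: mult_ac)
    also have "\<dots> = (\<integral>\<^sup>+w. (\<integral>\<^sup>+t. ennreal (\<theta> * exp (- \<theta> * w)) * indicator {0<..} w * (ennreal (s * exp (- s * t)) * indicator {0<..} t * cdfD w t) \<partial>lborel) \<partial>lborel)"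
      by (rule lborel_pair.Fubini') measurable
    also have "\<dots> = (\<integral>\<^sup>+w. ennreal (\<theta> * exp (- \<theta> * w)) * indicator {0<..} w * (\<integral>\<^sup>+t. ennreal (s * exp (- s * t)) * indicator {0<..} t * cdfD w t \<partial>lborel) \<partial>lborel)"
      by (intro nn_integral_cong nn_integral_cmult) measurable
    also have "\<dots> = (\<integral>\<^sup>+w. ennreal (\<theta> / (\<theta> + \<psi> s)) * (ennreal ((\<theta> + \<psi> s) * exp (- (\<theta> + \<psi> s) * w)) * indicator {0<..} w) \<partial>lborel)"
    proof (rule nn_integral_cong)
      fix w :: real
      have "ennreal (\<theta> * exp (- \<theta> * w)) * ennreal (exp (- w * \<psi> s)) = ennreal (\<theta> / (\<theta> + \<psi> s)) * ennreal ((\<theta> + \<psi> s) * exp (- (\<theta> + \<psi> s) * w))"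
      proof -
        have e: "exp (- (\<theta> + \<psi> s) * w) = exp (- \<theta> * w) * exp (- w * \<psi> s)"
          by (simp add: exp_add[symmetric] algebra_simps)
        have "\<theta> * exp (- \<theta> * w) * exp (- w * \<psi> s) = \<theta> / (\<theta> + \<psi> s) * ((\<theta> + \<psi> s) * exp (- (\<theta> + \<psi> s) * w))"
          unfolding e using psi_pos[OF s] theta_pos by simp
        then show ?thesis
          using psi_pos[OF s] theta_pos by (simp only: ennreal_mult[symmetric] mult_nonneg_nonneg exp_ge_zero less_imp_le add_pos_pos divide_nonneg_pos)
      qed
      then show "ennreal (\<theta> * exp (- \<theta> * w)) * indicator {0<..} w * (\<integral>\<^sup>+t. ennreal (s * exp (- s * t)) * indicator {0<..} t * cdfD w t \<partial>lborel)
        = ennreal (\<theta> / (\<theta> + \<psi> s)) * (ennreal ((\<theta> + \<psi> s) * exp (- (\<theta> + \<psi> s) * w)) * indicator {0<..} w)"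
        using exp_laplace_cdf[OF _ s, of w] by (cases "w > 0") simp_all
    qed
    also have "\<dots> = ennreal (\<theta> / (\<theta> + \<psi> s))"
      using nn_integral_exp_greaterThan[of "\<theta> + \<psi> s"] psi_pos[OF s] theta_pos by (subst nn_integral_cmult) simp_all
    finally show ?thesis .
  qed
  define LT where "LT = (\<integral>\<^sup>+t. ennreal (s * exp (- s * t)) * indicator {0<..} t * T t \<partial>lborel)"
  have "LT + ennreal (\<theta> / (\<theta> + \<psi> s)) = (\<integral>\<^sup>+t. ennreal (s * exp (- s * t)) * indicator {0<..} t * T t + ennreal (s * exp (- s * t)) * indicator {0<..} t * C t \<partial>lborel)"
    unfolding LT_def LC[symmetric] by (subst nn_integral_add) auto
  also have "\<dots> = 1"
    unfolding distrib_left[symmetric] TC using nn_integral_exp_greaterThan[OF s] by simp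
  finally have "LT + ennreal (\<theta> / (\<theta> + \<psi> s)) = ennreal (\<psi> s / (\<theta> + \<psi> s)) + ennreal (\<theta> / (\<theta> + \<psi> s))"
    using psi_pos[OF s] theta_pos by (simp add: ennreal_plus[symmetric] add_divide_distrib[symmetric] add.commute del: ennreal_plus)
  then have "ennreal (\<theta> / (\<theta> + \<psi> s)) + LT = ennreal (\<theta> / (\<theta> + \<psi> s)) + ennreal (\<psi> s / (\<theta> + \<psi> s))"
    by (simp only: add.commute)
  then have LT: "LT = ennreal (\<psi> s / (\<theta> + \<psi> s))"
    unfolding ennreal_add_left_cancel by simp
  show ?thesis
  proof (rule has_bochner_integral_nn_integral)
    \<comment> \<open>Measurability is taken over from \<open>T\<close>, which agrees with
      \<open>\<Phi>\<close> for t \<ge> 0; the factor \<open>pos\<close> hides the other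
      arguments.\<close>
    have eq: "pos t * (exp (- s * t) * \<Phi> t) = pos t * (exp (- s * t) * enn2real (T t))" for t
      by (cases "t > 0") (auto simp: pos_simps PT[symmetric] Phi_nonneg)
    show "(\<lambda>t. pos t * (exp (- s * t) * \<Phi> t)) \<in> borel_measurable lborel"
      unfolding eq by measurable
    have "(\<integral>\<^sup>+t. ennreal (pos t * (exp (- s * t) * \<Phi> t)) \<partial>lborel)
       = (\<integral>\<^sup>+t. ennreal (1 / s) * (ennreal (s * exp (- s * t)) * indicator {0<..} t * T t) \<partial>lborel)"
    proof (rule nn_integral_cong)
      fix t :: real
      show "ennreal (pos t * (exp (- s * t) * \<Phi> t)) = ennreal (1 / s) * (ennreal (s * exp (- s * t)) * indicator {0<..} t * T t)"
        using s Phi_nonneg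
        by (cases "t > 0") (auto simp: pos_simps PT[symmetric] ennreal_mult'[symmetric] simp flip: mult.assoc)
    qed
    also have "\<dots> = ennreal (1 / s) * ennreal (\<psi> s / (\<theta> + \<psi> s))"
      by (subst nn_integral_cmult) (simp_all only: LT_def[symmetric] LT, measurable)
    finally show "(\<integral>\<^sup>+t. ennreal (pos t * (exp (- s * t) * \<Phi> t)) \<partial>lborel) = ennreal (\<psi> s / (s * (\<theta> + \<psi> s)))"
      using s psi_pos[OF s] theta_pos by (simp add: ennreal_mult[symmetric])
  qed (use s psi_pos[OF s] theta_pos Phi_nonneg in \<open>auto simp: pos_simps intro!: AE_I2\<close>)
qed

section \<open>Passage of two levels and the bounds for the correlation kernel\<close>

lemma increment_independent:
  assumes "0 < u" "u < v"
  shows "emeasure M {\<omega>\<in>space M. D u \<omega> \<le> s \<and> r < D v \<omega> - D u \<omega>} = cdfD u s * tailD (v - u) r"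
proof -
  have [measurable]: "D u \<in> borel_measurable M" "D v \<in> borel_measurable M" "D 0 \<in> borel_measurable M"
    using assms by (auto intro!: D_measurable)
  \<comment> \<open>Independence of increments is stated along infinite strictly increasing time
    sequences. This one runs through 0, u, v and continues with v + 1, v + 2 and so on; only its
    first two increments are used, and D(0) = 0 almost surely turns the first into D(u).\<close>
  define p :: "nat \<Rightarrow> real" where "p n = (if n = 0 then 0 else if n = 1 then u else v + real n - 2)" for n
  have p: "p 0 = 0" "p (Suc 0) = u" "p (Suc (Suc 0)) = v" by (auto simp: p_def)
  have "strict_mono p"
    unfolding strict_mono_Suc_iff
  proof
    fix n show "p n < p (Suc n)"
      using assms by (cases "n = 0"; cases "n = 1") (simp_all add: p_def)
  qed
  then have ind: "indep_vars (\<lambda>_. borel) (\<lambda>i \<omega>. D (p (Suc i)) \<omega> - D (p i) \<omega>) {..<2}"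
    using sub p(1) unfolding subordinator_def by (elim conjE allE[of _ "2::nat"] allE[of _ p]) simp
  define A :: "nat \<Rightarrow> real set" where "A i = (if i = 0 then {..s} else {r<..})" for i
  have "prob (\<Inter>i\<in>{0, Suc 0}. (\<lambda>\<omega>. D (p (Suc i)) \<omega> - D (p i) \<omega>) -` A i \<inter> space M)
     = (\<Prod>i\<in>{0, Suc 0}. prob ((\<lambda>\<omega>. D (p (Suc i)) \<omega> - D (p i) \<omega>) -` A i \<inter> space M))"
    by (rule indep_varsD[OF ind]) (auto simp: A_def)
  then have pr: "prob {\<omega>\<in>space M. D u \<omega> - D 0 \<omega> \<le> s \<and> r < D v \<omega> - D u \<omega>}
      = prob {\<omega>\<in>space M. D u \<omega> - D 0 \<omega> \<le> s} * prob {\<omega>\<in>space M. r < D v \<omega> - D u \<omega>}"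
    by (simp add: A_def p vimage_def Int_def conj_ac cong: conj_cong)
  have 1: "emeasure M {\<omega>\<in>space M. D u \<omega> - D 0 \<omega> \<le> s \<and> r < D v \<omega> - D u \<omega>} = emeasure M {\<omega>\<in>space M. D u \<omega> \<le> s \<and> r < D v \<omega> - D u \<omega>}"
    using AE_D0 by (intro emeasure_eq_AE) auto
  have 2: "emeasure M {\<omega>\<in>space M. D u \<omega> - D 0 \<omega> \<le> s} = cdfD u s"
    unfolding cdfD_eq[OF assms(1)] using AE_D0 by (intro emeasure_eq_AE) auto
  have "distr M borel (\<lambda>\<omega>. D v \<omega> - D u \<omega>) = distr M borel (D (v - u))"
    using sub assms unfolding subordinator_def by auto
  then have "emeasure (distr M borel (\<lambda>\<omega>. D v \<omega> - D u \<omega>)) {r<..} = emeasure (distr M borel (D (v - u))) {r<..}"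
    by simp
  then have "emeasure M ((\<lambda>\<omega>. D v \<omega> - D u \<omega>) -` {r<..} \<inter> space M) = emeasure M (D (v - u) -` {r<..} \<inter> space M)"
    using assms by (simp add: emeasure_distr)
  moreover have "(\<lambda>\<omega>. D v \<omega> - D u \<omega>) -` {r<..} \<inter> space M = {\<omega>\<in>space M. r < D v \<omega> - D u \<omega>}"
    "D (v - u) -` {r<..} \<inter> space M = {\<omega>\<in>space M. r < D (v - u) \<omega>}" by auto
  ultimately have 3: "emeasure M {\<omega>\<in>space M. r < D v \<omega> - D u \<omega>} = tailD (v - u) r"
    using assms by (simp add: tailD_eq)
  show ?thesis
    unfolding 1[symmetric] 2[symmetric] 3[symmetric]
    unfolding emeasure_eq_measure pr by (simp add: ennreal_mult)
qed

text \<open>If D(u) \<ge> 0, an increment above t forces D(v) > t; conversely D(u) \<le> s and D(v)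
  > t force an increment above t - s. Both comparison events factorize by independence. This is the
  only place where the correlation is estimated instead of computed.\<close>

lemma two_level_event_bounds:
  assumes "0 \<le> s" "s \<le> t" "0 < u" "u < v"
  shows "cdfD u s * tailD (v - u) t \<le> emeasure M {\<omega>\<in>space M. D u \<omega> \<le> s \<and> t < D v \<omega>}"
    and "emeasure M {\<omega>\<in>space M. D u \<omega> \<le> s \<and> t < D v \<omega>} \<le> cdfD u s * tailD (v - u) (t - s)"
proof -
  have [measurable]: "D u \<in> borel_measurable M" "D v \<in> borel_measurable M"
    using assms by (auto intro!: D_measurable)
  have nn: "AE \<omega> in M. 0 \<le> D u \<omega>" using assms by (intro AE_D_nonneg) auto
  show "cdfD u s * tailD (v - u) t \<le> emeasure M {\<omega>\<in>space M. D u \<omega> \<le> s \<and> t < D v \<omega>}"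
    unfolding increment_independent[OF assms(3,4), symmetric]
    using nn by (intro emeasure_mono_AE) auto
  show "emeasure M {\<omega>\<in>space M. D u \<omega> \<le> s \<and> t < D v \<omega>} \<le> cdfD u s * tailD (v - u) (t - s)"
    unfolding increment_independent[OF assms(3,4), symmetric]
    by (intro emeasure_mono) auto
qed

lemma AE_two_level_event:
  assumes "0 \<le> s" "s \<le> t"
  shows "AE u in lborel. 0 < u \<longrightarrow> (AE v in lborel. u < v \<longrightarrow>
    emeasure M {\<omega>\<in>space M. u < E s \<omega> \<and> E t \<omega> \<le> v} = emeasure M {\<omega>\<in>space M. D u \<omega> \<le> s \<and> t < D v \<omega>})"
  using AE_less_E_iff[OF assms(1)]
proof eventually_elim
  case (elim u)
  have t: "0 \<le> t" using assms by simp
  show ?case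
  proof
    assume u: "0 < u"
    show "AE v in lborel. u < v \<longrightarrow>
      emeasure M {\<omega>\<in>space M. u < E s \<omega> \<and> E t \<omega> \<le> v} = emeasure M {\<omega>\<in>space M. D u \<omega> \<le> s \<and> t < D v \<omega>}"
      using AE_less_E_iff[OF t]
    proof eventually_elim
      case (elim v)
      have [measurable]: "E s \<in> borel_measurable M" "E t \<in> borel_measurable M"
        using assms t by (auto intro: E_measurable)
      show ?case
      proof
        assume v: "u < v"
        have [measurable]: "D u \<in> borel_measurable M" "D v \<in> borel_measurable M"
          using u v by (auto intro!: D_measurable)
        have "AE \<omega> in M. u < E s \<omega> \<longleftrightarrow> D u \<omega> \<le> s" "AE \<omega> in M. v < E t \<omega> \<longleftrightarrow> D v \<omega> \<le> t"
          using elim \<open>0 < u \<longrightarrow> _\<close> u v by auto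
        then have "AE \<omega> in M. \<omega> \<in> {\<omega>\<in>space M. u < E s \<omega> \<and> E t \<omega> \<le> v} \<longleftrightarrow> \<omega> \<in> {\<omega>\<in>space M. D u \<omega> \<le> s \<and> t < D v \<omega>}"
          by eventually_elim (simp add: not_less[symmetric])
        then show "emeasure M {\<omega>\<in>space M. u < E s \<omega> \<and> E t \<omega> \<le> v} = emeasure M {\<omega>\<in>space M. D u \<omega> \<le> s \<and> t < D v \<omega>}"
          by (intro emeasure_eq_AE) auto
      qed
    qed
  qed
qed

text \<open>Substituting v = u + w separates the variables: one factor \<theta> together with the
  integral over w gives \<open>\<Phi> r\<close>, the integral over u gives the renewal function at
  \<open>s\<close>, and the second \<theta> remains in front.\<close>

lemma nn_integral_two_level:
  assumes "r \<ge> 0"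
  shows "(\<integral>\<^sup>+u. (\<integral>\<^sup>+v. ennreal (\<theta> * \<theta> * exp (- \<theta> * (v - u))) *
        (indicator {0<..} u * (if u < v then 1 else 0) * (cdfD u s * tailD (v - u) r)) \<partial>lborel) \<partial>lborel)
     = ennreal (\<theta> * U s * \<Phi> r)"
proof -
  have "(\<integral>\<^sup>+v. ennreal (\<theta> * \<theta> * exp (- \<theta> * (v - u))) *
        (indicator {0<..} u * (if u < v then 1 else 0) * (cdfD u s * tailD (v - u) r)) \<partial>lborel)
      = ennreal (\<theta> * \<Phi> r) * (indicator {0<..} u * cdfD u s)" for u
  proof -
    let ?f = "\<lambda>v. ennreal (\<theta> * \<theta> * exp (- \<theta> * (v - u))) *
        (indicator {0<..} u * (if u < v then 1 else 0) * (cdfD u s * tailD (v - u) r))"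
    have "(\<integral>\<^sup>+v. ?f v \<partial>lborel) = ennreal \<bar>1\<bar> * (\<integral>\<^sup>+w. ?f (u + 1 * w) \<partial>lborel)"
      by (rule nn_integral_real_affine) auto
    also have "\<dots> = (\<integral>\<^sup>+w. ennreal \<theta> * (indicator {0<..} u * cdfD u s) * (ennreal (\<theta> * exp (- \<theta> * w)) * indicator {0<..} w * tailD w r) \<partial>lborel)"
      using theta_pos by (auto intro!: nn_integral_cong simp: indicator_def ennreal_mult mult_ac)
    also have "\<dots> = ennreal \<theta> * (indicator {0<..} u * cdfD u s) * ennreal (\<Phi> r)"
      by (subst nn_integral_cmult) (simp_all only: Phi_eq_tailD[OF assms], measurable)
    finally show ?thesis using theta_pos Phi_nonneg by (simp add: ennreal_mult mult_ac)
  qed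
  then have "(\<integral>\<^sup>+u. (\<integral>\<^sup>+v. ennreal (\<theta> * \<theta> * exp (- \<theta> * (v - u))) *
        (indicator {0<..} u * (if u < v then 1 else 0) * (cdfD u s * tailD (v - u) r)) \<partial>lborel) \<partial>lborel)
     = (\<integral>\<^sup>+u. ennreal (\<theta> * \<Phi> r) * (indicator {0<..} u * cdfD u s) \<partial>lborel)" by simp
  also have "\<dots> = ennreal (\<theta> * \<Phi> r) * renewal s"
    unfolding renewal_def by (subst nn_integral_cmult) auto
  finally show ?thesis
    using theta_pos U_nonneg Phi_nonneg by (simp add: U_ennreal[symmetric] ennreal_mult[symmetric] mult_ac)
qed

definition lag_correlation :: "real \<Rightarrow> real \<Rightarrow> real" where
  "lag_correlation t s = (LINT \<omega>|M. exp (- \<theta> * \<bar>E t \<omega> - E s \<omega>\<bar>))"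

text \<open>The expectation of the pathwise expansion at a = E(s), b = E(t), with the integral over
  the probability space moved inside. The integrand is nonnegative, so no integrability has to be
  checked.\<close>

lemma lag_correlation_eq:
  assumes "0 \<le> s" "s \<le> t"
  shows "ennreal (lag_correlation t s) = ennreal (\<Phi> t) +
    (\<integral>\<^sup>+u. (\<integral>\<^sup>+v. ennreal (\<theta> * \<theta> * exp (- \<theta> * (v - u))) *
        (indicator {0<..} u * (if u < v then 1 else 0) * emeasure M {\<omega>\<in>space M. u < E s \<omega> \<and> E t \<omega> \<le> v}) \<partial>lborel) \<partial>lborel)"
proof -
  interpret P: pair_sigma_finite M lborel ..
  have t: "t \<ge> 0" using assms by simp
  have [measurable]: "E s \<in> borel_measurable M" "E t \<in> borel_measurable M"
    using assms t by (auto intro: E_measurable)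
  let ?k = "\<lambda>u v. ennreal (\<theta> * \<theta> * exp (- \<theta> * (v - u)))"
  let ?i = "\<lambda>u v \<omega>. indicator {0<..} u * (if u < v then 1 else 0) * (if u < E s \<omega> \<and> E t \<omega> \<le> v then 1 else 0) :: ennreal"
  have "ennreal (lag_correlation t s) = (\<integral>\<^sup>+\<omega>. ennreal (exp (- \<theta> * \<bar>E t \<omega> - E s \<omega>\<bar>)) \<partial>M)"
    unfolding lag_correlation_def
  proof (subst nn_integral_eq_integral)
    show "integrable M (\<lambda>\<omega>. exp (- \<theta> * \<bar>E t \<omega> - E s \<omega>\<bar>))"
      using theta_pos by (intro integrable_const_bound[where B = 1]) (auto intro!: AE_I2)
  qed auto
  also have "\<dots> = (\<integral>\<^sup>+\<omega>. ennreal (exp (- \<theta> * E t \<omega>)) + (\<integral>\<^sup>+u. (\<integral>\<^sup>+v. ?k u v * ?i u v \<omega> \<partial>lborel) \<partial>lborel) \<partial>M)"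
  proof (rule nn_integral_cong_AE)
    show "AE \<omega> in M. ennreal (exp (- \<theta> * \<bar>E t \<omega> - E s \<omega>\<bar>)) = ennreal (exp (- \<theta> * E t \<omega>)) + (\<integral>\<^sup>+u. (\<integral>\<^sup>+v. ?k u v * ?i u v \<omega> \<partial>lborel) \<partial>lborel)"
      using AE_E_mono[OF assms(2)]
    proof eventually_elim
      case (elim \<omega>)
      then have "\<bar>E t \<omega> - E s \<omega>\<bar> = E t \<omega> - E s \<omega>" by simp
      then show ?case using exp_difference_expansion[OF theta_pos E_nonneg elim] by simp
    qed
  qed
  also have "\<dots> = (\<integral>\<^sup>+\<omega>. ennreal (exp (- \<theta> * E t \<omega>)) \<partial>M) + (\<integral>\<^sup>+\<omega>. (\<integral>\<^sup>+u. (\<integral>\<^sup>+v. ?k u v * ?i u v \<omega> \<partial>lborel) \<partial>lborel) \<partial>M)"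
    by (rule nn_integral_add) measurable
  also have "(\<integral>\<^sup>+\<omega>. ennreal (exp (- \<theta> * E t \<omega>)) \<partial>M) = ennreal (\<Phi> t)"
    unfolding Phi_def by (subst nn_integral_eq_integral[OF integrable_exp_E[OF t]]) auto
  also have "(\<integral>\<^sup>+\<omega>. (\<integral>\<^sup>+u. (\<integral>\<^sup>+v. ?k u v * ?i u v \<omega> \<partial>lborel) \<partial>lborel) \<partial>M)
     = (\<integral>\<^sup>+u. (\<integral>\<^sup>+\<omega>. (\<integral>\<^sup>+v. ?k u v * ?i u v \<omega> \<partial>lborel) \<partial>M) \<partial>lborel)"
    by (rule P.Fubini'[symmetric]) measurable
  also have "\<dots> = (\<integral>\<^sup>+u. (\<integral>\<^sup>+v. (\<integral>\<^sup>+\<omega>. ?k u v * ?i u v \<omega> \<partial>M) \<partial>lborel) \<partial>lborel)"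
    by (intro nn_integral_cong P.Fubini'[symmetric]) measurable
  also have "\<dots> = (\<integral>\<^sup>+u. (\<integral>\<^sup>+v. ?k u v *
        (indicator {0<..} u * (if u < v then 1 else 0) * emeasure M {\<omega>\<in>space M. u < E s \<omega> \<and> E t \<omega> \<le> v}) \<partial>lborel) \<partial>lborel)"
  proof (intro nn_integral_cong)
    fix u v :: real
    have "(\<integral>\<^sup>+\<omega>. ?k u v * ?i u v \<omega> \<partial>M) = (\<integral>\<^sup>+\<omega>. ?k u v * (indicator {0<..} u * (if u < v then 1 else 0)) * indicator {\<omega>\<in>space M. u < E s \<omega> \<and> E t \<omega> \<le> v} \<omega> \<partial>M)"
      by (intro nn_integral_cong) (auto simp: mult.assoc)
    also have "\<dots> = ?k u v * (indicator {0<..} u * (if u < v then 1 else 0)) * emeasure M {\<omega>\<in>space M. u < E s \<omega> \<and> E t \<omega> \<le> v}"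
      by (subst nn_integral_cmult_indicator) auto
    finally show "(\<integral>\<^sup>+\<omega>. ?k u v * ?i u v \<omega> \<partial>M) = ?k u v * (indicator {0<..} u * (if u < v then 1 else 0) * emeasure M {\<omega>\<in>space M. u < E s \<omega> \<and> E t \<omega> \<le> v})"
      by (simp add: mult.assoc)
  qed
  finally show ?thesis .
qed

theorem lag_correlation_bounds:
  assumes "0 \<le> s" "s \<le> t"
  shows "\<Phi> t * (1 + \<theta> * U s) \<le> lag_correlation t s"
    and "lag_correlation t s \<le> \<Phi> t + \<theta> * U s * \<Phi> (t - s)"
proof -
  have t: "t \<ge> 0" using assms by simp
  let ?w = "\<lambda>u v. indicator {0<..} u * (if u < v then 1 else 0) :: ennreal"
  let ?P = "\<lambda>u v. emeasure M {\<omega>\<in>space M. u < E s \<omega> \<and> E t \<omega> \<le> v}"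
  have ev: "AE u in lborel. AE v in lborel. ?w u v * (cdfD u s * tailD (v - u) t) \<le> ?w u v * ?P u v \<and>
      ?w u v * ?P u v \<le> ?w u v * (cdfD u s * tailD (v - u) (t - s))"
    using AE_two_level_event[OF assms]
  proof eventually_elim
    case (elim u)
    show ?case
    proof (cases "0 < u")
      case True
      with elim have "AE v in lborel. u < v \<longrightarrow>
        ?P u v = emeasure M {\<omega>\<in>space M. D u \<omega> \<le> s \<and> t < D v \<omega>}" by simp
      then show ?thesis
      proof eventually_elim
        case (elim v)
        then show ?case
          using two_level_event_bounds[OF assms True, of v] True by (cases "u < v") auto
      qed
    qed simp
  qed
  have "ennreal (\<Phi> t) + ennreal (\<theta> * U s * \<Phi> t) \<le> ennreal (lag_correlation t s)"
    unfolding lag_correlation_eq[OF assms] nn_integral_two_level[OF t, symmetric]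
  proof (intro add_left_mono nn_integral_mono_AE)
    show "AE u in lborel. (\<integral>\<^sup>+v. ennreal (\<theta> * \<theta> * exp (- \<theta> * (v - u))) * (?w u v * (cdfD u s * tailD (v - u) t)) \<partial>lborel)
        \<le> (\<integral>\<^sup>+v. ennreal (\<theta> * \<theta> * exp (- \<theta> * (v - u))) * (?w u v * ?P u v) \<partial>lborel)"
      using ev
    proof eventually_elim
      case (elim u)
      show ?case by (rule nn_integral_mono_AE, use elim in eventually_elim)
        (elim conjE, rule mult_left_mono, assumption, simp)
    qed
  qed
  then have "ennreal (\<Phi> t * (1 + \<theta> * U s)) \<le> ennreal (lag_correlation t s)"
    using theta_pos U_nonneg[of s] Phi_nonneg[of t] by (simp add: ennreal_plus[symmetric] algebra_simps del: ennreal_plus)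
  moreover have "0 \<le> lag_correlation t s" unfolding lag_correlation_def by simp
  ultimately show "\<Phi> t * (1 + \<theta> * U s) \<le> lag_correlation t s" by simp
  have ts: "t - s \<ge> 0" using assms by simp
  have "ennreal (lag_correlation t s) \<le> ennreal (\<Phi> t) + ennreal (\<theta> * U s * \<Phi> (t - s))"
    unfolding lag_correlation_eq[OF assms] nn_integral_two_level[OF ts, symmetric]
  proof (intro add_left_mono nn_integral_mono_AE)
    show "AE u in lborel. (\<integral>\<^sup>+v. ennreal (\<theta> * \<theta> * exp (- \<theta> * (v - u))) * (?w u v * ?P u v) \<partial>lborel)
        \<le> (\<integral>\<^sup>+v. ennreal (\<theta> * \<theta> * exp (- \<theta> * (v - u))) * (?w u v * (cdfD u s * tailD (v - u) (t - s))) \<partial>lborel)"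
      using ev
    proof eventually_elim
      case (elim u)
      show ?case by (rule nn_integral_mono_AE, use elim in eventually_elim)
        (elim conjE, rule mult_left_mono, assumption, simp)
    qed
  qed
  also have "\<dots> = ennreal (\<Phi> t + \<theta> * U s * \<Phi> (t - s))"
    using theta_pos U_nonneg[of s] Phi_nonneg by (simp add: ennreal_plus[symmetric] del: ennreal_plus)
  finally show "lag_correlation t s \<le> \<Phi> t + \<theta> * U s * \<Phi> (t - s)"
    by (subst (asm) ennreal_le_iff) (use theta_pos U_nonneg[of s] Phi_nonneg in auto)
qed

section \<open>The density \<open>k\<close>\<close>

lemma weighted_k_fun_integral:
  assumes A: "A \<in> sets borel" "A \<subseteq> {0..}"
    and P: "(\<integral>\<^sup>+z. ennreal (\<theta> * exp (- \<theta> * z)) * indicator {0<..} z * (\<integral>\<^sup>+x. ennreal (g x z) * indicator A x \<partial>lborel) \<partial>lborel) = ennreal p"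
    and p: "p \<ge> 0"
  shows "has_bochner_integral lborel (\<lambda>x. indicator A x *\<^sub>R (\<theta> * k_fun g \<theta> x)) p"
proof -
  define kk where "kk x = (\<integral>\<^sup>+z. ennreal (g x z * exp (- \<theta> * z)) * indicator {0<..} z \<partial>lborel)" for x
  have [measurable]: "kk \<in> borel_measurable borel" unfolding kk_def[abs_def] by measurable
  have k: "k_fun g \<theta> x = enn2real (kk x)" for x
  proof -
    have "k_fun g \<theta> x = enn2real (\<integral>\<^sup>+z. ennreal (indicator {0..} z *\<^sub>R (g x z * exp (- \<theta> * z))) \<partial>lborel)"
      unfolding k_fun_def set_lebesgue_integral_def
      by (rule integral_eq_nn_integral) (auto simp: g_nonneg indicator_def intro!: AE_I2)
    also have "(\<integral>\<^sup>+z. ennreal (indicator {0..} z *\<^sub>R (g x z * exp (- \<theta> * z))) \<partial>lborel) = kk x"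
      unfolding kk_def
    proof (rule nn_integral_cong_AE)
      have "AE z in lborel. z \<noteq> (0::real)" by (rule AE_lborel_singleton)
      then show "AE z in lborel. ennreal (indicator {0..} z *\<^sub>R (g x z * exp (- \<theta> * z))) = ennreal (g x z * exp (- \<theta> * z)) * indicator {0<..} z"
        by eventually_elim (auto simp: indicator_def)
    qed
    finally show ?thesis .
  qed
  have [measurable]: "A \<in> sets borel" by (rule A)
  have int: "(\<integral>\<^sup>+x. ennreal \<theta> * kk x * indicator A x \<partial>lborel) = ennreal p"
  proof -
    have "(\<integral>\<^sup>+x. ennreal \<theta> * kk x * indicator A x \<partial>lborel)
      = (\<integral>\<^sup>+x. (\<integral>\<^sup>+z. ennreal (\<theta> * exp (- \<theta> * z)) * indicator {0<..} z * (ennreal (g x z) * indicator A x) \<partial>lborel) \<partial>lborel)"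
    proof (rule nn_integral_cong)
      fix x
      have "ennreal \<theta> * kk x * indicator A x = (ennreal \<theta> * indicator A x) * kk x" by (simp add: mult_ac)
      also have "\<dots> = (\<integral>\<^sup>+z. (ennreal \<theta> * indicator A x) * (ennreal (g x z * exp (- \<theta> * z)) * indicator {0<..} z) \<partial>lborel)"
        unfolding kk_def by (rule nn_integral_cmult[symmetric]) measurable
      also have "\<dots> = (\<integral>\<^sup>+z. ennreal (\<theta> * exp (- \<theta> * z)) * indicator {0<..} z * (ennreal (g x z) * indicator A x) \<partial>lborel)"
        using theta_pos by (intro nn_integral_cong) (simp add: ennreal_mult g_nonneg mult_ac)
      finally show "ennreal \<theta> * kk x * indicator A x = (\<integral>\<^sup>+z. ennreal (\<theta> * exp (- \<theta> * z)) * indicator {0<..} z * (ennreal (g x z) * indicator A x) \<partial>lborel)" .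
    qed
    also have "\<dots> = (\<integral>\<^sup>+z. (\<integral>\<^sup>+x. ennreal (\<theta> * exp (- \<theta> * z)) * indicator {0<..} z * (ennreal (g x z) * indicator A x) \<partial>lborel) \<partial>lborel)"
      by (intro lborel_pair.Fubini') measurable
    also have "\<dots> = (\<integral>\<^sup>+z. ennreal (\<theta> * exp (- \<theta> * z)) * indicator {0<..} z * (\<integral>\<^sup>+x. ennreal (g x z) * indicator A x \<partial>lborel) \<partial>lborel)"
      by (intro nn_integral_cong nn_integral_cmult) measurable
    finally show ?thesis unfolding P .
  qed
  \<comment> \<open>Where the integral over z diverges, \<open>k_fun\<close> has the default value
    0. Since the total \<open>p\<close> is finite, such points of \<open>A\<close> form a null set,
    so the real and the extended integral agree.\<close>
  have "AE x in lborel. ennreal \<theta> * kk x * indicator A x \<noteq> \<infinity>"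
    by (rule nn_integral_PInf_AE) (simp_all add: int)
  then have eq: "AE x in lborel. ennreal (indicator A x *\<^sub>R (\<theta> * k_fun g \<theta> x)) = ennreal \<theta> * kk x * indicator A x"
  proof eventually_elim
    case (elim x)
    show ?case
    proof (cases "x \<in> A")
      case True
      then have "kk x \<noteq> \<top>" using elim theta_pos by (auto simp: ennreal_mult_top)
      then show ?thesis using True theta_pos by (simp add: k ennreal_mult less_top[symmetric])
    qed simp
  qed
  show ?thesis
  proof (rule has_bochner_integral_nn_integral)
    show "(\<lambda>x. indicator A x *\<^sub>R (\<theta> * k_fun g \<theta> x)) \<in> borel_measurable lborel"
      unfolding k by measurable
    show "(\<integral>\<^sup>+x. ennreal (indicator A x *\<^sub>R (\<theta> * k_fun g \<theta> x)) \<partial>lborel) = ennreal p"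
      using nn_integral_cong_AE[OF eq] int by simp
  qed (use p theta_pos in \<open>auto simp: k intro!: AE_I2\<close>)
qed

lemma k_fun_nonneg: "0 \<le> k_fun g \<theta> x"
  unfolding k_fun_def set_lebesgue_integral_def
  by (intro integral_nonneg_AE) (auto simp: g_nonneg indicator_def)

lemma Phi_plus_cdf:
  assumes "t \<ge> 0"
  shows "ennreal (\<Phi> t) + (\<integral>\<^sup>+w. ennreal (\<theta> * exp (- \<theta> * w)) * indicator {0<..} w * cdfD w t \<partial>lborel) = 1"
  unfolding Phi_eq_tailD[OF assms] by (rule exp_weighted_tail_plus_cdf)

text \<open>Exchanging the x and z integrals turns the integral of \<theta> k over [0,t] into the
  mixture of distribution functions complementary to \<open>\<Phi> t\<close>. The density on the
  whole half-line is the same computation with mass 1 for every D(z).\<close>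

theorem Phi_eq_integral_k_fun:
  assumes t: "t \<ge> 0"
  shows "set_integrable lborel {0..t} (\<lambda>x. \<theta> * k_fun g \<theta> x)"
    and "\<Phi> t = 1 - (LINT x:{0..t}|lborel. \<theta> * k_fun g \<theta> x)"
proof -
  let ?C = "(\<integral>\<^sup>+w. ennreal (\<theta> * exp (- \<theta> * w)) * indicator {0<..} w * cdfD w t \<partial>lborel)"
  have "ennreal (\<Phi> t) + ?C = ennreal (\<Phi> t) + ennreal (1 - \<Phi> t)"
    unfolding Phi_plus_cdf[OF t] using Phi_le_1[OF t] Phi_nonneg by (simp add: ennreal_plus[symmetric] del: ennreal_plus)
  then have "?C = ennreal (1 - \<Phi> t)" unfolding ennreal_add_left_cancel by simp
  then have "has_bochner_integral lborel (\<lambda>x. indicator {0..t} x *\<^sub>R (\<theta> * k_fun g \<theta> x)) (1 - \<Phi> t)"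
    using Phi_le_1[OF t] by (intro weighted_k_fun_integral) (auto simp: cdfD_def[symmetric])
  then show "set_integrable lborel {0..t} (\<lambda>x. \<theta> * k_fun g \<theta> x)"
    "\<Phi> t = 1 - (LINT x:{0..t}|lborel. \<theta> * k_fun g \<theta> x)"
    unfolding set_integrable_def set_lebesgue_integral_def has_bochner_integral_iff by auto
qed

theorem k_fun_density:
  shows "set_integrable lborel {0..} (\<lambda>x. \<theta> * k_fun g \<theta> x)"
    and "(LINT x:{0..}|lborel. \<theta> * k_fun g \<theta> x) = 1"
proof -
  have one: "(\<integral>\<^sup>+x. ennreal (g x z) * indicator {0..} x \<partial>lborel) = 1" if z: "z > 0" for z
  proof -
    have [measurable]: "D z \<in> borel_measurable M" using z by (intro D_measurable) simp
    have "(\<integral>\<^sup>+x. ennreal (g x z) * indicator {0..} x \<partial>lborel) = emeasure M (D z -` {0..} \<inter> space M)"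
      using distributed_emeasure[OF g_distributed[OF z], of "{0..}"] by simp
    also have "\<dots> = emeasure M (space M)"
      using AE_D_nonneg[of z] z by (intro emeasure_eq_AE) auto
    finally show ?thesis by (simp add: emeasure_space_1)
  qed
  have "(\<integral>\<^sup>+z. ennreal (\<theta> * exp (- \<theta> * z)) * indicator {0<..} z * (\<integral>\<^sup>+x. ennreal (g x z) * indicator {0..} x \<partial>lborel) \<partial>lborel)
      = (\<integral>\<^sup>+z. ennreal (\<theta> * exp (- \<theta> * z)) * indicator {0<..} z \<partial>lborel)"
  proof (rule nn_integral_cong)
    fix z :: real
    show "ennreal (\<theta> * exp (- \<theta> * z)) * indicator {0<..} z * (\<integral>\<^sup>+x. ennreal (g x z) * indicator {0..} x \<partial>lborel)
      = ennreal (\<theta> * exp (- \<theta> * z)) * indicator {0<..} z"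
      using one[of z] by (cases "z > 0") auto
  qed
  also have "\<dots> = ennreal 1" unfolding nn_integral_exp_greaterThan[OF theta_pos] by simp
  finally have "has_bochner_integral lborel (\<lambda>x. indicator {0..} x *\<^sub>R (\<theta> * k_fun g \<theta> x)) 1"
    by (intro weighted_k_fun_integral) auto
  then show "set_integrable lborel {0..} (\<lambda>x. \<theta> * k_fun g \<theta> x)"
    "(LINT x:{0..}|lborel. \<theta> * k_fun g \<theta> x) = 1"
    unfolding set_integrable_def set_lebesgue_integral_def has_bochner_integral_iff by auto
qed

text \<open>Chebyshev's bound \<open>E exp (- D w) \<le> P (D w \<le> s) + exp (- s)\<close> at small times \<open>w\<close>.\<close>
lemma U_pos:
  assumes s: "s > 0"
  shows "U s > 0"
proof -
  \<comment> \<open>For w < a one has w \<psi>(1) \<le> s/2, so E exp(-D(w)) is at least exp(-s/2),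
    which exceeds exp(-s).\<close>
  define a where "a = s / (2 * \<psi> 1)"
  have a: "a > 0" using s psi_pos[of 1] by (simp add: a_def)
  have le: "ennreal (exp (- s / 2) - exp (- s)) \<le> cdfD w s" if w: "0 < w" "w < a" for w
  proof -
    have [measurable]: "D w \<in> borel_measurable M" using w by (intro D_measurable) simp
    have "w * \<psi> 1 \<le> s / 2"
      using w psi_pos[of 1] by (simp add: a_def field_simps)
    then have "ennreal (exp (- s / 2)) \<le> ennreal (exp (- w * \<psi> 1))" by simp
    also have "\<dots> = (\<integral>\<^sup>+\<omega>. ennreal (exp (- 1 * D w \<omega>)) \<partial>M)"
      using w by (intro D_laplace[symmetric]) auto
    also have "\<dots> \<le> (\<integral>\<^sup>+\<omega>. indicator {\<omega>\<in>space M. D w \<omega> \<le> s} \<omega> + ennreal (exp (- s)) \<partial>M)"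
    proof (rule nn_integral_mono_AE)
      show "AE \<omega> in M. ennreal (exp (- 1 * D w \<omega>)) \<le> indicator {\<omega>\<in>space M. D w \<omega> \<le> s} \<omega> + ennreal (exp (- s))"
        using AE_D_nonneg[of w, OF less_imp_le[OF w(1)]] AE_space
      proof eventually_elim
        case (elim \<omega>)
        show ?case
        proof (cases "D w \<omega> \<le> s")
          case True
          have "ennreal (exp (- 1 * D w \<omega>)) \<le> 1" using elim by simp
          also have "(1::ennreal) \<le> 1 + ennreal (exp (- s))" by simp
          finally show ?thesis using True elim by simp
        qed (use elim in simp)
      qed
    qed
    also have "\<dots> = cdfD w s + ennreal (exp (- s))"
      unfolding cdfD_eq[OF w(1)] by (subst nn_integral_add) (auto simp: emeasure_space_1)
    finally have "ennreal (exp (- s / 2)) - ennreal (exp (- s)) \<le> cdfD w s"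
      by (simp add: ennreal_minus_le_iff add.commute)
    then show ?thesis by (simp add: ennreal_minus)
  qed
  have "0 < ennreal (exp (- s / 2) - exp (- s)) * ennreal a"
    using s a by (simp add: ennreal_zero_less_mult_iff)
  also have "\<dots> = (\<integral>\<^sup>+w. ennreal (exp (- s / 2) - exp (- s)) * indicator {0<..<a} w \<partial>lborel)"
    using a by (subst nn_integral_cmult_indicator) auto
  also have "\<dots> \<le> renewal s"
    unfolding renewal_def using le by (intro nn_integral_mono) (auto simp: indicator_def)
  finally show ?thesis unfolding U_ennreal[symmetric] by simp
qed

section \<open>Asymptotics when \<open>\<psi>\<close> has a power law at 0\<close>

context
  fixes \<beta> c :: real
  assumes beta: "0 < \<beta>" "\<beta> < 1" and c: "c > 0"
    and psi_lim: "((\<lambda>s. s powr (- \<beta>) * \<psi> s) \<longlongrightarrow> c) (at_right 0)"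
begin

lemma psi_tendsto_0: "(\<psi> \<longlongrightarrow> 0) (at_right 0)"
proof -
  have "((\<lambda>s::real. s powr \<beta>) \<longlongrightarrow> 0 powr \<beta>) (at_right 0)"
    using beta by (intro tendsto_powr2 tendsto_ident_at tendsto_const) (auto simp: eventually_at_filter)
  then have "((\<lambda>s. s powr \<beta> * (s powr (- \<beta>) * \<psi> s)) \<longlongrightarrow> 0 * c) (at_right 0)"
    using psi_lim by (intro tendsto_mult) auto
  moreover have "\<forall>\<^sub>F s in at_right 0. s powr \<beta> * (s powr (- \<beta>) * \<psi> s) = \<psi> s"
    unfolding eventually_at_filter by (auto simp: powr_minus intro!: always_eventually)
  ultimately show ?thesis by (auto intro: Lim_transform_eventually)
qed

text \<open>Near 0 the denominator \<theta> + \<psi>(s) tends to \<theta>, so the transform behaves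
  like (c/\<theta>) s^(\<beta>-1) and the Tauberian theorem applies with exponent 1 -
  \<beta>.\<close>

theorem Phi_asymptotics: "((\<lambda>t. t powr \<beta> * \<Phi> t) \<longlongrightarrow> c / \<theta> / Gamma (1 - \<beta>)) at_top"
proof -
  have "((\<lambda>t. t powr (1 - (1 - \<beta>)) * \<Phi> t) \<longlongrightarrow> c / \<theta> / Gamma (1 - \<beta>)) at_top"
  proof (rule karamata_monotone[where L = "\<lambda>s. \<psi> s / (s * (\<theta> + \<psi> s))"])
    show "mono_on {0<..} \<Phi> \<or> antimono_on {0<..} \<Phi>"
      by (rule disjI2) (auto intro!: monotone_onI Phi_antimono)
    have "((\<lambda>s. s powr (- \<beta>) * \<psi> s / (\<theta> + \<psi> s)) \<longlongrightarrow> c / (\<theta> + 0)) (at_right 0)"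
      using psi_lim psi_tendsto_0 theta_pos by (intro tendsto_intros) auto
    moreover have "\<forall>\<^sub>F s in at_right 0. s powr (- \<beta>) * \<psi> s / (\<theta> + \<psi> s) = s powr (1 - \<beta>) * (\<psi> s / (s * (\<theta> + \<psi> s)))"
      unfolding eventually_at_filter
      by (auto simp: powr_mult_base[of _ "- \<beta>", simplified, symmetric] intro!: always_eventually)
    ultimately show "((\<lambda>s. s powr (1 - \<beta>) * (\<psi> s / (s * (\<theta> + \<psi> s)))) \<longlongrightarrow> c / \<theta>) (at_right 0)"
      by (auto intro: Lim_transform_eventually)
  qed (use beta Phi_nonneg Phi_laplace in auto)
  then show ?thesis by simp
qed

theorem U_asymptotics: "((\<lambda>t. t powr (- \<beta>) * U t) \<longlongrightarrow> 1 / c / Gamma (1 + \<beta>)) at_top"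
proof -
  have "((\<lambda>t. t powr (1 - (1 + \<beta>)) * U t) \<longlongrightarrow> 1 / c / Gamma (1 + \<beta>)) at_top"
  proof (rule karamata_monotone[where L = "\<lambda>s. 1 / (s * \<psi> s)"])
    show "mono_on {0<..} U \<or> antimono_on {0<..} U"
      by (rule disjI1) (auto intro!: mono_onI U_mono)
    have "((\<lambda>s. 1 / (s powr (- \<beta>) * \<psi> s)) \<longlongrightarrow> 1 / c) (at_right 0)"
      using psi_lim c by (intro tendsto_intros) auto
    moreover have "\<forall>\<^sub>F s in at_right 0. 1 / (s powr (- \<beta>) * \<psi> s) = s powr (1 + \<beta>) * (1 / (s * \<psi> s))"
      unfolding eventually_at_filter
      by (auto simp: powr_add powr_minus field_simps intro!: always_eventually)
    ultimately show "((\<lambda>s. s powr (1 + \<beta>) * (1 / (s * \<psi> s))) \<longlongrightarrow> 1 / c) (at_right 0)"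
      by (auto intro: Lim_transform_eventually)
  qed (use beta U_nonneg U_laplace in auto)
  then show ?thesis by simp
qed

lemma Phi_pos_eventually: "\<forall>\<^sub>F t in at_top. \<Phi> t > 0"
proof -
  have "c / \<theta> / Gamma (1 - \<beta>) > 0"
    using c theta_pos beta Gamma_real_pos[of "1 - \<beta>"] by simp
  then have "\<forall>\<^sub>F t in at_top. t powr \<beta> * \<Phi> t > 0"
    by (rule order_tendstoD(1)[OF Phi_asymptotics])
  then show ?thesis by eventually_elim (auto simp: zero_less_mult_iff)
qed

text \<open>\<open>\<Phi>\<close> is asymptotically a multiple of t^(-\<beta>), and (1 -
  S(t)/t)^\<beta> tends to 1 when S(t) = o(t). It serves both for constant shifts and for shifts
  growing with t.\<close>

lemma Phi_shift_ratio:
  assumes "filterlim (\<lambda>t. t - S t) at_top at_top" "((\<lambda>t. S t / t) \<longlongrightarrow> 0) at_top"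
  shows "((\<lambda>t. \<Phi> (t - S t) / \<Phi> t) \<longlongrightarrow> 1) at_top"
proof -
  let ?K = "c / \<theta> / Gamma (1 - \<beta>)"
  have K: "?K > 0" using c theta_pos beta Gamma_real_pos[of "1 - \<beta>"] by simp
  have 1: "((\<lambda>t. (t - S t) powr \<beta> * \<Phi> (t - S t)) \<longlongrightarrow> ?K) at_top"
    by (rule filterlim_compose[OF Phi_asymptotics assms(1)])
  have 2: "((\<lambda>t. (1 - S t / t) powr \<beta>) \<longlongrightarrow> (1 - 0) powr \<beta>) at_top"
    by (intro tendsto_powr tendsto_diff tendsto_const assms(2)) simp
  have "((\<lambda>t. (t - S t) powr \<beta> * \<Phi> (t - S t) / (t powr \<beta> * \<Phi> t * (1 - S t / t) powr \<beta>)) \<longlongrightarrow> ?K / (?K * (1 - 0) powr \<beta>)) at_top"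
    using K by (intro tendsto_divide tendsto_mult 1 2 Phi_asymptotics) auto
  moreover have "\<forall>\<^sub>F t in at_top. (t - S t) powr \<beta> * \<Phi> (t - S t) / (t powr \<beta> * \<Phi> t * (1 - S t / t) powr \<beta>) = \<Phi> (t - S t) / \<Phi> t"
    using eventually_gt_at_top[of 0] filterlim_at_top_dense[THEN iffD1, OF assms(1), rule_format, of 0]
  proof eventually_elim
    case (elim t)
    have "(t - S t) powr \<beta> = t powr \<beta> * (1 - S t / t) powr \<beta>"
    proof -
      have "t - S t = t * (1 - S t / t)" using elim by (simp add: right_diff_distrib)
      then show ?thesis using elim by (simp only: powr_mult)
    qed
    moreover have "(t - S t) powr \<beta> > 0" using elim by simp
    ultimately show ?case by auto
  qed
  ultimately have "((\<lambda>t. \<Phi> (t - S t) / \<Phi> t) \<longlongrightarrow> ?K / (?K * (1 - 0) powr \<beta>)) at_top"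
    by (rule Lim_transform_eventually)
  moreover have "?K / (?K * (1 - 0) powr \<beta>) = 1"
    unfolding diff_zero powr_one_eq_one mult_1_right using K by (intro divide_self) linarith
  ultimately show ?thesis by (simp only:)
qed

text \<open>The lower bound is exactly the denominator. As \<open>\<Phi>\<close> decreases, the
  upper bound is at most \<Phi>(t - S) (1 + \<theta> U(S)), so the quotient lies between 1 and
  \<Phi>(t - S) / \<Phi>(t). The factor containing U(S) cancels, which is why S may tend to
  infinity.\<close>

theorem lag_correlation_asymptotics:
  assumes S: "\<forall>\<^sub>F t in at_top. 0 \<le> S t" "((\<lambda>t. S t / t) \<longlongrightarrow> 0) at_top"
  shows "((\<lambda>t. lag_correlation t (S t) / (\<Phi> t * (1 + \<theta> * U (S t)))) \<longlongrightarrow> 1) at_top"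
proof -
  \<comment> \<open>This gives t - S(t) \<ge> t/2, so the shifted argument also tends to
    infinity.\<close>
  have half: "\<forall>\<^sub>F t in at_top. S t \<le> t / 2"
    using order_tendstoD(2)[OF S(2), of "1/2", simplified] eventually_gt_at_top[of 0]
    by eventually_elim (simp add: field_simps)
  have "filterlim (\<lambda>t::real. t * (1 / 2)) at_top at_top"
    by (rule filterlim_at_top_mult_tendsto_pos[OF tendsto_const _ filterlim_ident]) simp
  then have "filterlim (\<lambda>t. t - S t) at_top at_top"
    by (rule filterlim_at_top_mono) (use half in eventually_elim, simp)
  from Phi_shift_ratio[OF this S(2)]
  have R: "((\<lambda>t. \<Phi> (t - S t) / \<Phi> t) \<longlongrightarrow> 1) at_top" .
  show ?thesis
  proof (rule tendsto_sandwich[OF _ _ tendsto_const R])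
    have ev: "\<forall>\<^sub>F t in at_top. 0 \<le> S t \<and> S t \<le> t \<and> \<Phi> t > 0"
      using half S(1) eventually_gt_at_top[of 0] Phi_pos_eventually by eventually_elim auto
    show "\<forall>\<^sub>F t in at_top. 1 \<le> lag_correlation t (S t) / (\<Phi> t * (1 + \<theta> * U (S t)))"
      using ev
    proof eventually_elim
      case (elim t)
      have "1 + \<theta> * U (S t) > 0" using U_nonneg[of "S t"] theta_pos by (simp add: add_pos_nonneg)
      then show ?case using elim lag_correlation_bounds(1)[of "S t" t] by simp
    qed
    show "\<forall>\<^sub>F t in at_top. lag_correlation t (S t) / (\<Phi> t * (1 + \<theta> * U (S t))) \<le> \<Phi> (t - S t) / \<Phi> t"
      using ev
    proof eventually_elim
      case (elim t)
      have p: "1 + \<theta> * U (S t) > 0" using U_nonneg[of "S t"] theta_pos by (simp add: add_pos_nonneg)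
      have "lag_correlation t (S t) \<le> \<Phi> t + \<theta> * U (S t) * \<Phi> (t - S t)"
        using elim by (intro lag_correlation_bounds) auto
      also have "\<dots> \<le> \<Phi> (t - S t) * (1 + \<theta> * U (S t))"
        using elim Phi_antimono[of "t - S t" t] by (simp add: algebra_simps)
      finally show ?case using elim p by (simp add: divide_le_eq mult_ac)
    qed
  qed
qed

end

end

section \<open>The renewal function and Mittag-Leffler functions\<close>

lemma powr_mult_nat_add:
  fixes x a b :: real
  assumes "x > 0"
  shows "x powr (a * real j + b) = x powr b * (x powr a) ^ j"
  using assms powr_realpow[of "x powr a" j] by (simp add: powr_add powr_powr)

text \<open>Only the part of the Gamma integral over [R, R+1] is kept. Since R is arbitrary,
  \<Gamma>(\<alpha> j + b) outgrows every geometric sequence in j.\<close>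

lemma Gamma_lower_bound:
  fixes p R :: real
  assumes "p \<ge> 1" "R > 0"
  shows "R powr (p - 1) * exp (- (R + 1)) \<le> Gamma p"
proof -
  have hb: "has_bochner_integral lborel (\<lambda>t. pos t * (exp (- 1 * t) * t powr (p - 1))) (Gamma p * 1 powr (- p))"
    by (rule laplace_powr) (use assms in auto)
  have hc: "has_bochner_integral lborel (\<lambda>t. indicator {R..R + 1} t *\<^sub>R (R powr (p - 1) * exp (- (R + 1)))) (measure lborel {R..R + 1} *\<^sub>R (R powr (p - 1) * exp (- (R + 1))))"
    by (rule has_bochner_integral_indicator) (auto simp: emeasure_lborel_Icc_eq)
  have "(LINT t|lborel. indicator {R..R + 1} t *\<^sub>R (R powr (p - 1) * exp (- (R + 1)))) \<le> (LINT t|lborel. pos t * (exp (- 1 * t) * t powr (p - 1)))"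
  proof (rule integral_mono)
    fix t
    show "indicator {R..R + 1} t *\<^sub>R (R powr (p - 1) * exp (- (R + 1))) \<le> pos t * (exp (- 1 * t) * t powr (p - 1))"
    proof (cases "t \<in> {R..R + 1}")
      case True
      then have "R powr (p - 1) * exp (- (R + 1)) \<le> t powr (p - 1) * exp (- 1 * t)"
        using assms by (intro mult_mono powr_mono2) auto
      then show ?thesis using True assms by (simp add: pos_simps mult.commute)
    qed (simp add: pos_simps)
  qed (use hb hc in \<open>auto simp: has_bochner_integral_iff\<close>)
  then show ?thesis using hb hc by (simp add: has_bochner_integral_iff)
qed

lemma mittag_leffler_summable:
  fixes \<alpha> b x :: real
  assumes "\<alpha> > 0" "b > 0"
  shows "summable (\<lambda>j. norm (x ^ j / Gamma (\<alpha> * real j + b)))"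
proof -
  \<comment> \<open>Chosen so that R^\<alpha> = 2|x| + 1 exceeds |x|; the terms are then dominated
    by a geometric series of ratio |x| / R^\<alpha> < 1.\<close>
  define R where "R = (2 * \<bar>x\<bar> + 1) powr (1 / \<alpha>)"
  have R: "R > 0" "R powr \<alpha> = 2 * \<bar>x\<bar> + 1"
    using assms by (auto simp: R_def powr_powr)
  define q where "q = \<bar>x\<bar> / R powr \<alpha>"
  have q: "0 \<le> q" "q < 1" unfolding q_def R by (auto simp: divide_less_eq)
  define C where "C = exp (R + 1) * R powr (1 - b)"
  have "\<forall>\<^sub>F j in sequentially. real j \<ge> 1 / \<alpha>"
    using filterlim_real_sequentially by (simp add: filterlim_at_top)
  then have ev: "\<forall>\<^sub>F j in sequentially. norm (norm (x ^ j / Gamma (\<alpha> * real j + b))) \<le> C * q ^ j"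
  proof eventually_elim
    case (elim j)
    let ?p = "\<alpha> * real j + b"
    have "1 \<le> \<alpha> * real j" using elim assms by (simp add: field_simps)
    then have p: "?p \<ge> 1" using assms by simp
    have low: "R powr (?p - 1) * exp (- (R + 1)) \<le> Gamma ?p" by (rule Gamma_lower_bound[OF p R(1)])
    have lowpos: "R powr (?p - 1) * exp (- (R + 1)) > 0" using R by simp
    have "norm (x ^ j / Gamma ?p) = \<bar>x\<bar> ^ j / Gamma ?p"
      using low lowpos by (simp add: power_abs)
    also have "\<dots> \<le> \<bar>x\<bar> ^ j / (R powr (?p - 1) * exp (- (R + 1)))"
      using low lowpos by (intro divide_left_mono) auto
    also have "R powr (?p - 1) = (R powr \<alpha>) ^ j * R powr (b - 1)"
      using powr_mult_nat_add[OF R(1), of \<alpha> j "b - 1"] by (simp add: mult.commute add_diff_eq)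
    also have "\<bar>x\<bar> ^ j / ((R powr \<alpha>) ^ j * R powr (b - 1) * exp (- (R + 1))) = C * q ^ j"
      unfolding C_def q_def exp_minus using R(1) by (simp add: power_divide powr_diff divide_simps)
    finally show ?case by simp
  qed
  moreover have "summable (\<lambda>j. C * q ^ j)" using q by (intro summable_mult summable_geometric) auto
  ultimately show ?thesis by (rule summable_comparison_test_ev)
qed

lemma mittag_leffler_continuous:
  assumes "\<alpha> > 0" "b > 0"
  shows "isCont (mittag_leffler \<alpha> b) z"
proof -
  have "isCont (\<lambda>x. \<Sum>j. inverse (Gamma (\<alpha> * real j + b)) * x ^ j) z"
  proof (rule isCont_powser)
    have "summable (\<lambda>j. (\<bar>z\<bar> + 1) ^ j / Gamma (\<alpha> * real j + b))"
      by (rule summable_norm_cancel[OF mittag_leffler_summable[OF assms]])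
    then show "summable (\<lambda>j. inverse (Gamma (\<alpha> * real j + b)) * (\<bar>z\<bar> + 1) ^ j)"
      by (simp add: divide_inverse mult.commute)
  qed simp
  then show ?thesis
    unfolding mittag_leffler_def[abs_def] by (simp add: divide_inverse mult.commute)
qed

text \<open>The weight \<open>w\<close> is \<open>exp (-s y)\<close> for the Laplace transform and the indicator of an interval for the
  antiderivative.\<close>
lemma mittag_leffler_termwise:
  fixes \<alpha> b \<kappa> :: real and w :: "real \<Rightarrow> real"
  assumes ab: "\<alpha> > 0" "b > 0" and \<kappa>: "\<kappa> \<ge> 0"
    and w: "\<And>y. 0 \<le> w y" "\<And>y. y < 0 \<Longrightarrow> w y = 0"
    and I: "\<And>j::nat. has_bochner_integral lborel (\<lambda>y. w y * y powr (\<alpha> * real j + b - 1)) (I j)"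
    and sm: "summable (\<lambda>j. \<kappa> ^ j * I j / Gamma (\<alpha> * real j + b))"
  shows "has_bochner_integral lborel (\<lambda>y. w y * (y powr (b - 1) * mittag_leffler \<alpha> b (- \<kappa> * y powr \<alpha>)))
    (\<Sum>j. (- \<kappa>) ^ j * I j / Gamma (\<alpha> * real j + b))"
proof -
  define G where "G j = Gamma (\<alpha> * real j + b)" for j :: nat
  have G: "G j > 0" for j unfolding G_def using ab by (intro Gamma_real_pos add_nonneg_pos) auto
  define f where "f j y = (- \<kappa>) ^ j / G j * (w y * y powr (\<alpha> * real j + b - 1))" for j y
  have hf: "has_bochner_integral lborel (f j) ((- \<kappa>) ^ j / G j * I j)" for j
    unfolding f_def[abs_def] by (rule has_bochner_integral_mult_right) (rule I)
  have feq: "f j y = w y * y powr (b - 1) * ((- \<kappa> * y powr \<alpha>) ^ j / G j)" for j y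
  proof (cases "y > 0")
    case True
    have "y powr (\<alpha> * real j + b - 1) = y powr (b - 1) * (y powr \<alpha>) ^ j"
      using powr_mult_nat_add[OF True, of \<alpha> j "b - 1"] by (simp add: add_diff_eq)
    then show ?thesis unfolding f_def by (simp flip: power_mult_distrib)
  next
    case False
    \<comment> \<open>At y = 0 both sides vanish because \<open>0 powr a = 0\<close> for every
      \<open>a\<close>; for negative y the weight vanishes.\<close>
    then have "y = 0 \<or> y < 0" by auto
    then show ?thesis using w(2) by (auto simp: f_def)
  qed
  have abs: "norm (f j y) = \<kappa> ^ j / G j * (w y * y powr (\<alpha> * real j + b - 1))" for j y
    unfolding f_def using G[of j] \<kappa> w(1)[of y] by (simp add: abs_mult power_abs)
  have habs: "has_bochner_integral lborel (\<lambda>y. norm (f j y)) (\<kappa> ^ j / G j * I j)" for j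
    unfolding abs by (rule has_bochner_integral_mult_right) (rule I)
  have sumpt: "summable (\<lambda>j. norm (f j y))" for y
  proof -
    have "summable (\<lambda>j. norm (w y * y powr (b - 1)) * norm ((- \<kappa> * y powr \<alpha>) ^ j / G j))"
      unfolding G_def by (intro summable_mult mittag_leffler_summable ab)
    then show ?thesis unfolding feq norm_mult .
  qed
  have 1: "integrable lborel (f j)" for j using hf by (auto simp: has_bochner_integral_iff)
  have 2: "AE y in lborel. summable (\<lambda>j. norm (f j y))" using sumpt by simp
  have 3: "summable (\<lambda>j. LINT y|lborel. norm (f j y))"
    using habs sm by (simp add: has_bochner_integral_iff G_def)
  have S: "(\<Sum>j. f j y) = w y * (y powr (b - 1) * mittag_leffler \<alpha> b (- \<kappa> * y powr \<alpha>))" for y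
  proof -
    have "summable (\<lambda>j. (- \<kappa> * y powr \<alpha>) ^ j / G j)"
      unfolding G_def by (rule summable_norm_cancel[OF mittag_leffler_summable[OF ab]])
    from suminf_mult[OF this, of "w y * y powr (b - 1)"] show ?thesis
      unfolding feq mittag_leffler_def G_def[symmetric] by (simp only: mult.assoc)
  qed
  have "integrable lborel (\<lambda>y. \<Sum>j. f j y)" by (rule integrable_suminf[OF 1 2 3])
  moreover have "(LINT y|lborel. (\<Sum>j. f j y)) = (\<Sum>j. LINT y|lborel. f j y)" by (rule integral_suminf[OF 1 2 3])
  moreover have "(LINT y|lborel. f j y) = (- \<kappa>) ^ j * I j / G j" for j
    using hf[of j] by (simp add: has_bochner_integral_iff)
  ultimately show ?thesis unfolding S G_def by (simp add: has_bochner_integral_iff)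
qed

text \<open>The function y^(\<alpha> j + b - 1) / \<Gamma>(\<alpha> j + b) has the transform
  s^(-(\<alpha> j + b)), so the series becomes geometric with ratio -\<kappa> s^(-\<alpha>); the
  condition \<kappa> < s^\<alpha> is its absolute convergence.\<close>

lemma mittag_leffler_laplace:
  fixes \<alpha> b \<kappa> s :: real
  assumes ab: "\<alpha> > 0" "b > 0" and \<kappa>: "\<kappa> \<ge> 0" and s: "s > 0" "\<kappa> < s powr \<alpha>"
  shows "has_bochner_integral lborel (\<lambda>y. pos y * (exp (- s * y) * (y powr (b - 1) * mittag_leffler \<alpha> b (- \<kappa> * y powr \<alpha>))))
    (s powr (- b) / (1 + \<kappa> * s powr (- \<alpha>)))"
proof -
  define r where "r = \<kappa> * s powr (- \<alpha>)"
  have r: "0 \<le> r" "r < 1" using \<kappa> s by (auto simp: r_def powr_minus field_simps)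
  have pow: "s powr (- (\<alpha> * real j + b)) = s powr (- b) * (s powr (- \<alpha>)) ^ j" for j :: nat
    using powr_mult_nat_add[OF s(1), of "- \<alpha>" j "- b"] by simp
  have G: "Gamma (\<alpha> * real j + b) > 0" for j :: nat using ab by (intro Gamma_real_pos add_nonneg_pos) auto
  have coeff: "k ^ j * (Gamma (\<alpha> * real j + b) * s powr (- (\<alpha> * real j + b))) / Gamma (\<alpha> * real j + b) = s powr (- b) * (k * s powr (- \<alpha>)) ^ j" for k j
    using G[of j] unfolding pow by (simp add: power_mult_distrib)
  have "has_bochner_integral lborel (\<lambda>y. (pos y * exp (- s * y)) * (y powr (b - 1) * mittag_leffler \<alpha> b (- \<kappa> * y powr \<alpha>)))
    (\<Sum>j. (- \<kappa>) ^ j * (Gamma (\<alpha> * real j + b) * s powr (- (\<alpha> * real j + b))) / Gamma (\<alpha> * real j + b))"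
  proof (rule mittag_leffler_termwise[OF ab \<kappa>])
    show "has_bochner_integral lborel (\<lambda>y. pos y * exp (- s * y) * y powr (\<alpha> * real j + b - 1)) (Gamma (\<alpha> * real j + b) * s powr (- (\<alpha> * real j + b)))" for j
      using laplace_powr[of "\<alpha> * real j + b" s] ab s by (simp add: add_nonneg_pos mult.assoc)
    show "summable (\<lambda>j. \<kappa> ^ j * (Gamma (\<alpha> * real j + b) * s powr (- (\<alpha> * real j + b))) / Gamma (\<alpha> * real j + b))"
      unfolding coeff r_def[symmetric] using r by (intro summable_mult summable_geometric) auto
  qed (auto simp: pos_simps)
  moreover have "(\<Sum>j. s powr (- b) * (- \<kappa> * s powr (- \<alpha>)) ^ j) = s powr (- b) / (1 + \<kappa> * s powr (- \<alpha>))"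
    using suminf_mult[OF summable_geometric[of "- r"], of "s powr (- b)"] suminf_geometric[of "- r"] r
    by (simp add: r_def)
  ultimately show ?thesis unfolding coeff by (simp add: mult.assoc)
qed

text \<open>Integrating y^(p-1) over [0,x] gives x^p / p, and p \<Gamma>(p) = \<Gamma>(p+1) raises
  the second Mittag-Leffler parameter by one.\<close>

lemma mittag_leffler_integral:
  fixes \<alpha> b \<kappa> x :: real
  assumes ab: "\<alpha> > 0" "b > 0" and \<kappa>: "\<kappa> \<ge> 0" and x: "x > 0"
  shows "has_bochner_integral lborel (\<lambda>y. indicator {0..x} y * (y powr (b - 1) * mittag_leffler \<alpha> b (- \<kappa> * y powr \<alpha>)))
    (x powr b * mittag_leffler \<alpha> (b + 1) (- \<kappa> * x powr \<alpha>))"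
proof -
  have pow: "x powr (\<alpha> * real j + b) = x powr b * (x powr \<alpha>) ^ j" for j :: nat
    by (rule powr_mult_nat_add[OF x])
  have p: "\<alpha> * real j + b > 0" for j :: nat using ab by (intro add_nonneg_pos) auto
  have G: "Gamma (\<alpha> * real j + b + 1) = (\<alpha> * real j + b) * Gamma (\<alpha> * real j + b)" for j :: nat
    using Gamma_plus1[of "\<alpha> * real j + b"] p[of j] by (auto simp: nonpos_Ints_def)
  have coeff: "k ^ j * (x powr (\<alpha> * real j + b) / (\<alpha> * real j + b)) / Gamma (\<alpha> * real j + b)
     = x powr b * ((k * x powr \<alpha>) ^ j / Gamma (\<alpha> * real j + (b + 1)))" for k and j :: nat
    unfolding pow using G[of j] by (simp add: power_mult_distrib add.assoc[symmetric])
  have sm: "summable (\<lambda>j. (k * x powr \<alpha>) ^ j / Gamma (\<alpha> * real j + (b + 1)))" for k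
    by (rule summable_norm_cancel[OF mittag_leffler_summable]) (use ab in auto)
  have "has_bochner_integral lborel (\<lambda>y. indicator {0..x} y * (y powr (b - 1) * mittag_leffler \<alpha> b (- \<kappa> * y powr \<alpha>)))
    (\<Sum>j. (- \<kappa>) ^ j * (x powr (\<alpha> * real j + b) / (\<alpha> * real j + b)) / Gamma (\<alpha> * real j + b))"
  proof (rule mittag_leffler_termwise[OF ab \<kappa>])
    show "has_bochner_integral lborel (\<lambda>y. indicator {0..x} y * y powr (\<alpha> * real j + b - 1)) (x powr (\<alpha> * real j + b) / (\<alpha> * real j + b))" for j
    proof (rule has_bochner_integral_nn_integral)
      have "((\<lambda>y. y powr (\<alpha> * real j + b - 1)) has_integral (x powr (\<alpha> * real j + b - 1 + 1) / (\<alpha> * real j + b - 1 + 1))) {0..x}"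
        using p[of j] x by (intro has_integral_powr_from_0) auto
      from nn_integral_has_integral_lebesgue[OF _ this]
      show "(\<integral>\<^sup>+y. ennreal (indicator {0..x} y * y powr (\<alpha> * real j + b - 1)) \<partial>lborel) = ennreal (x powr (\<alpha> * real j + b) / (\<alpha> * real j + b))"
        by (simp add: mult.commute)
    qed (use p[of j] in \<open>auto simp: indicator_def intro!: AE_I2\<close>)
    show "summable (\<lambda>j. \<kappa> ^ j * (x powr (\<alpha> * real j + b) / (\<alpha> * real j + b)) / Gamma (\<alpha> * real j + b))"
      unfolding coeff by (intro summable_mult sm)
  qed auto
  moreover have "(\<Sum>j. x powr b * ((- \<kappa> * x powr \<alpha>) ^ j / Gamma (\<alpha> * real j + (b + 1)))) = x powr b * mittag_leffler \<alpha> (b + 1) (- \<kappa> * x powr \<alpha>)"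
    unfolding mittag_leffler_def by (rule suminf_mult[OF sm])
  ultimately show ?thesis unfolding coeff by simp
qed

section \<open>Convolution with \<open>\<Phi>\<close> and identification of \<open>U\<close>\<close>

context subordinator_setting begin

text \<open>The convolution integrand involves \<Phi>(t - y) with y ranging over the line;
  measurability in y is obtained from a version that is measurable at negative arguments
  too.\<close>

lemma Phi_measurable_version: "\<exists>T. T \<in> borel_measurable borel \<and> (\<forall>t\<ge>0. \<Phi> t = T t)"
proof (intro exI conjI allI impI)
  let ?T = "\<lambda>t. enn2real (\<integral>\<^sup>+w. ennreal (\<theta> * exp (- \<theta> * w)) * indicator {0<..} w * tailD w t \<partial>lborel)"
  show "?T \<in> borel_measurable borel" by measurable
  show "\<Phi> t = ?T t" if "t \<ge> 0" for t
    unfolding Phi_eq_tailD[OF that, symmetric] by (simp add: Phi_nonneg)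
qed

text \<open>Dominated convergence: the ratio \<Phi>(t - y) / \<Phi>(t) tends to 1 for each y, and by
  monotonicity it is at most \<Phi>(t - s) / \<Phi>(t) on [0,s], hence eventually below 2.
  Integrability of \<open>h\<close> on [0,s] suffices, so its singularity at 0 is harmless.\<close>

lemma convolution_ratio:
  fixes \<beta> c s :: real and h :: "real \<Rightarrow> real"
  assumes beta: "0 < \<beta>" "\<beta> < 1" and c: "c > 0"
    and psi_lim: "((\<lambda>s. s powr (- \<beta>) * \<psi> s) \<longlongrightarrow> c) (at_right 0)"
    and s: "s > 0" and h: "integrable lborel (\<lambda>y. indicator {0..s} y * h y)"
  shows "((\<lambda>t. (LINT y:{0..s}|lborel. h y * \<Phi> (t - y)) / \<Phi> t) \<longlongrightarrow> (LINT y|lborel. indicator {0..s} y * h y)) at_top"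
proof -
  obtain T where T [measurable]: "T \<in> borel_measurable borel" and TP: "\<And>t. t \<ge> 0 \<Longrightarrow> \<Phi> t = T t"
    using Phi_measurable_version by blast
  have ratio: "((\<lambda>t. \<Phi> (t - y) / \<Phi> t) \<longlongrightarrow> 1) at_top" for y
  proof (rule Phi_shift_ratio[OF beta c psi_lim])
    show "filterlim (\<lambda>t. t - y) at_top at_top"
      using filterlim_tendsto_add_at_top[OF tendsto_const filterlim_ident, of "- y"] by simp
    show "((\<lambda>t. y / t) \<longlongrightarrow> 0) at_top"
      by (intro real_tendsto_divide_at_top[OF tendsto_const filterlim_ident])
  qed
  have "((\<lambda>t. LINT y|lborel. (indicator {0..s} y * h y) * (T (t - y) / \<Phi> t)) \<longlongrightarrow> (LINT y|lborel. indicator {0..s} y * h y)) at_top"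
  proof (rule integral_dominated_convergence_at_top[where w = "\<lambda>y. 2 * norm (indicator {0..s} y * h y)"])
    have hm: "(\<lambda>y. indicator {0..s} y * h y) \<in> borel_measurable lborel" using h by simp
    show "(\<lambda>y. (indicator {0..s} y * h y) * (T (t - y) / \<Phi> t)) \<in> borel_measurable lborel" for t
      by (rule borel_measurable_times[OF hm]) measurable
    show "(\<lambda>y. indicator {0..s} y * h y) \<in> borel_measurable lborel" by (rule hm)
    show "integrable lborel (\<lambda>y. 2 * norm (indicator {0..s} y * h y))" using h by simp
    have "\<forall>\<^sub>F t in at_top. \<Phi> (t - s) / \<Phi> t < 2" by (rule order_tendstoD[OF ratio]) simp
    then show "\<forall>\<^sub>F t in at_top. AE y in lborel. norm ((indicator {0..s} y * h y) * (T (t - y) / \<Phi> t)) \<le> 2 * norm (indicator {0..s} y * h y)"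
      using eventually_ge_at_top[of s] Phi_pos_eventually[OF beta c psi_lim]
    proof eventually_elim
      case (elim t)
      show ?case
      proof (rule AE_I2)
        fix y
        show "norm ((indicator {0..s} y * h y) * (T (t - y) / \<Phi> t)) \<le> 2 * norm (indicator {0..s} y * h y)"
        proof (cases "y \<in> {0..s}")
          case True
          have "T (t - y) / \<Phi> t \<le> \<Phi> (t - s) / \<Phi> t"
            using True elim TP[of "t - y"] Phi_antimono[of "t - s" "t - y"] by (auto intro!: divide_right_mono)
          then have "\<bar>T (t - y) / \<Phi> t\<bar> \<le> 2"
            using elim True TP[of "t - y"] Phi_nonneg[of "t - y"] by auto
          then have "norm (h y) * \<bar>T (t - y) / \<Phi> t\<bar> \<le> norm (h y) * 2"
            by (intro mult_left_mono) auto
          then show ?thesis using True by (simp add: abs_mult)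
        qed simp
      qed
    qed
    show "AE y in lborel. ((\<lambda>t. (indicator {0..s} y * h y) * (T (t - y) / \<Phi> t)) \<longlongrightarrow> indicator {0..s} y * h y) at_top"
    proof (rule AE_I2)
      fix y
      have "((\<lambda>t. T (t - y) / \<Phi> t) \<longlongrightarrow> 1) at_top"
        by (rule Lim_transform_eventually[OF ratio[of y]])
          (use eventually_ge_at_top[of y] in eventually_elim, simp add: TP)
      from tendsto_mult_left[OF this, of "indicator {0..s} y * h y"]
      show "((\<lambda>t. (indicator {0..s} y * h y) * (T (t - y) / \<Phi> t)) \<longlongrightarrow> indicator {0..s} y * h y) at_top" by simp
    qed
  qed
  moreover have "\<forall>\<^sub>F t in at_top. (LINT y|lborel. (indicator {0..s} y * h y) * (T (t - y) / \<Phi> t)) = (LINT y:{0..s}|lborel. h y * \<Phi> (t - y)) / \<Phi> t"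
    using eventually_ge_at_top[of s]
  proof eventually_elim
    case (elim t)
    have "(LINT y|lborel. (indicator {0..s} y * h y) * (T (t - y) / \<Phi> t)) = (LINT y|lborel. (indicator {0..s} y *\<^sub>R (h y * \<Phi> (t - y))) / \<Phi> t)"
      using elim by (intro Bochner_Integration.integral_cong) (auto simp: TP indicator_def)
    then show ?case unfolding set_lebesgue_integral_def by simp
  qed
  ultimately show ?thesis by (rule Lim_transform_eventually)
qed

text \<open>The continuity theorem for a constant sequence. It evaluates transforms only at
  \<open>s0 + n\<close>, so the transform of \<open>H\<close> need not be known below
  \<open>s0\<close>; monotonicity of \<open>U\<close> and continuity of \<open>H\<close> give
  equality at every point.\<close>

lemma U_eq_of_laplace:
  assumes H: "\<And>s. s \<ge> s0 \<Longrightarrow> has_bochner_integral lborel (\<lambda>t. pos t * (exp (- s * t) * H t)) (1 / (s * \<psi> s))"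
    and cont: "continuous_on {0<..} H" and s0: "s0 > 0" and x: "x > 0"
  shows "U x = H x"
proof -
  have "((\<lambda>i::nat. U x) \<longlongrightarrow> H x) sequentially"
  proof (rule laplace_continuity_monotone[where f = "\<lambda>_. U" and g = H and x = x and ?s0.0 = s0])
    show "\<forall>\<^sub>F i in sequentially. integrable lborel (\<lambda>t. pos t * (exp (- s0 * t) * U t)) \<and> (\<forall>t>0. 0 \<le> U t)"
      using U_laplace[OF s0] U_nonneg by (auto simp: has_bochner_integral_iff)
    show "(\<forall>\<^sub>F i in sequentially. mono_on {0<..} U) \<or> (\<forall>\<^sub>F i in sequentially. antimono_on {0<..} U)"
      by (intro disjI1 always_eventually allI mono_onI U_mono)
    show "integrable lborel (\<lambda>t. pos t * (exp (- s0 * t) * H t))"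
      using H[of s0] by (auto simp: has_bochner_integral_iff)
    show "(\<lambda>i. LINT t|lborel. pos t * (exp (- (s0 + real n) * t) * U t)) \<longlonglongrightarrow> (LINT t|lborel. pos t * (exp (- (s0 + real n) * t) * H t))" for n
      using H[of "s0 + real n"] U_laplace[of "s0 + real n"] s0 by (simp add: has_bochner_integral_iff)
  qed (use cont x in auto)
  then show ?thesis by (simp add: LIMSEQ_const_iff)
qed

end

section \<open>Time change by an independent process\<close>

lemma steady_state_moments:
  assumes "prob_space M" and ss: "steady_state M m X"
    and cor: "\<forall>t\<ge>0. \<forall>s\<ge>0. corr M (X t) (X s) = exp (- \<theta> * \<bar>t - s\<bar>)"
  obtains \<mu> v where "v > 0" "\<And>t. t \<ge> 0 \<Longrightarrow> X t \<in> borel_measurable M"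
    "\<And>t. t \<ge> 0 \<Longrightarrow> integrable M (X t)" "\<And>t. t \<ge> 0 \<Longrightarrow> (LINT \<omega>|M. X t \<omega>) = \<mu>"
    "\<And>t. t \<ge> 0 \<Longrightarrow> integrable M (\<lambda>\<omega>. (X t \<omega> - \<mu>)\<^sup>2)" "\<And>t. t \<ge> 0 \<Longrightarrow> (LINT \<omega>|M. (X t \<omega> - \<mu>)\<^sup>2) = v"
    "\<And>t s. t \<ge> 0 \<Longrightarrow> s \<ge> 0 \<Longrightarrow> (LINT \<omega>|M. (X t \<omega> - \<mu>) * (X s \<omega> - \<mu>)) = v * exp (- \<theta> * \<bar>t - s\<bar>)"
proof -
  interpret prob_space M by fact
  define \<mu> where "\<mu> = (LINT \<omega>|M. X 0 \<omega>)"
  define v where "v = (LINT \<omega>|M. (X 0 \<omega> - \<mu>)\<^sup>2)"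
  have meas: "X t \<in> borel_measurable M" if "t \<ge> 0" for t
    using ss that unfolding steady_state_def by (auto simp: distributed_def)
  have law: "distr M borel (X t) = distr M borel (X 0)" if "t \<ge> 0" for t
  proof -
    have "distr M lborel (X t) = distr M lborel (X 0)"
      using ss that unfolding steady_state_def distributed_def by simp
    moreover have "distr M borel (X u) = distr M lborel (X u)" for u
      by (intro distr_cong) auto
    ultimately show ?thesis by simp
  qed
  have same: "(LINT \<omega>|M. f (X t \<omega>)) = (LINT \<omega>|M. f (X 0 \<omega>))"
    if "t \<ge> 0" "f \<in> borel_measurable borel" for t and f :: "real \<Rightarrow> real"
    using integral_distr[OF meas[OF that(1)], of f] integral_distr[OF meas[of 0], of f] law[OF that(1)] that by simp
  have mean: "(LINT \<omega>|M. X t \<omega>) = \<mu>" if "t \<ge> 0" for t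
    using same[OF that, of "\<lambda>x. x"] by (simp add: \<mu>_def)
  have var: "(LINT \<omega>|M. (X t \<omega> - \<mu>)\<^sup>2) = v" if "t \<ge> 0" for t
    using same[OF that, of "\<lambda>x. (x - \<mu>)\<^sup>2"] by (simp add: v_def)
  have "v \<ge> 0" unfolding v_def by simp
  moreover have "v \<noteq> 0"
  proof
    assume "v = 0"
    then have "corr M (X 0) (X 0) = 0" unfolding corr_def mean[OF order_refl] v_def by simp
    then show False using cor by simp
  qed
  ultimately have v: "v > 0" by simp
  \<comment> \<open>The integral of a non-integrable function is 0 by convention, so the positive
    value v forces square integrability.\<close>
  have sq: "integrable M (\<lambda>\<omega>. (X t \<omega> - \<mu>)\<^sup>2)" if "t \<ge> 0" for t
    using var[OF that] v not_integrable_integral_eq by fastforce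
  have int: "integrable M (X t)" if "t \<ge> 0" for t
  proof -
    have "integrable M (\<lambda>\<omega>. X t \<omega> - \<mu>)"
      using meas[OF that] by (intro square_integrable_imp_integrable[OF _ sq[OF that]]) simp
    then have "integrable M (\<lambda>\<omega>. (X t \<omega> - \<mu>) + \<mu>)" by (intro Bochner_Integration.integrable_add) auto
    then show ?thesis by simp
  qed
  have cov: "(LINT \<omega>|M. (X t \<omega> - \<mu>) * (X s \<omega> - \<mu>)) = v * exp (- \<theta> * \<bar>t - s\<bar>)" if "t \<ge> 0" "s \<ge> 0" for t s
  proof -
    have "(LINT \<omega>|M. (X t \<omega> - \<mu>) * (X s \<omega> - \<mu>)) / (sqrt v * sqrt v) = exp (- \<theta> * \<bar>t - s\<bar>)"
      using cor that unfolding corr_def by (simp add: mean var)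
    then show ?thesis using v by (simp add: field_simps)
  qed
  show ?thesis by (rule that[OF v meas int mean sq var cov])
qed

text \<open>By continuity of the paths, X(u) is the limit of the values at the grid times floor(u
  (n+1)) / (n+1), of which there are countably many. Negative u are sent to 0: by \<open>max\<close>
  in the statement, and by \<open>nat\<close> in the grid.\<close>

lemma evaluation_measurable:
  fixes X :: "real \<Rightarrow> 'a \<Rightarrow> real"
  assumes meas: "\<And>t. t \<ge> 0 \<Longrightarrow> X t \<in> borel_measurable G"
    and cont: "\<And>\<omega>. \<omega> \<in> space G \<Longrightarrow> continuous_on {0..} (\<lambda>t. X t \<omega>)"
  shows "(\<lambda>p. X (max 0 (fst p)) (snd p)) \<in> borel_measurable (borel \<Otimes>\<^sub>M G)"
proof (rule borel_measurable_LIMSEQ_real)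
  define r where "r n u = real (nat \<lfloor>u * real (Suc n)\<rfloor>) / real (Suc n)" for n and u :: real
  have r0: "0 \<le> r n u" for n u unfolding r_def by simp
  have dist: "\<bar>r n u - max 0 u\<bar> \<le> 1 / real (Suc n)" for n u
  proof (cases "u \<ge> 0")
    case True
    let ?N = "real (Suc n)"
    have N: "?N > 0" by simp
    have "real (nat \<lfloor>u * ?N\<rfloor>) = of_int \<lfloor>u * ?N\<rfloor>" using True by simp
    then have "\<bar>real (nat \<lfloor>u * ?N\<rfloor>) - u * ?N\<bar> \<le> 1" by linarith
    then have "\<bar>real (nat \<lfloor>u * ?N\<rfloor>) - u * ?N\<bar> / ?N \<le> 1 / ?N" by (intro divide_right_mono) auto
    moreover have "r n u - max 0 u = (real (nat \<lfloor>u * ?N\<rfloor>) - u * ?N) / ?N"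
      unfolding r_def using True N by (simp add: diff_divide_distrib del: of_nat_Suc)
    ultimately show ?thesis by (simp del: of_nat_Suc)
  next
    case False
    then have "u * real (Suc n) \<le> 0" by (simp add: mult_nonpos_nonneg del: of_nat_Suc)
    then have "r n u = 0" unfolding r_def by (simp add: floor_le_iff del: of_nat_Suc)
    then show ?thesis using False by simp
  qed
  have lim: "(\<lambda>n. r n u) \<longlonglongrightarrow> max 0 u" for u
  proof (rule Lim_null_comparison[where f = "\<lambda>n. r n u - max 0 u" and g = "\<lambda>n. 1 / real (Suc n)", THEN LIM_zero_cancel])
    show "\<forall>\<^sub>F n in sequentially. norm (r n u - max 0 u) \<le> 1 / real (Suc n)" using dist by simp
    show "(\<lambda>n. 1 / real (Suc n)) \<longlonglongrightarrow> 0" by (rule lim_1_over_n[THEN LIMSEQ_Suc])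
  qed
  show "(\<lambda>n. X (r n (fst p)) (snd p)) \<longlonglongrightarrow> X (max 0 (fst p)) (snd p)" if "p \<in> space (borel \<Otimes>\<^sub>M G)" for p
    by (rule continuous_on_tendsto_compose[OF cont lim]) (use that r0 in \<open>auto simp: space_pair_measure\<close>)
  show "(\<lambda>p. X (r n (fst p)) (snd p)) \<in> borel_measurable (borel \<Otimes>\<^sub>M G)" for n
    unfolding r_def
  proof (rule measurable_compose_countable[where f = "\<lambda>i p. X (real i / real (Suc n)) (snd p)" and g = "\<lambda>p. nat \<lfloor>fst p * real (Suc n)\<rfloor>"])
    fix i :: nat
    have "X (real i / real (Suc n)) \<in> borel_measurable G" by (rule meas) simp
    then show "(\<lambda>p. X (real i / real (Suc n)) (snd p)) \<in> borel_measurable (borel \<Otimes>\<^sub>M G)"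
      by (rule measurable_compose[OF measurable_snd])
  qed measurable
qed

lemma measurable_vimage_algebra_id:
  assumes "f \<in> measurable M N"
  shows "(\<lambda>\<omega>. \<omega>) \<in> measurable M (vimage_algebra (space M) f N)"
    and "f \<in> measurable (vimage_algebra (space M) f N) N"
    and "sets (vimage_algebra (space M) f N) = {f -` A \<inter> space M | A. A \<in> sets N}"
  using assms measurable_space[OF assms]
  by (auto intro!: measurable_vimage_algebra1 measurable_vimage_algebra2 sets_vimage_algebra2)

text \<open>Fubini for the time change: on the sigma-algebras generated by the two processes, independence says
  that the law of \<open>\<omega> \<mapsto> (\<omega>, \<omega>)\<close> is a product measure.\<close>
lemma time_change_expectation:
  fixes X E :: "real \<Rightarrow> 'a \<Rightarrow> real" and \<phi> K :: "real \<Rightarrow> real \<Rightarrow> real"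
  assumes "prob_space M"
    and cont: "\<And>\<omega>. \<omega> \<in> space M \<Longrightarrow> continuous_on {0..} (\<lambda>t. X t \<omega>)"
    and ind: "indep_processes M E X" and E: "\<And>t \<omega>. 0 \<le> E t \<omega>"
    and st: "s \<ge> 0" "t \<ge> 0"
    and \<phi> [measurable]: "(\<lambda>(x, y). \<phi> x y) \<in> borel_measurable (borel \<Otimes>\<^sub>M borel)"
    and K [measurable]: "(\<lambda>(x, y). K x y) \<in> borel_measurable (borel \<Otimes>\<^sub>M borel)"
    and int: "\<And>a b. a \<ge> 0 \<Longrightarrow> b \<ge> 0 \<Longrightarrow> integrable M (\<lambda>\<omega>. \<phi> (X a \<omega>) (X b \<omega>))"
    and bound: "\<And>a b. a \<ge> 0 \<Longrightarrow> b \<ge> 0 \<Longrightarrow> (LINT \<omega>|M. \<bar>\<phi> (X a \<omega>) (X b \<omega>)\<bar>) \<le> B"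
    and K_eq: "\<And>a b. a \<ge> 0 \<Longrightarrow> b \<ge> 0 \<Longrightarrow> (LINT \<omega>|M. \<phi> (X a \<omega>) (X b \<omega>)) = K a b"
  shows "integrable M (\<lambda>\<omega>. \<phi> (time_change X E s \<omega>) (time_change X E t \<omega>))"
    and "(LINT \<omega>|M. \<phi> (time_change X E s \<omega>) (time_change X E t \<omega>)) = (LINT \<omega>|M. K (E s \<omega>) (E t \<omega>))"
    and "time_change X E t \<in> borel_measurable M"
proof -
  interpret prob_space M by fact
  let ?PM = "Pi\<^sub>M {0..} (\<lambda>_. borel) :: (real \<Rightarrow> real) measure"
  let ?path = "\<lambda>Y \<omega>. \<lambda>t\<in>{0..}. (Y t \<omega> :: real)"
  \<comment> \<open>Sigma-algebras on the original space replace path space: every point still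
    carries a continuous path, whereas on the space of all paths evaluation at a random time is not
    measurable.\<close>
  define G where "G Y = vimage_algebra (space M) (?path Y) ?PM" for Y
  have ind': "indep_var ?PM (?path E) ?PM (?path X)" using ind unfolding indep_processes_def .
  note G1 = measurable_vimage_algebra_id[OF indep_var_rv1[OF ind'], folded G_def]
  note G2 = measurable_vimage_algebra_id[OF indep_var_rv2[OF ind'], folded G_def]
  have spG: "space (G Y) = space M" for Y unfolding G_def by simp
  have comp: "Y u \<in> borel_measurable (G Y)" if "u \<ge> 0" "?path Y \<in> measurable (G Y) ?PM" for Y u
  proof -
    have "(\<lambda>\<omega>. ?path Y \<omega> u) \<in> borel_measurable (G Y)"
      by (rule measurable_compose[OF that(2) measurable_component_singleton]) (use that in simp)
    then show ?thesis using that by simp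
  qed
  have XG: "X u \<in> borel_measurable (G X)" if "u \<ge> 0" for u using comp[OF that G2(2)] .
  have EG: "E u \<in> borel_measurable (G E)" if "u \<ge> 0" for u using comp[OF that G1(2)] .
  have Z: "(\<lambda>p. X (max 0 (fst p)) (snd p)) \<in> borel_measurable (borel \<Otimes>\<^sub>M G X)"
    by (rule evaluation_measurable) (use XG cont spG in auto)
  \<comment> \<open>The identity maps into these sigma-algebras generate the same events as the path
    maps, so independence of the processes is independence of two copies of the identity.\<close>
  have gen: "{(\<lambda>\<omega>. \<omega>) -` A \<inter> space M | A. A \<in> sets (G Y)} = {?path Y -` A \<inter> space M | A. A \<in> sets ?PM}"
    if "sets (G Y) = {?path Y -` A \<inter> space M | A. A \<in> sets ?PM}" for Y
    unfolding that by auto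
  have iv: "indep_var (G E) (\<lambda>\<omega>. \<omega>) (G X) (\<lambda>\<omega>. \<omega>)"
    using ind' G1(1) G2(1) unfolding indep_var_eq gen[OF G1(3)] gen[OF G2(3)] by simp
  define A where "A = distr M (G E) (\<lambda>\<omega>. \<omega>)"
  define N where "N = distr M (G X) (\<lambda>\<omega>. \<omega>)"
  have joint: "A \<Otimes>\<^sub>M N = distr M (G E \<Otimes>\<^sub>M G X) (\<lambda>\<omega>. (\<omega>, \<omega>))"
    using iv unfolding indep_var_distribution_eq A_def N_def by simp
  interpret A: prob_space A unfolding A_def by (rule prob_space_distr[OF G1(1)])
  interpret N: prob_space N unfolding N_def by (rule prob_space_distr[OF G2(1)])
  interpret AN: pair_prob_space A N ..
  have sA [measurable_cong]: "sets A = sets (G E)" unfolding A_def by simp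
  have sN [measurable_cong]: "sets N = sets (G X)" unfolding N_def by simp
  \<comment> \<open>The first coordinate drives the clock, the second one the parent process; on the
    diagonal this is the integrand of the time-changed process.\<close>
  define F where "F q = \<phi> (X (max 0 (E s (fst q))) (snd q)) (X (max 0 (E t (fst q))) (snd q))" for q
  have Z1: "(\<lambda>q. X (max 0 (E u (fst q))) (snd q)) \<in> borel_measurable (G E \<Otimes>\<^sub>M G X)" if "u \<ge> 0" for u
    using measurable_compose[OF measurable_Pair[OF measurable_compose[OF measurable_fst EG[OF that]] measurable_snd] Z] by simp
  have Fm [measurable]: "F \<in> borel_measurable (G E \<Otimes>\<^sub>M G X)"
    unfolding F_def[abs_def] using measurable_compose[OF measurable_Pair[OF Z1[OF st(1)] Z1[OF st(2)]] \<phi>] by simp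
  have pairM: "(\<lambda>\<omega>. (\<omega>, \<omega>)) \<in> measurable M (G E \<Otimes>\<^sub>M G X)"
    by (rule measurable_Pair[OF G1(1) G2(1)])
  have FE: "F (\<omega>, \<omega>) = \<phi> (time_change X E s \<omega>) (time_change X E t \<omega>)" for \<omega>
    unfolding F_def time_change_def using E[of s \<omega>] E[of t \<omega>] by (simp add: max_def)
  have Nint: "integrable N (\<lambda>\<omega>. F (p, \<omega>))" "(LINT \<omega>|N. F (p, \<omega>)) = K (E s p) (E t p)"
    "(LINT \<omega>|N. \<bar>F (p, \<omega>)\<bar>) \<le> B" if p: "p \<in> space M" for p
  proof -
    have "(\<lambda>\<omega>. (p, \<omega>)) \<in> measurable (G X) (G E \<Otimes>\<^sub>M G X)" using p by (simp add: spG)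
    from measurable_compose[OF this Fm] have m: "(\<lambda>\<omega>. F (p, \<omega>)) \<in> borel_measurable (G X)" .
    have Feq: "F (p, \<omega>) = \<phi> (X (E s p) \<omega>) (X (E t p) \<omega>)" for \<omega>
      unfolding F_def using E[of s p] E[of t p] by (simp add: max_def)
    show "integrable N (\<lambda>\<omega>. F (p, \<omega>))"
      unfolding N_def integrable_distr_eq[OF G2(1) m] unfolding Feq by (rule int[OF E E])
    show "(LINT \<omega>|N. F (p, \<omega>)) = K (E s p) (E t p)"
      unfolding N_def integral_distr[OF G2(1) m] unfolding Feq by (rule K_eq[OF E E])
    have "(\<lambda>\<omega>. \<bar>F (p, \<omega>)\<bar>) \<in> borel_measurable (G X)" using m by measurable
    then show "(LINT \<omega>|N. \<bar>F (p, \<omega>)\<bar>) \<le> B"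
      unfolding N_def by (subst integral_distr[OF G2(1)]) (simp_all add: Feq bound[OF E E])
  qed
  have spA: "space A = space M" unfolding A_def by (simp add: spG)
  \<comment> \<open>The bound \<open>B\<close> is uniform in the two times, so the inner absolute
    integrals stay bounded whatever values the clock takes.\<close>
  have Fint: "integrable (A \<Otimes>\<^sub>M N) F"
  proof (rule AN.Fubini_integrable)
    show "F \<in> borel_measurable (A \<Otimes>\<^sub>M N)" by measurable
    have "(\<lambda>p. LINT \<omega>|N. norm (F (p, \<omega>))) \<in> borel_measurable A"
      by (rule N.borel_measurable_lebesgue_integral) measurable
    then show "integrable A (\<lambda>p. LINT \<omega>|N. norm (F (p, \<omega>)))"
      using Nint(3) spA by (intro A.integrable_const_bound[where B = B]) (auto intro!: AE_I2)
    show "AE p in A. integrable N (\<lambda>\<omega>. F (p, \<omega>))" using Nint(1) spA by (auto intro!: AE_I2)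
  qed
  show "integrable M (\<lambda>\<omega>. \<phi> (time_change X E s \<omega>) (time_change X E t \<omega>))"
    using Fint unfolding joint FE[symmetric] integrable_distr_eq[OF pairM Fm] .
  have Kst: "(\<lambda>\<omega>. K (E s \<omega>) (E t \<omega>)) \<in> borel_measurable (G E)"
    using measurable_compose[OF measurable_Pair[OF EG[OF st(1)] EG[OF st(2)]] K] by simp
  have "(LINT \<omega>|M. \<phi> (time_change X E s \<omega>) (time_change X E t \<omega>)) = (\<integral>q. F q \<partial>(A \<Otimes>\<^sub>M N))"
    unfolding joint FE[symmetric] by (rule integral_distr[OF pairM Fm, symmetric])
  also have "\<dots> = (LINT p|A. LINT \<omega>|N. F (p, \<omega>))"
    by (rule AN.integral_fst'[OF Fint, symmetric])
  also have "\<dots> = (LINT p|A. K (E s p) (E t p))"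
    using Nint(2) spA by (intro Bochner_Integration.integral_cong) auto
  also have "\<dots> = (LINT \<omega>|M. K (E s \<omega>) (E t \<omega>))"
    unfolding A_def by (rule integral_distr[OF G1(1) Kst])
  finally show "(LINT \<omega>|M. \<phi> (time_change X E s \<omega>) (time_change X E t \<omega>)) = (LINT \<omega>|M. K (E s \<omega>) (E t \<omega>))" .
  have "(\<lambda>\<omega>. X (max 0 (E t \<omega>)) \<omega>) \<in> borel_measurable M"
    using measurable_compose[OF pairM Z1[OF st(2)]] by simp
  moreover have "max 0 (E t \<omega>) = E t \<omega>" for \<omega> using E[of t \<omega>] by simp
  ultimately show "time_change X E t \<in> borel_measurable M"
    unfolding time_change_def[abs_def] by simp
qed

section \<open>Moments and correlation of the time-changed process\<close>

context subordinator_setting begin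

text \<open>Three applications of \<open>time_change_expectation\<close>, to x, to (x - \<mu>)^2 and
  to the product of two centered values. Stationarity makes the first two kernels constant; the
  third is the exponential covariance and yields \<open>lag_correlation\<close>. Uniform bounds come
  from |x| \<le> |\<mu>| + 1 + (x - \<mu>)^2 and from the inequality between geometric and
  arithmetic mean.\<close>

lemma time_changed_moments:
  fixes X :: "real \<Rightarrow> 'a \<Rightarrow> real" and \<mu> v :: real
  assumes meas: "\<And>t. t \<ge> 0 \<Longrightarrow> X t \<in> borel_measurable M"
    and cont: "\<And>\<omega>. \<omega> \<in> space M \<Longrightarrow> continuous_on {0..} (\<lambda>t. X t \<omega>)"
    and ind: "indep_processes M E X"
    and int: "\<And>t. t \<ge> 0 \<Longrightarrow> integrable M (X t)" and mean: "\<And>t. t \<ge> 0 \<Longrightarrow> (LINT \<omega>|M. X t \<omega>) = \<mu>"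
    and sq: "\<And>t. t \<ge> 0 \<Longrightarrow> integrable M (\<lambda>\<omega>. (X t \<omega> - \<mu>)\<^sup>2)" and var: "\<And>t. t \<ge> 0 \<Longrightarrow> (LINT \<omega>|M. (X t \<omega> - \<mu>)\<^sup>2) = v"
    and cov: "\<And>t s. t \<ge> 0 \<Longrightarrow> s \<ge> 0 \<Longrightarrow> (LINT \<omega>|M. (X t \<omega> - \<mu>) * (X s \<omega> - \<mu>)) = v * exp (- \<theta> * \<bar>t - s\<bar>)"
    and t: "t \<ge> 0"
  shows "time_change X E t \<in> borel_measurable M" "integrable M (time_change X E t)"
    "(LINT \<omega>|M. time_change X E t \<omega>) = \<mu>" "integrable M (\<lambda>\<omega>. (time_change X E t \<omega> - \<mu>)\<^sup>2)"
    "(LINT \<omega>|M. (time_change X E t \<omega> - \<mu>)\<^sup>2) = v"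
    "s \<ge> 0 \<Longrightarrow> (LINT \<omega>|M. (time_change X E t \<omega> - \<mu>) * (time_change X E s \<omega> - \<mu>)) = v * lag_correlation t s"
proof -
  have B: "(LINT \<omega>|M. \<bar>X a \<omega>\<bar>) \<le> \<bar>\<mu>\<bar> + 1 + v" if a: "a \<ge> 0" for a
  proof -
    have "(LINT \<omega>|M. \<bar>X a \<omega>\<bar>) \<le> (LINT \<omega>|M. (\<bar>\<mu>\<bar> + 1) + (X a \<omega> - \<mu>)\<^sup>2)"
    proof (rule integral_mono)
      show "integrable M (\<lambda>\<omega>. (\<bar>\<mu>\<bar> + 1) + (X a \<omega> - \<mu>)\<^sup>2)" using sq[OF a] by simp
      fix \<omega>
      have "\<bar>X a \<omega> - \<mu>\<bar> \<le> 1 + (X a \<omega> - \<mu>)\<^sup>2"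
      proof -
        have "2 * \<bar>X a \<omega> - \<mu>\<bar> \<le> (X a \<omega> - \<mu>)\<^sup>2 + 1"
          using sum_squares_bound[of "\<bar>X a \<omega> - \<mu>\<bar>" 1] by simp
        moreover have "2 * p \<le> q + 1 \<Longrightarrow> 0 \<le> p \<Longrightarrow> p \<le> 1 + q" for p q :: real by linarith
        ultimately show ?thesis using abs_ge_zero by blast
      qed
      then show "\<bar>X a \<omega>\<bar> \<le> (\<bar>\<mu>\<bar> + 1) + (X a \<omega> - \<mu>)\<^sup>2" by linarith
    qed (use int[OF a] in simp)
    also have "\<dots> = \<bar>\<mu>\<bar> + 1 + v" using sq[OF a] var[OF a] by (simp add: prob_space)
    finally show ?thesis .
  qed
  note tc = time_change_expectation[OF prob_space_axioms _ ind E_nonneg]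
  note tc1 = tc[where s = t and t = t and \<phi> = "\<lambda>x y. y" and K = "\<lambda>a b. \<mu>" and B = "\<bar>\<mu>\<bar> + 1 + v"]
  show "time_change X E t \<in> borel_measurable M"
    by (rule tc1(3); (fact t | erule cont | erule int | erule B | erule mean | measurable))
  show "integrable M (time_change X E t)"
    by (rule tc1(1); (fact t | erule cont | erule int | erule B | erule mean | measurable))
  have "(LINT \<omega>|M. time_change X E t \<omega>) = (LINT \<omega>|M. \<mu>)"
    by (rule tc1(2); (fact t | erule cont | erule int | erule B | erule mean | measurable))
  then show "(LINT \<omega>|M. time_change X E t \<omega>) = \<mu>" by (simp add: prob_space)
  have varB: "(LINT \<omega>|M. \<bar>(X b \<omega> - \<mu>)\<^sup>2\<bar>) \<le> v" if "b \<ge> 0" for b using var[OF that] by simp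
  note tc2 = tc[where s = t and t = t and \<phi> = "\<lambda>x y. (y - \<mu>)\<^sup>2" and K = "\<lambda>a b. v" and B = v]
  show "integrable M (\<lambda>\<omega>. (time_change X E t \<omega> - \<mu>)\<^sup>2)"
    by (rule tc2(1); (fact t | erule cont | erule sq | erule varB | erule var | measurable))
  have "(LINT \<omega>|M. (time_change X E t \<omega> - \<mu>)\<^sup>2) = (LINT \<omega>|M. v)"
    by (rule tc2(2); (fact t | erule cont | erule sq | erule varB | erule var | measurable))
  then show "(LINT \<omega>|M. (time_change X E t \<omega> - \<mu>)\<^sup>2) = v" by (simp add: prob_space)
  show "(LINT \<omega>|M. (time_change X E t \<omega> - \<mu>) * (time_change X E s \<omega> - \<mu>)) = v * lag_correlation t s" if s: "s \<ge> 0"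
  proof -
    have le: "\<bar>(x - \<mu>) * (y - \<mu>)\<bar> \<le> ((x - \<mu>)\<^sup>2 + (y - \<mu>)\<^sup>2) / 2" for x y
      using sum_squares_bound[of "\<bar>x - \<mu>\<bar>" "\<bar>y - \<mu>\<bar>"] by (simp add: abs_mult)
    have dom: "integrable M (\<lambda>\<omega>. ((X a \<omega> - \<mu>)\<^sup>2 + (X b \<omega> - \<mu>)\<^sup>2) / 2)" if "a \<ge> 0" "b \<ge> 0" for a b
      using sq that by simp
    have i: "integrable M (\<lambda>\<omega>. (X a \<omega> - \<mu>) * (X b \<omega> - \<mu>))" if "a \<ge> 0" "b \<ge> 0" for a b
    proof (rule Bochner_Integration.integrable_bound[OF dom[OF that]])
      show "(\<lambda>\<omega>. (X a \<omega> - \<mu>) * (X b \<omega> - \<mu>)) \<in> borel_measurable M"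
        using meas[OF that(1)] meas[OF that(2)] by measurable
      show "AE \<omega> in M. norm ((X a \<omega> - \<mu>) * (X b \<omega> - \<mu>)) \<le> norm (((X a \<omega> - \<mu>)\<^sup>2 + (X b \<omega> - \<mu>)\<^sup>2) / 2)"
        by (intro AE_I2) (use le in simp)
    qed
    have b: "(LINT \<omega>|M. \<bar>(X a \<omega> - \<mu>) * (X b \<omega> - \<mu>)\<bar>) \<le> v" if "a \<ge> 0" "b \<ge> 0" for a b
    proof -
      have "(LINT \<omega>|M. \<bar>(X a \<omega> - \<mu>) * (X b \<omega> - \<mu>)\<bar>) \<le> (LINT \<omega>|M. ((X a \<omega> - \<mu>)\<^sup>2 + (X b \<omega> - \<mu>)\<^sup>2) / 2)"
        by (rule integral_mono[OF integrable_abs[OF i[OF that]] dom[OF that] le])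
      also have "\<dots> = v" using sq var that by simp
      finally show ?thesis .
    qed
    have "(LINT \<omega>|M. (time_change X E t \<omega> - \<mu>) * (time_change X E s \<omega> - \<mu>)) = (LINT \<omega>|M. v * exp (- \<theta> * \<bar>E t \<omega> - E s \<omega>\<bar>))"
      by (rule tc(2)[where \<phi> = "\<lambda>x y. (x - \<mu>) * (y - \<mu>)" and K = "\<lambda>a b. v * exp (- \<theta> * \<bar>a - b\<bar>)" and B = v];
        (fact t | fact s | erule cont | erule (1) i | erule (1) b | erule (1) cov | measurable))
    then show ?thesis unfolding lag_correlation_def by simp
  qed
qed

text \<open>Eventually \<Phi>(\<tau>) is at least a constant times \<tau>^(-\<beta>), and \<beta> <
  1 makes this larger than the same constant times 1/\<tau>: comparison with the harmonic
  series.\<close>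

lemma Phi_shift_not_summable:
  fixes \<beta> c t :: real
  assumes beta: "0 < \<beta>" "\<beta> < 1" and c: "c > 0"
    and psi_lim: "((\<lambda>s. s powr (- \<beta>) * \<psi> s) \<longlongrightarrow> c) (at_right 0)"
    and t: "t \<ge> 0"
  shows "\<not> summable (\<lambda>n. \<Phi> (t + real (Suc n)))"
proof
  assume sm: "summable (\<lambda>n. \<Phi> (t + real (Suc n)))"
  define K where "K = c / \<theta> / Gamma (1 - \<beta>)"
  have K: "K > 0" unfolding K_def using c theta_pos beta Gamma_real_pos[of "1 - \<beta>"] by simp
  have "\<forall>\<^sub>F \<tau> in at_top. \<tau> powr \<beta> * \<Phi> \<tau> > K / 2"
    using Phi_asymptotics[OF beta c psi_lim, folded K_def] by (rule order_tendstoD(1)) (use K in simp)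
  moreover have "filterlim (\<lambda>n. t + real (Suc n)) at_top sequentially"
    by (intro filterlim_tendsto_add_at_top[OF tendsto_const] filterlim_compose[OF filterlim_real_sequentially filterlim_Suc])
  ultimately have "\<forall>\<^sub>F n in sequentially. (t + real (Suc n)) powr \<beta> * \<Phi> (t + real (Suc n)) > K / 2"
    by (rule eventually_compose_filterlim)
  then have "\<forall>\<^sub>F n in sequentially. norm (K / 2 / (t + 1) * inverse (real (Suc n))) \<le> \<Phi> (t + real (Suc n))"
  proof eventually_elim
    case (elim n)
    let ?\<tau> = "t + real (Suc n)"
    have \<tau>: "?\<tau> \<ge> 1" using t by simp
    have "?\<tau> powr \<beta> \<le> ?\<tau> powr 1" using \<tau> beta by (intro powr_mono) auto
    \<comment> \<open>A sum of the form t + n is at most (t + 1) n for n \<ge> 1, which turns the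
      shifted harmonic series into a multiple of the usual one.\<close>
    also have "\<dots> \<le> (t + 1) * real (Suc n)" using t \<tau> by (simp add: algebra_simps)
    finally have "K / 2 \<le> (t + 1) * real (Suc n) * \<Phi> ?\<tau>"
      using elim mult_right_mono[of "?\<tau> powr \<beta>" "(t + 1) * real (Suc n)" "\<Phi> ?\<tau>"] Phi_nonneg by fastforce
    moreover have "(t + 1) * real (Suc n) > 0" using t by simp
    ultimately have "K / 2 / ((t + 1) * real (Suc n)) \<le> \<Phi> ?\<tau>"
      by (subst pos_divide_le_eq) (simp_all add: mult.commute)
    moreover have "norm (K / 2 / (t + 1) * inverse (real (Suc n))) = K / 2 / ((t + 1) * real (Suc n))"
    proof -
      have "K / 2 / (t + 1) * inverse (real (Suc n)) \<ge> 0" using K t by simp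
      then have "norm (K / 2 / (t + 1) * inverse (real (Suc n))) = K / 2 / (t + 1) * inverse (real (Suc n))"
        by (simp only: real_norm_def abs_of_nonneg)
      then show ?thesis by (simp only: divide_inverse inverse_mult_distrib mult.assoc)
    qed
    ultimately show ?case by (simp only:)
  qed
  from summable_comparison_test_ev[OF this sm]
  have "summable (\<lambda>n. inverse (real (Suc n)))"
    using K t by (subst (asm) summable_cmult_iff) simp
  then have "summable (\<lambda>n. inverse (real n))" by (subst (asm) summable_Suc_iff)
  then show False using not_summable_harmonic[where 'a = real] by simp
qed

text \<open>Passes from the form with \<open>U\<close> to the pure power as the earlier time grows:
  c U(x) behaves like x^\<beta> / \<Gamma>(1+\<beta>), and after division by x^\<beta> the constant
  c/\<theta> disappears on both sides.\<close>

lemma renewal_scale_ratio: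
  fixes \<beta> c :: real
  assumes beta: "0 < \<beta>" "\<beta> < 1" and c: "c > 0"
    and psi_lim: "((\<lambda>s. s powr (- \<beta>) * \<psi> s) \<longlongrightarrow> c) (at_right 0)"
  shows "((\<lambda>x. (c / \<theta> + c * U x) / (c / \<theta> + x powr \<beta> / Gamma (1 + \<beta>))) \<longlongrightarrow> 1) at_top"
proof -
  let ?G = "Gamma (1 + \<beta>)"
  have G: "?G > 0" using beta by (intro Gamma_real_pos) simp
  have z: "((\<lambda>x. x powr (- \<beta>)) \<longlongrightarrow> 0) at_top"
    by (rule tendsto_neg_powr[OF _ filterlim_ident]) (use beta in simp)
  have "((\<lambda>x. (c / \<theta> * x powr (- \<beta>) + c * (x powr (- \<beta>) * U x)) / (c / \<theta> * x powr (- \<beta>) + 1 / ?G)) \<longlongrightarrow>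
      (c / \<theta> * 0 + c * (1 / c / ?G)) / (c / \<theta> * 0 + 1 / ?G)) at_top"
    using G by (intro tendsto_intros z U_asymptotics[OF beta c psi_lim]) auto
  moreover have "(c / \<theta> * 0 + c * (1 / c / ?G)) / (c / \<theta> * 0 + 1 / ?G) = 1" using c G by simp
  moreover have "\<forall>\<^sub>F x in at_top. (c / \<theta> * x powr (- \<beta>) + c * (x powr (- \<beta>) * U x)) / (c / \<theta> * x powr (- \<beta>) + 1 / ?G)
      = (c / \<theta> + c * U x) / (c / \<theta> + x powr \<beta> / ?G)"
    using eventually_gt_at_top[of 0]
  proof eventually_elim
    case (elim x)
    have p: "x powr \<beta> > 0" using elim by simp
    have "c / \<theta> * x powr (- \<beta>) + c * (x powr (- \<beta>) * U x) = (c / \<theta> + c * U x) / x powr \<beta>"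
      by (simp add: powr_minus divide_inverse algebra_simps)
    moreover have "c / \<theta> * x powr (- \<beta>) + 1 / ?G = (c / \<theta> + x powr \<beta> / ?G) / x powr \<beta>"
      using p by (simp add: powr_minus divide_inverse algebra_simps)
    ultimately show ?case using p by simp
  qed
  ultimately show ?thesis by (auto intro: Lim_transform_eventually)
qed

text \<open>Combines the ratio limit with the power law of \<open>\<Phi>\<close>, through
  (c/\<theta>) (1 + \<theta> U) = c/\<theta> + c U.\<close>

lemma lag_correlation_power_law:
  fixes \<beta> c :: real
  assumes beta: "0 < \<beta>" "\<beta> < 1" and c: "c > 0"
    and psi_lim: "((\<lambda>s. s powr (- \<beta>) * \<psi> s) \<longlongrightarrow> c) (at_right 0)"
    and S: "\<forall>\<^sub>F t in at_top. 0 \<le> S t" "((\<lambda>t. S t / t) \<longlongrightarrow> 0) at_top"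
  shows "((\<lambda>t. lag_correlation t (S t) / (1 / (t powr \<beta> * Gamma (1 - \<beta>)) * (c / \<theta> + c * U (S t)))) \<longlongrightarrow> 1) at_top"
proof -
  let ?G = "Gamma (1 - \<beta>)"
  let ?K = "c / \<theta> / ?G"
  have G: "?G > 0" using beta by (intro Gamma_real_pos) simp
  have K: "?K > 0" using c theta_pos G by simp
  have 1: "((\<lambda>t. lag_correlation t (S t) / (\<Phi> t * (1 + \<theta> * U (S t))) * (t powr \<beta> * \<Phi> t / ?K)) \<longlongrightarrow> 1 * (?K / ?K)) at_top"
    using K by (intro tendsto_mult tendsto_divide tendsto_const lag_correlation_asymptotics[OF beta c psi_lim S] Phi_asymptotics[OF beta c psi_lim]) auto
  have 2: "1 * (?K / ?K) = 1" using K by (subst divide_self) auto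
  have 3: "\<forall>\<^sub>F t in at_top. lag_correlation t (S t) / (\<Phi> t * (1 + \<theta> * U (S t))) * (t powr \<beta> * \<Phi> t / ?K)
      = lag_correlation t (S t) / (1 / (t powr \<beta> * ?G) * (c / \<theta> + c * U (S t)))"
    using Phi_pos_eventually[OF beta c psi_lim] eventually_gt_at_top[of 0]
  proof eventually_elim
    case (elim t)
    have n: "1 + \<theta> * U (S t) > 0" using U_nonneg[of "S t"] theta_pos by (simp add: add_pos_nonneg)
    have "c / \<theta> + c * U (S t) = c / \<theta> * (1 + \<theta> * U (S t))" using theta_pos by (simp add: field_simps)
    then show ?case using elim n c G theta_pos by (simp add: mult_ac)
  qed
  show ?thesis by (rule Lim_transform_eventually[OF 1[unfolded 2] 3])
qed

end

section \<open>Correlation of time-changed Pearson diffusions\<close>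

text \<open>The power laws carry the guard \<open>c1 > 0\<close> because at \<open>c1 = 0\<close>
  the exponent becomes \<open>\<beta>2\<close>; the Mittag-Leffler formulas also need
  \<open>c2 > 0\<close>, as they divide by \<open>c2\<close>. The claims on the range of dependence
  hold without either guard.\<close>

theorem mainTheorem3:
  fixes M :: "'a measure"
    and F :: "real \<Rightarrow> 'a measure"
    and W X1 D E X :: "real \<Rightarrow> 'a \<Rightarrow> real"
    and a0 a1 d0 d1 d2 \<theta> c1 c2 \<beta>1 \<beta>2 :: real
    and m :: "real \<Rightarrow> real"
    and Q :: "nat \<Rightarrow> real \<Rightarrow> real"
    and lam :: "nat \<Rightarrow> real"
    and g :: "real \<Rightarrow> real \<Rightarrow> real"
  assumes "prob_space M"
    and "pearson_diffusion M F W a0 a1 d0 d1 d2 X1"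
    and "hermite_case d0 d1 d2 m Q \<or> laguerre_case d0 d1 d2 m Q \<or> jacobi_case d0 d1 d2 m Q"
    and "steady_state M m X1"
    and "pearson_spectrum a0 a1 d0 d1 d2 m Q lam"
    and "\<theta> = lam 1"
    and "\<forall>t\<ge>0. \<forall>s\<ge>0. corr M (X1 t) (X1 s) = exp (- \<theta> * \<bar>t - s\<bar>)"
    and "c1 \<ge> 0" and "c2 \<ge> 0" and "c1 + c2 = 1"
    and "0 < \<beta>1" and "\<beta>1 < \<beta>2" and "\<beta>2 < 1"
    and "subordinator M D"
    and "has_laplace_exponent M D (\<lambda>s. c1 * s powr \<beta>1 + c2 * s powr \<beta>2)"
    and "density_family M D g"
    and "E = inverse_subordinator D"
    and "indep_processes M E X1"
    and "X = time_change X1 E"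
  shows
    \<comment> \<open>short- and long-range dependence\<close>
    "(\<forall>t>0. short_range_dependent M (centered M X1) t) \<and>
     (\<forall>t>0. long_range_dependent M (centered M X) t) \<and>
     (c1 > 0 \<longrightarrow> (\<forall>s>0. \<exists>C>0. (\<lambda>t. corr M (X t) (X s)) \<sim>[at_top] (\<lambda>t. C * t powr (- \<beta>1)))) \<and>
     \<comment> \<open>(a)\<close>
     (\<forall>t\<ge>0. set_integrable lborel {0..t} (\<lambda>x. \<theta> * k_fun g \<theta> x) \<and>
        Phi M E \<theta> t = 1 - (LINT x:{0..t}|lborel. \<theta> * k_fun g \<theta> x)) \<and>
     (\<forall>x\<ge>0. 0 \<le> \<theta> * k_fun g \<theta> x) \<and>
     set_integrable lborel {0..} (\<lambda>x. \<theta> * k_fun g \<theta> x) \<and>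
     (LINT x:{0..}|lborel. \<theta> * k_fun g \<theta> x) = 1 \<and>
     (c1 > 0 \<longrightarrow>
        ((\<lambda>s. \<theta> / c1 * s powr (- \<beta>1) *
           ((c1 * s powr \<beta>1 + c2 * s powr \<beta>2) / (\<theta> + c1 * s powr \<beta>1 + c2 * s powr \<beta>2))) \<longlongrightarrow> 1)
          (at_right 0) \<and>
        Phi M E \<theta> \<sim>[at_top] (\<lambda>t. c1 / (Gamma (1 - \<beta>1) * \<theta> * t powr \<beta>1))) \<and>
     \<comment> \<open>(b)\<close>
     (c1 > 0 \<longrightarrow>
        (\<forall>s>0. \<forall>y\<in>{0..1}.
           (\<lambda>t. Phi M E \<theta> (t * (1 - s * y / t))) \<sim>[at_top]
           (\<lambda>t. c1 / (Gamma (1 - \<beta>1) * \<theta> * t powr \<beta>1 * (1 - s * y / t) powr \<beta>1)))) \<and>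
     (c1 > 0 \<and> c2 > 0 \<longrightarrow>
        (\<forall>s>0.
           (\<lambda>t. \<theta> * (LINT y:{0..s}|lborel. h_fun c1 c2 \<beta>1 \<beta>2 y * Phi M E \<theta> (t - y))) \<sim>[at_top]
           (\<lambda>t. s * c1 / (Gamma (1 - \<beta>1) * t powr \<beta>1) *
                  (LINT z:{0..1}|lborel. h_fun c1 c2 \<beta>1 \<beta>2 (s * z))) \<and>
           (\<forall>t>0.
              s * c1 / (Gamma (1 - \<beta>1) * t powr \<beta>1) *
                (LINT z:{0..1}|lborel. h_fun c1 c2 \<beta>1 \<beta>2 (s * z)) =
              c1 / c2 *
                (s powr \<beta>2 *
                   mittag_leffler (\<beta>2 - \<beta>1) (\<beta>2 + 1) (- (c1 / c2) * s powr (\<beta>2 - \<beta>1)) /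
                 (t powr \<beta>1 * Gamma (1 - \<beta>1)))))) \<and>
     \<comment> \<open>(c)\<close>
     (c1 > 0 \<and> c2 > 0 \<longrightarrow>
        (\<forall>s>0.
           (\<lambda>t. corr M (X t) (X s)) \<sim>[at_top]
           (\<lambda>t. 1 / (t powr \<beta>1 * Gamma (1 - \<beta>1)) *
              (c1 / \<theta> + c1 / c2 * s powr \<beta>2 *
                 mittag_leffler (\<beta>2 - \<beta>1) (\<beta>2 + 1) (- (c1 / c2) * s powr (\<beta>2 - \<beta>1)))))) \<and>
     \<comment> \<open>(d): first \<open>t \<rightarrow> \<infinity>\<close> for fixed \<open>s\<close> and then \<open>s \<rightarrow> \<infinity>\<close>; and jointly, as long as \<open>s / t \<rightarrow> 0\<close>.
       (It fails for unrestricted joint limits: on the diagonal \<open>s = t\<close> the correlation is 1.)\<close>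
     (c1 > 0 \<longrightarrow>
        (\<exists>L.
           (\<forall>s>0.
              ((\<lambda>t. corr M (X t) (X s) /
                 (1 / (t powr \<beta>1 * Gamma (1 - \<beta>1)) * (c1 / \<theta> + s powr \<beta>1 / Gamma (1 + \<beta>1))))
               \<longlongrightarrow> L s) at_top) \<and>
           (L \<longlongrightarrow> 1) at_top) \<and>
        (\<forall>S. filterlim S at_top at_top \<and> S \<in> o[at_top](\<lambda>t. t) \<longrightarrow>
           (\<lambda>t. corr M (X t) (X (S t))) \<sim>[at_top]
           (\<lambda>t. 1 / (t powr \<beta>1 * Gamma (1 - \<beta>1)) * (c1 / \<theta> + S t powr \<beta>1 / Gamma (1 + \<beta>1)))))"
proof -
  interpret prob_space M by (rule assms(1))
  define \<psi> where "\<psi> = (\<lambda>s::real. c1 * s powr \<beta>1 + c2 * s powr \<beta>2)"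
  let ?E = "inverse_subordinator D"
  have X: "X = time_change X1 ?E" and indep: "indep_processes M ?E X1"
    using assms by simp_all
  obtain \<mu> v where v: "v > 0" and meas: "\<And>t. t \<ge> 0 \<Longrightarrow> X1 t \<in> borel_measurable M"
    and int: "\<And>t. t \<ge> 0 \<Longrightarrow> integrable M (X1 t)" and mean: "\<And>t. t \<ge> 0 \<Longrightarrow> (LINT \<omega>|M. X1 t \<omega>) = \<mu>"
    and sq: "\<And>t. t \<ge> 0 \<Longrightarrow> integrable M (\<lambda>\<omega>. (X1 t \<omega> - \<mu>)\<^sup>2)"
    and var: "\<And>t. t \<ge> 0 \<Longrightarrow> (LINT \<omega>|M. (X1 t \<omega> - \<mu>)\<^sup>2) = v"
    and cov: "\<And>t s. t \<ge> 0 \<Longrightarrow> s \<ge> 0 \<Longrightarrow> (LINT \<omega>|M. (X1 t \<omega> - \<mu>) * (X1 s \<omega> - \<mu>)) = v * exp (- \<theta> * \<bar>t - s\<bar>)"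
    by (rule steady_state_moments[OF assms(1) assms(4) assms(7)]) blast
  have cont: "continuous_on {0..} (\<lambda>t. X1 t \<omega>)" if "\<omega> \<in> space M" for \<omega>
    using assms(2) that unfolding pearson_diffusion_def sde_solution_def by blast
  have theta: "\<theta> > 0"
    using assms(5,6) strict_monoD[of lam 0 1] unfolding pearson_spectrum_def by auto
  have psi_pos: "\<psi> s > 0" if "s > 0" for s
  proof -
    have "c1 > 0 \<or> c2 > 0" using assms(8-10) by linarith
    then show ?thesis
      unfolding \<psi>_def using that assms(8,9) by (auto intro: add_pos_nonneg add_nonneg_pos)
  qed
  \<comment> \<open>Independence of the processes includes measurability of the path map of the
    inverse, and E(t) is one of its coordinates.\<close>
  have Em: "?E t \<in> borel_measurable M" if "t \<ge> 0" for t
  proof -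
    have "(\<lambda>\<omega>. \<lambda>t\<in>{0..}. ?E t \<omega>) \<in> measurable M (Pi\<^sub>M {0..} (\<lambda>_. borel))"
      using indep unfolding indep_processes_def by (rule indep_var_rv1)
    from measurable_compose[OF this measurable_component_singleton[of t]] show ?thesis
      using that by simp
  qed
  interpret S: subordinator_setting M D g \<psi> \<theta>
    by unfold_locales (use assms(14,15,16) psi_pos theta Em in \<open>auto simp: \<psi>_def\<close>)
  let ?\<Phi> = "Phi M ?E \<theta>"
  let ?lag = "S.lag_correlation"
  note tcm = S.time_changed_moments[where X = X1 and \<mu> = \<mu> and v = v, folded X]
  have Xmeas: "X t \<in> borel_measurable M" if t: "t \<ge> 0" for t
    by (rule tcm(1); (fact t indep | erule cont | erule meas | erule int | erule mean | erule sq | erule var | erule (1) cov))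
  have Xint: "integrable M (X t)" if t: "t \<ge> 0" for t
    by (rule tcm(2); (fact t indep | erule cont | erule meas | erule int | erule mean | erule sq | erule var | erule (1) cov))
  have Xmean: "(LINT \<omega>|M. X t \<omega>) = \<mu>" if t: "t \<ge> 0" for t
    by (rule tcm(3); (fact t indep | erule cont | erule meas | erule int | erule mean | erule sq | erule var | erule (1) cov))
  have Xsq: "integrable M (\<lambda>\<omega>. (X t \<omega> - \<mu>)\<^sup>2)" if t: "t \<ge> 0" for t
    by (rule tcm(4); (fact t indep | erule cont | erule meas | erule int | erule mean | erule sq | erule var | erule (1) cov))
  have Xvar: "(LINT \<omega>|M. (X t \<omega> - \<mu>)\<^sup>2) = v" if t: "t \<ge> 0" for t
    by (rule tcm(5); (fact t indep | erule cont | erule meas | erule int | erule mean | erule sq | erule var | erule (1) cov))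
  have Xcov: "(LINT \<omega>|M. (X t \<omega> - \<mu>) * (X s \<omega> - \<mu>)) = v * ?lag t s" if t: "t \<ge> 0" and s: "s \<ge> 0" for t s
    by (rule tcm(6)[OF _ _ _ _ _ _ _ _ t s]; (fact indep | erule cont | erule meas | erule int | erule mean | erule sq | erule var | erule (1) cov))
  have corr_eq: "corr M (X t) (X s) = ?lag t s" if "t \<ge> 0" "s \<ge> 0" for t s
    unfolding corr_def Xmean[OF that(1)] Xmean[OF that(2)] Xcov[OF that] Xvar[OF that(1)] Xvar[OF that(2)]
    using v by simp
  have beta: "0 < \<beta>1" "\<beta>1 < 1" "0 < \<beta>2" "\<beta>2 < 1" using assms(11-13) by auto
  have psi_lim: "((\<lambda>s. s powr (- \<beta>1) * \<psi> s) \<longlongrightarrow> c1) (at_right 0)"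
  proof -
    have "((\<lambda>s::real. s powr (\<beta>2 - \<beta>1)) \<longlongrightarrow> 0 powr (\<beta>2 - \<beta>1)) (at_right 0)"
      using assms(12) by (intro tendsto_powr2 tendsto_ident_at tendsto_const) (auto simp: eventually_at_filter)
    then have "((\<lambda>s. c1 + c2 * s powr (\<beta>2 - \<beta>1)) \<longlongrightarrow> c1 + c2 * 0) (at_right 0)"
      by (intro tendsto_intros) simp
    moreover have "\<forall>\<^sub>F s in at_right 0. c1 + c2 * s powr (\<beta>2 - \<beta>1) = s powr (- \<beta>1) * \<psi> s"
      unfolding eventually_at_filter \<psi>_def
      by (auto simp: powr_diff powr_minus field_simps intro!: always_eventually)
    ultimately have "((\<lambda>s. s powr (- \<beta>1) * \<psi> s) \<longlongrightarrow> c1 + c2 * 0) (at_right 0)"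
      by (rule Lim_transform_eventually)
    then show ?thesis by simp
  qed
  have power_law: "((\<lambda>t. ?lag t (S t) / (1 / (t powr \<beta>1 * Gamma (1 - \<beta>1)) * (c1 / \<theta> + c1 * S.U (S t)))) \<longlongrightarrow> 1) at_top"
    if "c1 > 0" "\<forall>\<^sub>F t in at_top. 0 \<le> S t" "((\<lambda>t. S t / t) \<longlongrightarrow> 0) at_top" for S
    by (rule S.lag_correlation_power_law[OF beta(1,2) that(1) psi_lim that(2,3)])
  have power_law_const: "((\<lambda>t. corr M (X t) (X s) / (1 / (t powr \<beta>1 * Gamma (1 - \<beta>1)) * (c1 / \<theta> + c1 * S.U s))) \<longlongrightarrow> 1) at_top"
    if "c1 > 0" "s > 0" for s
  proof -
    have "((\<lambda>t. s / t) \<longlongrightarrow> 0) at_top" by (intro real_tendsto_divide_at_top[OF tendsto_const filterlim_ident])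
    then have 1: "((\<lambda>t. ?lag t s / (1 / (t powr \<beta>1 * Gamma (1 - \<beta>1)) * (c1 / \<theta> + c1 * S.U s))) \<longlongrightarrow> 1) at_top"
      using that by (intro power_law[of "\<lambda>_. s"]) auto
    show ?thesis
      by (rule Lim_transform_eventually[OF 1]) (use eventually_ge_at_top[of 0] in eventually_elim, use that in \<open>simp add: corr_eq\<close>)
  qed
  have Gpos: "Gamma (1 - \<beta>1) > 0" using beta by (intro Gamma_real_pos) simp
  have Phi_lim: "((\<lambda>t. t powr \<beta>1 * ?\<Phi> t) \<longlongrightarrow> c1 / \<theta> / Gamma (1 - \<beta>1)) at_top" if "c1 > 0"
    by (rule S.Phi_asymptotics[OF beta(1,2) that psi_lim])
  have Phi_ratio: "((\<lambda>t. t powr \<beta>1 * ?\<Phi> t / (c1 / \<theta> / Gamma (1 - \<beta>1))) \<longlongrightarrow> 1) at_top" if "c1 > 0"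
    using tendsto_divide[OF Phi_lim[OF that] tendsto_const, of "c1 / \<theta> / Gamma (1 - \<beta>1)"] that Gpos theta by simp

  \<comment> \<open>Range of dependence of \<open>X1\<close> and \<open>X\<close>\<close>
  have short: "short_range_dependent M (centered M X1) t" if t: "t > 0" for t
  proof -
    have c: "centered M X1 u = (\<lambda>\<omega>. X1 u \<omega> - \<mu>)" if "u \<ge> 0" for u
      unfolding centered_def using mean[OF that] by simp
    have "centered_L2_process M (centered M X1)"
      unfolding centered_L2_process_def using meas int mean sq
      by (auto simp: c less_imp_le prob_space)
    moreover have "(LINT \<omega>|M. centered M X1 t \<omega> * centered M X1 (t + real (Suc n)) \<omega>) = v * exp (- \<theta>) * exp (- \<theta>) ^ n" for n
    proof -
      have "(LINT \<omega>|M. centered M X1 t \<omega> * centered M X1 (t + real (Suc n)) \<omega>) = v * exp (- \<theta> * \<bar>t - (t + real (Suc n))\<bar>)"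
        using t by (simp add: c cov del: of_nat_Suc)
      also have "- \<theta> * \<bar>t - (t + real (Suc n))\<bar> = - \<theta> + real n * (- \<theta>)" by (simp add: algebra_simps)
      finally show ?thesis by (simp only: exp_add exp_of_nat_mult mult.assoc)
    qed
    moreover have "summable (\<lambda>n. v * exp (- \<theta>) * exp (- \<theta>) ^ n)"
      using theta by (intro summable_mult summable_geometric) simp
    ultimately show ?thesis unfolding short_range_dependent_def by simp
  qed
  have long: "long_range_dependent M (centered M X) t" if t: "t > 0" for t
  proof -
    have c: "centered M X u = (\<lambda>\<omega>. X u \<omega> - \<mu>)" if "u \<ge> 0" for u
      unfolding centered_def using Xmean[OF that] by simp
    have L2: "centered_L2_process M (centered M X)"
      unfolding centered_L2_process_def using Xmeas Xint Xmean Xsq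
      by (auto simp: c less_imp_le prob_space)
    have co: "(LINT \<omega>|M. centered M X t \<omega> * centered M X (t + real (Suc n)) \<omega>) = v * ?lag (t + real (Suc n)) t" for n
      using t Xcov[of "t + real (Suc n)" t] by (simp add: c mult.commute del: of_nat_Suc)
    \<comment> \<open>If \<open>c1 = 0\<close> then \<open>c2 = 1\<close> and \<psi>(s) =
      s^\<beta>2, which is again a power law with exponent in (0,1).\<close>
    obtain \<beta> c where bc: "0 < \<beta>" "\<beta> < 1" "c > 0" "((\<lambda>s. s powr (- \<beta>) * \<psi> s) \<longlongrightarrow> c) (at_right 0)"
    proof (cases "c1 > 0")
      case True
      show ?thesis by (rule that[OF beta(1,2) True psi_lim])
    next
      case False
      then have c: "c1 = 0" "c2 = 1" using assms(8,10) by auto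
      have "((\<lambda>s. s powr (- \<beta>2) * \<psi> s) \<longlongrightarrow> 1) (at_right 0)"
        by (rule Lim_transform_eventually[OF tendsto_const])
          (auto simp: eventually_at_filter \<psi>_def c powr_minus intro!: always_eventually)
      then show ?thesis using that[OF beta(3,4) zero_less_one] by blast
    qed
    have "\<not> summable (\<lambda>n. v * ?lag (t + real (Suc n)) t)"
    proof
      assume "summable (\<lambda>n. v * ?lag (t + real (Suc n)) t)"
      then have sm: "summable (\<lambda>n. ?lag (t + real (Suc n)) t)" using v by (simp add: summable_cmult_iff)
      have "norm (?\<Phi> (t + real (Suc n))) \<le> ?lag (t + real (Suc n)) t" for n
      proof -
        have "?\<Phi> (t + real (Suc n)) * 1 \<le> ?\<Phi> (t + real (Suc n)) * (1 + \<theta> * S.U t)"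
          using theta S.U_nonneg[of t] S.Phi_nonneg by (intro mult_left_mono) auto
        also have "\<dots> \<le> ?lag (t + real (Suc n)) t"
          using t by (intro S.lag_correlation_bounds(1)) auto
        finally show ?thesis using S.Phi_nonneg by simp
      qed
      then have "summable (\<lambda>n. ?\<Phi> (t + real (Suc n)))"
        by (intro summable_comparison_test[OF _ sm]) blast
      then show False using S.Phi_shift_not_summable[OF bc less_imp_le[OF t]] by blast
    qed
    then show ?thesis unfolding long_range_dependent_def co using L2 by blast
  qed
  have power: "\<exists>C>0. (\<lambda>t. corr M (X t) (X s)) \<sim>[at_top] (\<lambda>t. C * t powr (- \<beta>1))" if "c1 > 0" "s > 0" for s
  proof (intro exI conjI)
    let ?C = "1 / Gamma (1 - \<beta>1) * (c1 / \<theta> + c1 * S.U s)"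
    show "?C > 0" using Gpos that theta S.U_nonneg[of s] by (intro mult_pos_pos add_pos_nonneg) auto
    have "(\<lambda>t. corr M (X t) (X s)) \<sim>[at_top] (\<lambda>t. 1 / (t powr \<beta>1 * Gamma (1 - \<beta>1)) * (c1 / \<theta> + c1 * S.U s))"
      by (rule asymp_equivI'[OF power_law_const[OF that]])
    also have "(\<lambda>t. 1 / (t powr \<beta>1 * Gamma (1 - \<beta>1)) * (c1 / \<theta> + c1 * S.U s)) = (\<lambda>t. ?C * t powr (- \<beta>1))"
      by (simp add: powr_minus fun_eq_iff divide_simps)
    finally show "(\<lambda>t. corr M (X t) (X s)) \<sim>[at_top] (\<lambda>t. ?C * t powr (- \<beta>1))" .
  qed

  \<comment> \<open>Representation and asymptotics of \<open>\<Phi>\<close>\<close>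
  have a1: "set_integrable lborel {0..t} (\<lambda>x. \<theta> * k_fun g \<theta> x) \<and>
        ?\<Phi> t = 1 - (LINT x:{0..t}|lborel. \<theta> * k_fun g \<theta> x)" if "t \<ge> 0" for t
    using S.Phi_eq_integral_k_fun[OF that] by blast
  have a2: "0 \<le> \<theta> * k_fun g \<theta> x" for x using theta S.k_fun_nonneg by simp
  have a3: "((\<lambda>s. \<theta> / c1 * s powr (- \<beta>1) *
           ((c1 * s powr \<beta>1 + c2 * s powr \<beta>2) / (\<theta> + c1 * s powr \<beta>1 + c2 * s powr \<beta>2))) \<longlongrightarrow> 1) (at_right 0)" if "c1 > 0"
  proof -
    have "((\<lambda>s. \<theta> / c1 * (s powr (- \<beta>1) * \<psi> s / (\<theta> + \<psi> s))) \<longlongrightarrow> \<theta> / c1 * (c1 / (\<theta> + 0))) (at_right 0)"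
      using theta by (intro tendsto_mult tendsto_divide tendsto_add tendsto_const psi_lim S.psi_tendsto_0[OF beta(1,2) that psi_lim]) auto
    moreover have "\<theta> / c1 * (c1 / (\<theta> + 0)) = 1" using theta that by simp
    ultimately show ?thesis by (simp add: \<psi>_def add.assoc mult.assoc)
  qed
  have a4: "?\<Phi> \<sim>[at_top] (\<lambda>t. c1 / (Gamma (1 - \<beta>1) * \<theta> * t powr \<beta>1))" if "c1 > 0"
  proof (rule asymp_equivI', rule Lim_transform_eventually[OF Phi_ratio[OF that]])
    show "\<forall>\<^sub>F t in at_top. t powr \<beta>1 * ?\<Phi> t / (c1 / \<theta> / Gamma (1 - \<beta>1)) = ?\<Phi> t / (c1 / (Gamma (1 - \<beta>1) * \<theta> * t powr \<beta>1))"
      by (intro always_eventually) (simp add: mult_ac)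
  qed
  have b1: "(\<lambda>t. ?\<Phi> (t * (1 - s * y / t))) \<sim>[at_top]
           (\<lambda>t. c1 / (Gamma (1 - \<beta>1) * \<theta> * t powr \<beta>1 * (1 - s * y / t) powr \<beta>1))" if "c1 > 0" for s y
  proof (rule asymp_equivI', rule Lim_transform_eventually)
    have "filterlim (\<lambda>t. t - s * y) at_top at_top"
      using filterlim_tendsto_add_at_top[OF tendsto_const filterlim_ident, of "- (s * y)"] by simp
    from filterlim_compose[OF Phi_ratio[OF that] this]
    show "((\<lambda>t. (t - s * y) powr \<beta>1 * ?\<Phi> (t - s * y) / (c1 / \<theta> / Gamma (1 - \<beta>1))) \<longlongrightarrow> 1) at_top" .
    show "\<forall>\<^sub>F t in at_top. (t - s * y) powr \<beta>1 * ?\<Phi> (t - s * y) / (c1 / \<theta> / Gamma (1 - \<beta>1)) =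
        ?\<Phi> (t * (1 - s * y / t)) / (c1 / (Gamma (1 - \<beta>1) * \<theta> * t powr \<beta>1 * (1 - s * y / t) powr \<beta>1))"
      using eventually_gt_at_top[of "max 0 (s * y)"]
    proof eventually_elim
      case (elim t)
      then have e: "t - s * y = t * (1 - s * y / t)" by (simp add: right_diff_distrib)
      have "(t * (1 - s * y / t)) powr \<beta>1 = t powr \<beta>1 * (1 - s * y / t) powr \<beta>1"
        by (rule powr_mult)
      then show ?case unfolding e by (simp add: mult_ac)
    qed
  qed

  \<comment> \<open>Mittag-Leffler form of the renewal function\<close>
  have renewal: "has_bochner_integral lborel (\<lambda>y. indicator {0..s} y * h_fun c1 c2 \<beta>1 \<beta>2 y) (S.U s)"
      "S.U s = 1 / c2 * (s powr \<beta>2 * mittag_leffler (\<beta>2 - \<beta>1) (\<beta>2 + 1) (- (c1 / c2) * s powr (\<beta>2 - \<beta>1)))"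
    if c: "c1 > 0" "c2 > 0" and s: "s > 0" for s
  proof -
    let ?\<alpha> = "\<beta>2 - \<beta>1" and ?\<kappa> = "c1 / c2"
    \<comment> \<open>The antiderivative of \<open>h_fun\<close> given by
      \<open>mittag_leffler_integral\<close>. Unlike \<open>h_fun\<close> it can be compared with
      the monotone function \<open>U\<close> itself, so no derivative of \<open>U\<close> is
      involved.\<close>
    define H where "H x = 1 / c2 * (x powr \<beta>2 * mittag_leffler ?\<alpha> (\<beta>2 + 1) (- ?\<kappa> * x powr ?\<alpha>))" for x
    have \<alpha>: "?\<alpha> > 0" using assms(12) by simp
    have \<kappa>: "?\<kappa> \<ge> 0" using c by simp
    \<comment> \<open>Its \<alpha>-th power is \<kappa> + 1, so the geometric series converges for
      every argument u \<ge> s0.\<close>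
    define s0 where "s0 = (?\<kappa> + 1) powr (1 / ?\<alpha>)"
    have s0: "s0 > 0" "s0 powr ?\<alpha> = ?\<kappa> + 1" using \<alpha> \<kappa> by (auto simp: s0_def powr_powr)
    have UH: "S.U x = H x" if "x > 0" for x
    proof (rule S.U_eq_of_laplace[OF _ _ s0(1) that])
      fix u assume u: "s0 \<le> u"
      have u0: "u > 0" using u s0 by simp
      have "s0 powr ?\<alpha> \<le> u powr ?\<alpha>" using u s0 \<alpha> by (intro powr_mono2) auto
      then have lt: "?\<kappa> < u powr ?\<alpha>" using s0 by simp
      have b: "\<beta>2 + 1 > 0" using beta by simp
      from has_bochner_integral_mult_right[OF mittag_leffler_laplace[OF \<alpha> b \<kappa> u0 lt], of "1 / c2"]
      have "has_bochner_integral lborel (\<lambda>t. pos t * (exp (- u * t) * H t)) (1 / c2 * (u powr (- (\<beta>2 + 1)) / (1 + ?\<kappa> * u powr (- ?\<alpha>))))"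
        unfolding H_def by (simp add: mult_ac)
      \<comment> \<open>Multiplying numerator and denominator by c2 u^(\<beta>2+1) recovers u
        \<psi>(u).\<close>
      moreover have "1 / c2 * (u powr (- (\<beta>2 + 1)) / (1 + ?\<kappa> * u powr (- ?\<alpha>))) = 1 / (u * \<psi> u)"
      proof -
        have e1: "u powr (- (\<beta>2 + 1)) = 1 / (u * u powr \<beta>2)"
          unfolding powr_minus powr_add using u0 by (simp add: field_simps)
        have e2: "u powr (- ?\<alpha>) = u powr \<beta>1 / u powr \<beta>2"
          using u0 by (simp flip: powr_diff)
        have "u powr \<beta>2 > 0" "u powr \<beta>1 > 0" using u0 by auto
        then show ?thesis unfolding e1 e2 \<psi>_def using c u0 by (simp add: divide_simps add_pos_pos)
      qed
      ultimately show "has_bochner_integral lborel (\<lambda>t. pos t * (exp (- u * t) * H t)) (1 / (u * \<psi> u))"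
        by (simp only:)
    next
      have inner: "continuous_on {0<..} (\<lambda>x. - ?\<kappa> * x powr ?\<alpha>)" by (intro continuous_intros) auto
      have "continuous_on UNIV (mittag_leffler ?\<alpha> (\<beta>2 + 1))"
        using mittag_leffler_continuous[OF \<alpha>, of "\<beta>2 + 1"] beta by (simp add: continuous_at_imp_continuous_on)
      from continuous_on_compose2[OF this inner]
      have "continuous_on {0<..} (\<lambda>x. mittag_leffler ?\<alpha> (\<beta>2 + 1) (- ?\<kappa> * x powr ?\<alpha>))"
        by simp
      then show "continuous_on {0<..} H"
        unfolding H_def[abs_def] by (intro continuous_intros) auto
    qed
    show "S.U s = 1 / c2 * (s powr \<beta>2 * mittag_leffler ?\<alpha> (\<beta>2 + 1) (- ?\<kappa> * s powr ?\<alpha>))"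
      using UH[OF s] by (simp only: H_def)
    have "has_bochner_integral lborel (\<lambda>y. 1 / c2 * (indicator {0..s} y * (y powr (\<beta>2 - 1) * mittag_leffler ?\<alpha> \<beta>2 (- ?\<kappa> * y powr ?\<alpha>)))) (H s)"
      unfolding H_def by (intro has_bochner_integral_mult_right mittag_leffler_integral \<alpha> beta \<kappa> s)
    moreover have "1 / c2 * (indicator {0..s} y * (y powr (\<beta>2 - 1) * mittag_leffler ?\<alpha> \<beta>2 (- ?\<kappa> * y powr ?\<alpha>))) = indicator {0..s} y * h_fun c1 c2 \<beta>1 \<beta>2 y" for y
      unfolding h_fun_def by (simp only: mult_ac)
    ultimately show "has_bochner_integral lborel (\<lambda>y. indicator {0..s} y * h_fun c1 c2 \<beta>1 \<beta>2 y) (S.U s)"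
      by (simp only: UH[OF s])
  qed
  have scaled: "(LINT z:{0..1}|lborel. h_fun c1 c2 \<beta>1 \<beta>2 (s * z)) = S.U s / s" if c: "c1 > 0" "c2 > 0" and s: "s > 0" for s
  proof -
    have "has_bochner_integral lborel (\<lambda>z. indicator {0..s} (0 + s * z) * h_fun c1 c2 \<beta>1 \<beta>2 (0 + s * z)) (S.U s /\<^sub>R \<bar>s\<bar>)"
      using renewal(1)[OF that] s by (subst (asm) lborel_has_bochner_integral_real_affine_iff[where c = s and t = 0]) auto
    moreover have "indicator {0..s} (0 + s * z) * h_fun c1 c2 \<beta>1 \<beta>2 (0 + s * z) = indicator {0..1} z *\<^sub>R h_fun c1 c2 \<beta>1 \<beta>2 (s * z)" for z
      using s by (auto simp: indicator_def zero_le_mult_iff)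
    ultimately have "has_bochner_integral lborel (\<lambda>z. indicator {0..1} z *\<^sub>R h_fun c1 c2 \<beta>1 \<beta>2 (s * z)) (S.U s /\<^sub>R \<bar>s\<bar>)"
      by (simp only:)
    moreover have "S.U s /\<^sub>R \<bar>s\<bar> = S.U s / s" using s by (simp add: divide_inverse mult.commute)
    ultimately show ?thesis
      unfolding set_lebesgue_integral_def by (simp only: has_bochner_integral_iff)
  qed
  have b2: "(\<lambda>t. \<theta> * (LINT y:{0..s}|lborel. h_fun c1 c2 \<beta>1 \<beta>2 y * ?\<Phi> (t - y))) \<sim>[at_top]
           (\<lambda>t. s * c1 / (Gamma (1 - \<beta>1) * t powr \<beta>1) * (LINT z:{0..1}|lborel. h_fun c1 c2 \<beta>1 \<beta>2 (s * z)))"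
    if c: "c1 > 0" "c2 > 0" and s: "s > 0" for s
  proof (rule asymp_equivI')
    let ?J = "\<lambda>t. LINT y:{0..s}|lborel. h_fun c1 c2 \<beta>1 \<beta>2 y * ?\<Phi> (t - y)"
    let ?K = "c1 / \<theta> / Gamma (1 - \<beta>1)"
    \<comment> \<open>Asymptotic equivalence divides by the integral of \<open>h_fun\<close> over
      [0,s], which equals U(s) and must therefore be nonzero.\<close>
    have U: "S.U s > 0" by (rule S.U_pos[OF s])
    have hi: "integrable lborel (\<lambda>y. indicator {0..s} y * h_fun c1 c2 \<beta>1 \<beta>2 y)"
      and hv: "(LINT y|lborel. indicator {0..s} y * h_fun c1 c2 \<beta>1 \<beta>2 y) = S.U s"
      using renewal(1)[OF that] by (simp_all add: has_bochner_integral_iff)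
    from S.convolution_ratio[OF beta(1,2) c(1) psi_lim s hi]
    have "((\<lambda>t. ?J t / ?\<Phi> t) \<longlongrightarrow> S.U s) at_top" unfolding hv .
    from tendsto_mult[OF tendsto_divide[OF this tendsto_const, of "S.U s"] Phi_ratio[OF c(1)]]
    have 1: "((\<lambda>t. ?J t / ?\<Phi> t / S.U s * (t powr \<beta>1 * ?\<Phi> t / ?K)) \<longlongrightarrow> 1) at_top" using U by simp
    show "((\<lambda>t. \<theta> * ?J t / (s * c1 / (Gamma (1 - \<beta>1) * t powr \<beta>1) * (LINT z:{0..1}|lborel. h_fun c1 c2 \<beta>1 \<beta>2 (s * z)))) \<longlongrightarrow> 1) at_top"
    proof (rule Lim_transform_eventually[OF 1])
      show "\<forall>\<^sub>F t in at_top. ?J t / ?\<Phi> t / S.U s * (t powr \<beta>1 * ?\<Phi> t / ?K) =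
         \<theta> * ?J t / (s * c1 / (Gamma (1 - \<beta>1) * t powr \<beta>1) * (LINT z:{0..1}|lborel. h_fun c1 c2 \<beta>1 \<beta>2 (s * z)))"
        using S.Phi_pos_eventually[OF beta(1,2) c(1) psi_lim] eventually_gt_at_top[of 0]
      proof eventually_elim
        case (elim t)
        then show ?case unfolding scaled[OF that] using U c s Gpos theta by (simp add: mult_ac)
      qed
    qed
  qed
  have b3: "s * c1 / (Gamma (1 - \<beta>1) * t powr \<beta>1) * (LINT z:{0..1}|lborel. h_fun c1 c2 \<beta>1 \<beta>2 (s * z)) =
              c1 / c2 * (s powr \<beta>2 * mittag_leffler (\<beta>2 - \<beta>1) (\<beta>2 + 1) (- (c1 / c2) * s powr (\<beta>2 - \<beta>1)) / (t powr \<beta>1 * Gamma (1 - \<beta>1)))"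
    if c: "c1 > 0" "c2 > 0" and s: "s > 0" for s t
    unfolding scaled[OF that] renewal(2)[OF that] using s by (simp add: mult_ac)
  have c: "(\<lambda>t. corr M (X t) (X s)) \<sim>[at_top]
           (\<lambda>t. 1 / (t powr \<beta>1 * Gamma (1 - \<beta>1)) *
              (c1 / \<theta> + c1 / c2 * s powr \<beta>2 *
                 mittag_leffler (\<beta>2 - \<beta>1) (\<beta>2 + 1) (- (c1 / c2) * s powr (\<beta>2 - \<beta>1))))"
    if c: "c1 > 0" "c2 > 0" and s: "s > 0" for s
  proof -
    have "c1 * S.U s = c1 / c2 * s powr \<beta>2 * mittag_leffler (\<beta>2 - \<beta>1) (\<beta>2 + 1) (- (c1 / c2) * s powr (\<beta>2 - \<beta>1))"
      unfolding renewal(2)[OF that] by simp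
    then show ?thesis using asymp_equivI'[OF power_law_const[OF c(1) s]] by (simp only:)
  qed

  \<comment> \<open>Limits in which the earlier time grows\<close>
  have rho: "((\<lambda>x. (c1 / \<theta> + c1 * S.U x) / (c1 / \<theta> + x powr \<beta>1 / Gamma (1 + \<beta>1))) \<longlongrightarrow> 1) at_top" if "c1 > 0"
    by (rule S.renewal_scale_ratio[OF beta(1,2) that psi_lim])
  have G1: "Gamma (1 + \<beta>1) > 0" using beta by (intro Gamma_real_pos) simp
  have d1: "\<exists>L. (\<forall>s>0. ((\<lambda>t. corr M (X t) (X s) /
                 (1 / (t powr \<beta>1 * Gamma (1 - \<beta>1)) * (c1 / \<theta> + s powr \<beta>1 / Gamma (1 + \<beta>1)))) \<longlongrightarrow> L s) at_top) \<and>
           (L \<longlongrightarrow> 1) at_top" if c: "c1 > 0"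
  \<comment> \<open>The witness is found by unification: L(s) is the quotient of c1/\<theta> + c1
    U(s) by its power-law replacement, and \<open>rho\<close> says that it tends to 1.\<close>
  proof (intro exI conjI allI impI)
    fix s :: real assume s: "s > 0"
    have n: "c1 / \<theta> + c1 * S.U s > 0" using c theta S.U_nonneg[of s] by (intro add_pos_nonneg) auto
    from tendsto_mult[OF power_law_const[OF c s] tendsto_const, of "(c1 / \<theta> + c1 * S.U s) / (c1 / \<theta> + s powr \<beta>1 / Gamma (1 + \<beta>1))"]
    show "((\<lambda>t. corr M (X t) (X s) / (1 / (t powr \<beta>1 * Gamma (1 - \<beta>1)) * (c1 / \<theta> + s powr \<beta>1 / Gamma (1 + \<beta>1))))
       \<longlongrightarrow> (c1 / \<theta> + c1 * S.U s) / (c1 / \<theta> + s powr \<beta>1 / Gamma (1 + \<beta>1))) at_top"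
      using n by simp
  qed (rule rho[OF c])
  have d2: "(\<lambda>t. corr M (X t) (X (S t))) \<sim>[at_top]
           (\<lambda>t. 1 / (t powr \<beta>1 * Gamma (1 - \<beta>1)) * (c1 / \<theta> + S t powr \<beta>1 / Gamma (1 + \<beta>1)))"
    if c: "c1 > 0" and S: "filterlim S at_top at_top" "S \<in> o[at_top](\<lambda>t. t)" for S
  proof (rule asymp_equivI')
    have nn: "\<forall>\<^sub>F t in at_top. 0 \<le> S t" using S(1) by (simp add: filterlim_at_top)
    have "((\<lambda>t. S t / t) \<longlongrightarrow> 0) at_top" by (rule smalloD_tendsto[OF S(2)])
    from tendsto_mult[OF power_law[OF c nn this] filterlim_compose[OF rho[OF c] S(1)]]
    have 1: "((\<lambda>t. ?lag t (S t) / (1 / (t powr \<beta>1 * Gamma (1 - \<beta>1)) * (c1 / \<theta> + c1 * S.U (S t))) *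
        ((c1 / \<theta> + c1 * S.U (S t)) / (c1 / \<theta> + S t powr \<beta>1 / Gamma (1 + \<beta>1)))) \<longlongrightarrow> 1) at_top" by (simp only: mult_1_left)
    show "((\<lambda>t. corr M (X t) (X (S t)) / (1 / (t powr \<beta>1 * Gamma (1 - \<beta>1)) * (c1 / \<theta> + S t powr \<beta>1 / Gamma (1 + \<beta>1)))) \<longlongrightarrow> 1) at_top"
    proof (rule Lim_transform_eventually[OF 1])
      show "\<forall>\<^sub>F t in at_top. ?lag t (S t) / (1 / (t powr \<beta>1 * Gamma (1 - \<beta>1)) * (c1 / \<theta> + c1 * S.U (S t))) *
          ((c1 / \<theta> + c1 * S.U (S t)) / (c1 / \<theta> + S t powr \<beta>1 / Gamma (1 + \<beta>1)))
        = corr M (X t) (X (S t)) / (1 / (t powr \<beta>1 * Gamma (1 - \<beta>1)) * (c1 / \<theta> + S t powr \<beta>1 / Gamma (1 + \<beta>1)))"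
        using nn eventually_ge_at_top[of 0]
      proof eventually_elim
        case (elim t)
        have "c1 / \<theta> + c1 * S.U (S t) > 0" using c theta S.U_nonneg[of "S t"] by (intro add_pos_nonneg) auto
        then show ?case using elim by (simp add: corr_eq)
      qed
    qed
  qed
  show ?thesis
    unfolding assms(17)
    by (intro conjI allI impI ballI; (elim conjE)?;
      (rule short long power a1[THEN conjunct1] a1[THEN conjunct2] a2 S.k_fun_density a3 a4 b1 b2 b3 c d1 d2; assumption))
qed

end
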